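(* Let $D$ and $D'$ be equivalent (oriented, virtual) link diagrams with $\mu$ components. Then there is an isomorphism $f:M_A^{\mathrm{enr}}(D)\to M_A^{\mathrm{enr}}(D')$ of enhanced reduced Alexander modules; that is, there is an isomorphism of $\Lambda$-modules $f:M_A^{\mathrm{red}}(D)\to M_A^{\mathrm{red}}(D')$ such that $f(M_i(D))=M_i(D')$ and $f(\chi_i(D))=\chi_i(D')$ for every $i\in\{1,\dots,\mu\}$.
   Context: **Link diagrams.** A link diagram $D$ is an oriented virtual link diagram in $\mathbb R^2$: finitely many oriented, piecewise smooth closed curves $C_1,\dots,C_\mu$ with finitely many (self-)intersections, all transverse double points, each designated classical (with over/under information) or virtual. At each classical crossing the underpassing strand (only) is cut; nothing is cut at virtual crossings. The resulting pieces are the arcs; $A(D)$ is the set of arcs and $C(D)$ the set of classical crossings. $D$ is classical if it has no virtual crossings. $\kappa_D:A(D)\to\{1,\dots,\mu\}$ sends an arc to the index of the component containing it. Two diagrams are equivalent if related by a finite sequence of classical Reidemeister moves (involving only classical crossings) and detour moves (a segment of a curve $C_i$ with no classical crossing is replaced by any other piecewise smooth segment with the same endpoints and no classical crossing); all moves preserve orientations and component indices. A link $L=K_1\cup\dots\cup K_\mu$ is an equivalence class of diagrams, the component $K_i$ being represented by $C_i$. **Crossing data.** For $c\in C(D)$: $a(c)$ is the overpassing arc, $b_1(c)$ the underpassing arc on the right-hand side of the oriented arc $a(c)$, and $b_2(c)$ the underpassing arc on its left-hand side. The writhe $w(c)$ is $+1$ if the underpassing strand is oriented from $b_1(c)$ to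 $b_2(c)$, and $-1$ if it is oriented from $b_2(c)$ to $b_1(c)$. **Reduced Alexander module.** $\Lambda=\mathbb Z[t,t^{-1}]$. $\Lambda^{A(D)},\Lambda^{C(D)}$ are the free $\Lambda$-modules on $A(D),C(D)$. $\varrho_D:\Lambda^{C(D)}\to\Lambda^{A(D)}$ is the $\Lambda$-linear map with $\varrho_D(c)=(1-t)a(c)+tb_1(c)-b_2(c)$. $M_A^{\mathrm{red}}(D)=\operatorname{coker}\varrho_D$, with quotient map $\varsigma_D:\Lambda^{A(D)}\to M_A^{\mathrm{red}}(D)$. **The map $\varphi_D$.** $\epsilon:\Lambda\to\mathbb Z$ is the ring homomorphism with $\epsilon(t^{\pm1})=1$, and $\mathbb Z_\epsilon$ is $\mathbb Z$ with the $\Lambda$-action $\lambda\cdot n=\epsilon(\lambda)n$. $\varphi_D:M_A^{\mathrm{red}}(D)\to\Lambda\oplus(\mathbb Z_\epsilon)^{\mu-1}$ is the $\Lambda$-linear map with $\varphi_D(\varsigma_D(a))=(1,0,\dots,0)$ if $\kappa_D(a)=1$, and $\varphi_D(\varsigma_D(a))=(1,0,\dots,0,1,0,\dots,0)$, with the second $1$ in the $i$th coordinate, if $\kappa_D(a)=i>1$. **Peripheral elements.** $M_i(D)$, the set of meridians of $K_i$, is the set of all $x\in M_A^{\mathrm{red}}(D)$ with $\varphi_D(x)=\varphi_D(\varsigma_D(a))$ for any arc $a$ with $\kappa_D(a)=i$. The longitude of $K_i$ is $$\chi_i(D)=\varsigma_D\Big(\sum_{c\in C(D),\,\kappa_D(b_1(c))=i}w(c)a(c)-\tfrac12\sum_{c\in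 C(D),\,\kappa_D(b_1(c))=i}w(c)(b_1(c)+b_2(c))\Big),$$ where the second sum has all coefficients in $\{-2,0,2\}$ (each arc occurs $0$ or $2$ times as an underpassing arc), so multiplication by $\frac12$ makes sense. **Enhanced module.** $M_A^{\mathrm{enr}}(D)=(M_A^{\mathrm{red}}(D),M_1(D),\dots,M_\mu(D),\chi_1(D),\dots,\chi_\mu(D))$. For $\mu$-component diagrams $D,D'$, an isomorphism $M_A^{\mathrm{enr}}(D)\to M_A^{\mathrm{enr}}(D')$ is a $\Lambda$-module isomorphism $f:M_A^{\mathrm{red}}(D)\to M_A^{\mathrm{red}}(D')$ with $f(M_i(D))=M_i(D')$ and $f(\chi_i(D))=\chi_i(D')$ for all $i$. *)

theory Defs
  imports
    "HOL-Analysis.Analysis"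
    "HOL-Library.Poly_Mapping"
    "HOL-Algebra.Module"
begin

section \<open>Oriented virtual link diagrams\<close>

text \<open>
  The plane is \<^typ>\<open>complex\<close>. The components of a diagram are indexed by \<open>1, \<dots>, ncomp D\<close>; the
  component with index \<open>i\<close> is the closed curve \<open>curve D i\<close>, given as a function on the reals of
  period 1 and oriented by increasing parameter. A point of a component is named by its index and
  its parameter in \<open>{0..<1}\<close>, so that the two branches meeting at a double point have different
  names. The set \<open>classical D\<close> consists of the classical crossings, each one given as the pair
  (name of the overpassing point, name of the underpassing point); all other double points are
  virtual crossings.
\<close>

type_synonym pnt = "nat \<times> real"

type_synonym crossing = "pnt \<times> pnt"

record diagram =
  ncomp :: nat
  curve :: "nat \<Rightarrow> real \<Rightarrow> complex"
  classical :: "crossing set"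

definition points :: "diagram \<Rightarrow> pnt set" where
  "points D = {1..ncomp D} \<times> {0..<1}"

definition position :: "diagram \<Rightarrow> pnt \<Rightarrow> complex" where
  "position D p = curve D (fst p) (snd p)"

definition velocity :: "diagram \<Rightarrow> pnt \<Rightarrow> complex" where
  "velocity D p = vector_derivative (curve D (fst p)) (at (snd p))"

text \<open>The determinant of \<open>(v, w)\<close>: it is positive iff \<open>w\<close> points to the left-hand side of \<open>v\<close>.\<close>

definition det2 :: "complex \<Rightarrow> complex \<Rightarrow> real" where
  "det2 v w = Re v * Im w - Im v * Re w"

text \<open>Every double point of the diagram occurs twice in the following set, once in each order.\<close>

definition double_points :: "diagram \<Rightarrow> crossing set" where
  "double_points D =
    {(p, q). p \<in> points D \<and> q \<in> points D \<and> p \<noteq> q \<and> position D p = position D q}"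

definition link_diagram :: "diagram \<Rightarrow> bool" where
  "link_diagram D \<longleftrightarrow>
    1 \<le> ncomp D \<and>
    (\<forall>i \<in> {1..ncomp D}.
      (\<forall>x. curve D i (x + 1) = curve D i x) \<and>
      curve D i piecewise_C1_differentiable_on {0..1}) \<and>
    finite (double_points D) \<and>
    (\<forall>p q r. (p, q) \<in> double_points D \<and> (p, r) \<in> double_points D \<longrightarrow> q = r) \<and>
    (\<forall>(p, q) \<in> double_points D.
      curve D (fst p) differentiable (at (snd p)) \<and>
      curve D (fst q) differentiable (at (snd q)) \<and>
      det2 (velocity D p) (velocity D q) \<noteq> 0) \<and>
    classical D \<subseteq> double_points D \<and>
    (\<forall>p q. (p, q) \<in> classical D \<longrightarrow> (q, p) \<notin> classical D)"


section \<open>Equivalence of diagrams\<close>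

text \<open>
  A diagram does not change if its curves are reparametrized, respecting the orientations, or if
  the whole picture is moved by an orientation-preserving diffeomorphism of the plane.
\<close>

definition reparametrization :: "diagram \<Rightarrow> diagram \<Rightarrow> bool" where
  "reparametrization D D' \<longleftrightarrow>
    ncomp D' = ncomp D \<and>
    (\<exists>\<phi> :: nat \<Rightarrow> real \<Rightarrow> real.
      (\<forall>i \<in> {1..ncomp D}.
        continuous_on UNIV (\<phi> i) \<and> strict_mono (\<phi> i) \<and>
        (\<forall>x. \<phi> i (x + 1) = \<phi> i x + 1) \<and>
        (\<forall>x. curve D' i x = curve D i (\<phi> i x))) \<and>
      classical D' =
        {((i, x), (j, y)). (i, x) \<in> points D' \<and> (j, y) \<in> points D' \<and>
          ((i, frac (\<phi> i x)), (j, frac (\<phi> j y))) \<in> classical D})"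

definition orientation_preserving_diffeo :: "(complex \<Rightarrow> complex) \<Rightarrow> bool" where
  "orientation_preserving_diffeo h \<longleftrightarrow>
    bij h \<and>
    (\<exists>h' :: complex \<Rightarrow> complex \<Rightarrow> complex.
      (\<forall>z. (h has_derivative h' z) (at z)) \<and>
      (\<forall>v. continuous_on UNIV (\<lambda>z. h' z v)) \<and>
      (\<forall>z. det2 (h' z 1) (h' z \<i>) > 0))"

definition planar_isotopy :: "diagram \<Rightarrow> diagram \<Rightarrow> bool" where
  "planar_isotopy D D' \<longleftrightarrow>
    ncomp D' = ncomp D \<and>
    (\<exists>h. orientation_preserving_diffeo h \<and>
      (\<forall>i \<in> {1..ncomp D}. \<forall>x. curve D' i x = h (curve D i x))) \<and>
    classical D' = classical D"

text \<open>
  The segment \<open>{s..t}\<close> (modulo 1) of the curve with index \<open>i\<close> contains no classical crossing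
  of \<open>D\<close>. Since \<open>D'\<close> has the same classical crossings, all crossings on the new segment are
  virtual.
\<close>

definition detour_move :: "diagram \<Rightarrow> diagram \<Rightarrow> bool" where
  "detour_move D D' \<longleftrightarrow>
    ncomp D' = ncomp D \<and>
    (\<exists>i \<in> {1..ncomp D}. \<exists>s t. s < t \<and> t < s + 1 \<and>
      (\<forall>x. (\<forall>n :: int. x + of_int n \<notin> {s<..<t}) \<longrightarrow> curve D' i x = curve D i x) \<and>
      (\<forall>j \<in> {1..ncomp D} - {i}. \<forall>x. curve D' j x = curve D j x) \<and>
      (\<forall>x \<in> {s..t}. \<forall>q. ((i, frac x), q) \<notin> classical D \<and> (q, (i, frac x)) \<notin> classical D)) \<and>
    classical D' = classical D"

text \<open>
  A classical Reidemeister move replaces the picture inside a disc by another one. Up to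
  diffeomorphisms of the plane, reparametrizations and detours, the disc is the square
  \<open>{z. \<bar>Re z\<bar> \<le> 1 \<and> \<bar>Im z\<bar> \<le> 1}\<close>, and before and after the move the diagram meets it in the
  strands \<open>T 0, \<dots>, T (n - 1)\<close> and \<open>T' 0, \<dots>, T' (n - 1)\<close>, respectively, all parametrized over
  \<open>{-1..1}\<close>. The number \<open>k l\<close> is negative iff the diagram runs through the strand \<open>l\<close> in the
  direction of decreasing parameter, and \<open>h\<close> stacks the strands above each other. For a crossing
  of a strand with itself either choice of the overpassing branch is allowed.
\<close>

definition square :: "complex set" where
  "square = {z. \<bar>Re z\<bar> \<le> 1 \<and> \<bar>Im z\<bar> \<le> 1}"

definition local_move ::
    "nat \<Rightarrow> (nat \<Rightarrow> real \<Rightarrow> complex) \<Rightarrow> (nat \<Rightarrow> real \<Rightarrow> complex) \<Rightarrow> diagram \<Rightarrow> diagram \<Rightarrow> bool" where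
  "local_move n T T' D D' \<longleftrightarrow>
    ncomp D' = ncomp D \<and>
    (\<exists>(c :: nat \<Rightarrow> nat) (m :: nat \<Rightarrow> real) (k :: nat \<Rightarrow> real) (h :: nat \<Rightarrow> nat) (S :: nat \<Rightarrow> pnt set).
      (\<forall>l < n.
        c l \<in> {1..ncomp D} \<and> 0 < \<bar>k l\<bar> \<and> \<bar>k l\<bar> < 1/2 \<and>
        S l = {(c l, frac (m l + k l * v)) | v. v \<in> {-1..1}} \<and>
        (\<forall>v \<in> {-1..1}.
          curve D (c l) (m l + k l * v) = T l v \<and> curve D' (c l) (m l + k l * v) = T' l v)) \<and>
      disjoint_family_on S {..<n} \<and>
      (\<forall>p \<in> points D - (\<Union>l<n. S l).
        position D p \<notin> square \<and> position D' p = position D p) \<and>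
      inj_on h {..<n} \<and>
      (\<forall>E \<in> {D, D'}.
        (\<forall>l < n. \<forall>p \<in> S l. \<forall>q. (p, q) \<in> double_points E \<longrightarrow>
          (p, q) \<in> classical E \<or> (q, p) \<in> classical E) \<and>
        (\<forall>l < n. \<forall>l' < n. \<forall>p \<in> S l. \<forall>q \<in> S l'. l \<noteq> l' \<and> (p, q) \<in> classical E \<longrightarrow>
          h l' < h l)) \<and>
      (\<forall>p \<in> points D - (\<Union>l<n. S l). \<forall>q \<in> points D - (\<Union>l<n. S l).
        (p, q) \<in> classical D' \<longleftrightarrow> (p, q) \<in> classical D))"

text \<open>
  First move: the kink is an arc of the nodal cubic, with its double point at \<open>v = 1 / sqrt 2\<close>
  and \<open>v = - 1 / sqrt 2\<close>. Second move: a bent strand crosses the real axis at \<open>v = -1/2\<close> and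
  \<open>v = 1/2\<close>, or stays above it. Third move: a roof passes above the crossing of the two diagonals
  of the square, or below it.
\<close>

definition reidemeister1 :: "diagram \<Rightarrow> diagram \<Rightarrow> bool" where
  "reidemeister1 = local_move 1
    (\<lambda>_ v. Complex (2 * v ^ 3 - v) ((1 - v\<^sup>2) / 2))
    (\<lambda>_ v. Complex v 0)"

definition reidemeister2 :: "diagram \<Rightarrow> diagram \<Rightarrow> bool" where
  "reidemeister2 = local_move 2
    (\<lambda>l v. if l = 0 then Complex v 0 else Complex v (\<bar>v\<bar> - 1/2))
    (\<lambda>l v. if l = 0 then Complex v 0 else Complex v (1/2))"

definition reidemeister3 :: "diagram \<Rightarrow> diagram \<Rightarrow> bool" where
  "reidemeister3 = local_move 3
    (\<lambda>l v. if l = 0 then Complex v v else if l = 1 then Complex v (- v)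
       else Complex v ((1 - \<bar>v\<bar>) / 2))
    (\<lambda>l v. if l = 0 then Complex v v else if l = 1 then Complex v (- v)
       else Complex v (- (1 - \<bar>v\<bar>) / 2))"

inductive diagram_move :: "diagram \<Rightarrow> diagram \<Rightarrow> bool" for D D' where
  "\<lbrakk>link_diagram D; link_diagram D';
    reparametrization D D' \<or> planar_isotopy D D' \<or> detour_move D D' \<or>
    reidemeister1 D D' \<or> reidemeister2 D D' \<or> reidemeister3 D D'\<rbrakk>
   \<Longrightarrow> diagram_move D D'"

definition diagram_equivalent :: "diagram \<Rightarrow> diagram \<Rightarrow> bool" where
  "diagram_equivalent = equivclp diagram_move"


section \<open>Arcs and crossing data\<close>

definition under_params :: "diagram \<Rightarrow> nat \<Rightarrow> real set" where
  "under_params D i = {x. \<exists>p. (p, (i, frac x)) \<in> classical D}"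

text \<open>
  An arc is represented by the set of all pairs \<open>(i, x)\<close>, where \<open>i\<close> is the index of its component
  and \<open>x\<close> is a parameter (not only in \<open>{0..<1}\<close>) of one of its points.
\<close>

type_synonym arc = "(nat \<times> real) set"

definition arc_of :: "diagram \<Rightarrow> nat \<Rightarrow> real \<Rightarrow> arc" where
  "arc_of D i x =
    {(i, y) | y. \<exists>n :: int. closed_segment x (y + of_int n) \<inter> under_params D i = {}}"

definition arcs :: "diagram \<Rightarrow> arc set" where
  "arcs D = {arc_of D i x | i x. i \<in> {1..ncomp D} \<and> x \<notin> under_params D i}"

definition component_of :: "arc \<Rightarrow> nat" where
  "component_of a = (THE i. \<exists>x. (i, x) \<in> a)"

definition over_arc :: "diagram \<Rightarrow> crossing \<Rightarrow> arc" where
  "over_arc D c = (case fst c of (i, x) \<Rightarrow> arc_of D i x)"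

text \<open>The underpassing arcs just before and just after the crossing.\<close>

definition incoming_arc :: "diagram \<Rightarrow> crossing \<Rightarrow> arc" where
  "incoming_arc D c = (case snd c of (i, x) \<Rightarrow>
    {(i, y) | y. eventually (\<lambda>u. (i, y) \<in> arc_of D i u) (at_left x)})"

definition outgoing_arc :: "diagram \<Rightarrow> crossing \<Rightarrow> arc" where
  "outgoing_arc D c = (case snd c of (i, x) \<Rightarrow>
    {(i, y) | y. eventually (\<lambda>u. (i, y) \<in> arc_of D i u) (at_right x)})"

text \<open>
  The underpassing strand goes from the right-hand side of the overpassing strand to its left-hand
  side. For a component with a single undercrossing the two underpassing arcs coincide, so this
  has to be expressed by the strands and not by the arcs.
\<close>

definition right_to_left :: "diagram \<Rightarrow> crossing \<Rightarrow> bool" where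
  "right_to_left D c \<longleftrightarrow> det2 (velocity D (fst c)) (velocity D (snd c)) > 0"

definition b1 :: "diagram \<Rightarrow> crossing \<Rightarrow> arc" where
  "b1 D c = (if right_to_left D c then incoming_arc D c else outgoing_arc D c)"

definition b2 :: "diagram \<Rightarrow> crossing \<Rightarrow> arc" where
  "b2 D c = (if right_to_left D c then outgoing_arc D c else incoming_arc D c)"

definition writhe :: "diagram \<Rightarrow> crossing \<Rightarrow> int" where
  "writhe D c = (if right_to_left D c then 1 else -1)"


section \<open>The reduced Alexander module\<close>

text \<open>
  Multiplication of \<^typ>\<open>int \<Rightarrow>\<^sub>0 int\<close> is convolution, so this is the ring of Laurent polynomials
  in one variable over the integers.
\<close>

type_synonym laurent = "int \<Rightarrow>\<^sub>0 int"

definition tvar :: laurent where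
  "tvar = Poly_Mapping.single 1 1"

definition Laurent_ring :: "laurent ring" where
  "Laurent_ring = \<lparr>carrier = UNIV, mult = (*), one = 1, zero = 0, add = (+)\<rparr>"

definition augmentation :: "laurent \<Rightarrow> int" where
  "augmentation l = (\<Sum>n \<in> Poly_Mapping.keys l. Poly_Mapping.lookup l n)"

text \<open>The free module on a finite set \<open>A\<close>, with basis \<open>basis a\<close> for \<open>a \<in> A\<close>.\<close>

definition free_module :: "'a set \<Rightarrow> ('a \<Rightarrow> laurent) set" where
  "free_module A = {x. \<forall>a. a \<notin> A \<longrightarrow> x a = 0}"

definition basis :: "'a \<Rightarrow> 'a \<Rightarrow> laurent" where
  "basis a = (\<lambda>b. if b = a then 1 else 0)"

definition rho :: "diagram \<Rightarrow> (crossing \<Rightarrow> laurent) \<Rightarrow> (arc \<Rightarrow> laurent)" where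
  "rho D y = (\<lambda>a. \<Sum>c \<in> classical D. y c *
    ((1 - tvar) * basis (over_arc D c) a + tvar * basis (b1 D c) a - basis (b2 D c) a))"

text \<open>The quotient map to the cokernel of \<open>rho D\<close>, whose elements are the cosets of the image.\<close>

definition quot :: "diagram \<Rightarrow> (arc \<Rightarrow> laurent) \<Rightarrow> (arc \<Rightarrow> laurent) set" where
  "quot D x = {\<lambda>a. x a + rho D y a | y. y \<in> free_module (classical D)}"

text \<open>The fields \<open>mult\<close> and \<open>one\<close> have no meaning for a module.\<close>

definition M_red :: "diagram \<Rightarrow> (laurent, (arc \<Rightarrow> laurent) set) module" where
  "M_red D =
    \<lparr>carrier = quot D ` free_module (arcs D),
     mult = undefined, one = undefined,
     zero = quot D (\<lambda>_. 0),
     add = (\<lambda>X Y. \<Union>x \<in> X. \<Union>y \<in> Y. quot D (\<lambda>a. x a + y a)),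
     smult = (\<lambda>r X. \<Union>x \<in> X. quot D (\<lambda>a. r * x a))\<rparr>"

lemma rho_add: "rho D (\<lambda>c. y c + z c) a = rho D y a + rho D z a"
  by (simp add: rho_def distrib_right sum.distrib)

lemma rho_scale: "rho D (\<lambda>c. r * y c) a = r * rho D y a"
  by (simp add: rho_def sum_distrib_left mult.assoc)

lemma quot_self: "x \<in> quot D x"
proof -
  have "rho D (\<lambda>_. 0) = (\<lambda>_. 0)"
    by (simp add: rho_def)
  moreover have "(\<lambda>_. 0) \<in> free_module (classical D)"
    by (simp add: free_module_def)
  ultimately show ?thesis
    unfolding quot_def by (force intro: exI[of _ "\<lambda>_. 0"])
qed

lemma quot_shift:
  assumes y: "y \<in> free_module (classical D)"
  shows "quot D (\<lambda>a. x a + rho D y a) = quot D x"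
proof (intro equalityI subsetI)
  fix u assume "u \<in> quot D (\<lambda>a. x a + rho D y a)"
  then obtain z where z: "z \<in> free_module (classical D)" "u = (\<lambda>a. x a + rho D y a + rho D z a)"
    unfolding quot_def by blast
  have "(\<lambda>c. y c + z c) \<in> free_module (classical D)"
    using y z(1) by (simp add: free_module_def)
  moreover have "u = (\<lambda>a. x a + rho D (\<lambda>c. y c + z c) a)"
    by (simp add: z(2) rho_add add.assoc)
  ultimately show "u \<in> quot D x"
    unfolding quot_def by blast
next
  fix u assume "u \<in> quot D x"
  then obtain z where z: "z \<in> free_module (classical D)" "u = (\<lambda>a. x a + rho D z a)"
    unfolding quot_def by blast
  have "(\<lambda>c. z c + (-1) * y c) \<in> free_module (classical D)"
    using y z(1) by (simp add: free_module_def)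
  moreover have "u = (\<lambda>a. x a + rho D y a + rho D (\<lambda>c. z c + (-1) * y c) a)"
    unfolding rho_add rho_scale by (simp add: z(2))
  ultimately show "u \<in> quot D (\<lambda>a. x a + rho D y a)"
    unfolding quot_def by blast
qed

lemma M_red_add: "quot D x \<oplus>\<^bsub>M_red D\<^esub> quot D y = quot D (\<lambda>a. x a + y a)"
proof -
  have "quot D (\<lambda>a. u a + v a) = quot D (\<lambda>a. x a + y a)" if u: "u \<in> quot D x" and v: "v \<in> quot D y" for u v
  proof -
    obtain z w where z: "z \<in> free_module (classical D)" "u = (\<lambda>a. x a + rho D z a)"
      and w: "w \<in> free_module (classical D)" "v = (\<lambda>a. y a + rho D w a)"
      using u v unfolding quot_def by blast
    have "(\<lambda>c. z c + w c) \<in> free_module (classical D)"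
      using z(1) w(1) by (simp add: free_module_def)
    from quot_shift[OF this, of "\<lambda>a. x a + y a"] show ?thesis
      by (simp add: z(2) w(2) rho_add algebra_simps)
  qed
  then have "(\<Union>u \<in> quot D x. \<Union>v \<in> quot D y. quot D (\<lambda>a. u a + v a)) =
      (\<Union>u \<in> quot D x. \<Union>v \<in> quot D y. quot D (\<lambda>a. x a + y a))"
    by (intro SUP_cong refl)
  also have "\<dots> = quot D (\<lambda>a. x a + y a)"
    using quot_self[of x D] quot_self[of y D] by auto
  finally show ?thesis
    by (simp add: M_red_def)
qed

lemma M_red_smult: "r \<odot>\<^bsub>M_red D\<^esub> quot D x = quot D (\<lambda>a. r * x a)"
proof -
  have "quot D (\<lambda>a. r * u a) = quot D (\<lambda>a. r * x a)" if u: "u \<in> quot D x" for u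
  proof -
    obtain z where z: "z \<in> free_module (classical D)" "u = (\<lambda>a. x a + rho D z a)"
      using u unfolding quot_def by blast
    have "(\<lambda>c. r * z c) \<in> free_module (classical D)"
      using z(1) by (simp add: free_module_def)
    from quot_shift[OF this, of "\<lambda>a. r * x a"] show ?thesis
      by (simp add: z(2) rho_scale algebra_simps)
  qed
  then have "(\<Union>u \<in> quot D x. quot D (\<lambda>a. r * u a)) = (\<Union>u \<in> quot D x. quot D (\<lambda>a. r * x a))"
    by (intro SUP_cong refl)
  also have "\<dots> = quot D (\<lambda>a. r * x a)"
    using quot_self[of x D] by auto
  finally show ?thesis
    by (simp add: M_red_def)
qed

lemma cring_Laurent_ring: "cring Laurent_ring"
proof (rule cringI)
  show "abelian_group Laurent_ring"
    by (rule abelian_groupI) (auto simp: Laurent_ring_def algebra_simps intro: exI[of _ "- _"])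
  show "comm_monoid Laurent_ring"
    by (rule comm_monoidI) (auto simp: Laurent_ring_def algebra_simps)
qed (auto simp: Laurent_ring_def algebra_simps)

lemma module_M_red: "module Laurent_ring (M_red D)"
proof -
  have carr: "carrier (M_red D) = quot D ` free_module (arcs D)"
    and zero: "\<zero>\<^bsub>M_red D\<^esub> = quot D (\<lambda>_. 0)"
    by (simp_all add: M_red_def)
  note simps = carr zero free_module_def M_red_add M_red_smult Laurent_ring_def algebra_simps
  have inverse: "\<exists>Y \<in> carrier (M_red D). Y \<oplus>\<^bsub>M_red D\<^esub> X = \<zero>\<^bsub>M_red D\<^esub>"
    if X: "X \<in> carrier (M_red D)" for X
  proof -
    obtain x where x: "x \<in> free_module (arcs D)" "X = quot D x"
      using X unfolding carr by blast
    have "quot D (\<lambda>a. - x a) \<in> carrier (M_red D)"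
      using x(1) by (simp add: carr free_module_def)
    moreover have "quot D (\<lambda>a. - x a) \<oplus>\<^bsub>M_red D\<^esub> X = \<zero>\<^bsub>M_red D\<^esub>"
      by (simp add: x(2) M_red_add zero)
    ultimately show ?thesis ..
  qed
  have group: "abelian_group (M_red D)"
    by (rule abelian_groupI) (use inverse in \<open>auto simp: simps\<close>)
  show ?thesis
    by (rule Module.moduleI[OF cring_Laurent_ring group]) (auto simp: simps)
qed


section \<open>Peripheral elements and the enhanced module\<close>

text \<open>
  The direct sum of the Laurent polynomial ring and \<open>ncomp D - 1\<close> copies of the integers is
  realized as pairs of a Laurent polynomial and a family of integers, the coordinates of the family
  being those with indices \<open>2, \<dots>, ncomp D\<close>. The linear map sending \<open>basis a\<close> to \<open>1\<close> together with
  the coordinate vector of the component of \<open>a\<close> is constant on the cosets of the image of \<open>rho D\<close>.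
\<close>

definition phi_lift :: "diagram \<Rightarrow> (arc \<Rightarrow> laurent) \<Rightarrow> laurent \<times> (nat \<Rightarrow> int)" where
  "phi_lift D x =
    (\<Sum>a \<in> arcs D. x a,
     \<lambda>i. if i \<in> {2..ncomp D} then \<Sum>a \<in> {a \<in> arcs D. component_of a = i}. augmentation (x a) else 0)"

definition phi :: "diagram \<Rightarrow> (arc \<Rightarrow> laurent) set \<Rightarrow> laurent \<times> (nat \<Rightarrow> int)" where
  "phi D X = phi_lift D (SOME x. x \<in> X)"

definition meridians :: "diagram \<Rightarrow> nat \<Rightarrow> (arc \<Rightarrow> laurent) set set" where
  "meridians D i =
    {X \<in> carrier (M_red D).
      \<forall>a \<in> arcs D. component_of a = i \<longrightarrow> phi D X = phi D (quot D (basis a))}"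

text \<open>
  The integer divided by 2 is the coefficient of the arc \<open>a\<close> in the second sum of the
  definition of the longitude; it is even.
\<close>

definition longitude :: "diagram \<Rightarrow> nat \<Rightarrow> (arc \<Rightarrow> laurent) set" where
  "longitude D i =
    (let C = {c \<in> classical D. component_of (b1 D c) = i}
     in quot D (\<lambda>a.
       (\<Sum>c \<in> C. of_int (writhe D c) * basis (over_arc D c) a) -
       of_int ((\<Sum>c \<in> C. writhe D c * (of_bool (a = b1 D c) + of_bool (a = b2 D c))) div 2)))"

type_synonym enhanced_module =
  "(laurent, (arc \<Rightarrow> laurent) set) module \<times>
   (nat \<Rightarrow> (arc \<Rightarrow> laurent) set set) \<times> (nat \<Rightarrow> (arc \<Rightarrow> laurent) set)"

definition M_enr :: "diagram \<Rightarrow> enhanced_module" where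
  "M_enr D = (M_red D, meridians D, longitude D)"

definition module_iso :: "('r, 'm) ring_scheme \<Rightarrow> ('r, 'a, 's) module_scheme
    \<Rightarrow> ('r, 'b, 't) module_scheme \<Rightarrow> ('a \<Rightarrow> 'b) set" where
  "module_iso R M N =
    {f \<in> iso (add_monoid M) (add_monoid N).
      \<forall>r \<in> carrier R. \<forall>x \<in> carrier M. f (r \<odot>\<^bsub>M\<^esub> x) = r \<odot>\<^bsub>N\<^esub> f x}"

definition enhanced_iso :: "nat \<Rightarrow> enhanced_module \<Rightarrow> enhanced_module
    \<Rightarrow> ((arc \<Rightarrow> laurent) set \<Rightarrow> (arc \<Rightarrow> laurent) set) set" where
  "enhanced_iso \<mu> E E' =
    (case (E, E') of ((M, m, l), (M', m', l')) \<Rightarrow>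
      {f \<in> module_iso Laurent_ring M M'. \<forall>i \<in> {1..\<mu>}. f ` m i = m' i \<and> f (l i) = l' i})"

end

theory Submission
  imports Defs "HOL-Library.Function_Algebras"
begin

text \<open>
  The reduced Alexander module is the universal module of colours of the points of the diagram,
  subject to local relations: passing under a strand of colour \<open>a\<close> replaces the colour \<open>x\<close> by
  \<open>a + t (x - a)\<close> or \<open>a + t^(-1) (x - a)\<close>, depending on the side it comes from. In these terms the
  longitude of a component is a sum of local contributions of its undercrossings. Suppose that
  the strands inside the disc of a Reidemeister move, once coloured before the move, can be
  coloured after the move with the same colours at their ends and the same contributions of each
  strand to the longitudes. Glued with the old colours outside the disc this is a colouring of the
  new diagram by the old module, that is, a linear map between the modules. It respects
  the longitudes and the values of \<open>\<phi>\<close> on meridians, and the map for the reverse move is its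
  inverse because both fix the colours outside the disc, which generate the modules.
  The other moves only rename the arcs.
\<close>

section \<open>Laurent polynomials and their modules\<close>

text \<open>An arc that leaves the disc of a move may return to it anywhere, so a comparison of the
  arcs before and after the move would involve the whole diagram. Colours of points, required only
  to be locally constant off the undercrossings, avoid this: gluing can be checked near each point
  separately. The overlap that makes gluing possible is the collar 3/4 \<le> |v| < 1 of every
  strand. It is free of crossings, because the local pictures cross only at |v| = 1/sqrt 2, 1/2, 1/3
  and 0. The coefficient \<open>kap \<eta>\<close> in the longitude is (\<open>lpow \<eta>\<close> -
  1) / (t - 1). Hence 1 - t times the contribution of a crossing is the change of colour at it, and
  the invariance of longitudes under the second and third move is that of the total change of
  colour, divided by 1 - t; under the first move no colour changes. Neither the orientations nor the
  order of heights need separate treatment: walking along a strand backwards inverts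
  \<open>lpow\<close> and negates the contribution, and the heights and slopes enter only through a
  few Boolean flags.\<close>

definition tinv :: laurent where
  "tinv = Poly_Mapping.single (-1) 1"

lemma tvar_tinv [simp]: "tvar * tinv = 1" "tinv * tvar = 1"
  by (simp_all add: tvar_def tinv_def mult_single)

lemma augmentation_superset:
  assumes "finite A" "Poly_Mapping.keys p \<subseteq> A"
  shows "augmentation p = (\<Sum>n\<in>A. Poly_Mapping.lookup p n)"
  unfolding augmentation_def using assms by (intro sum.mono_neutral_left) (auto simp: in_keys_iff)

lemma augmentation_add [simp]: "augmentation (p + q) = augmentation p + augmentation q"
proof -
  let ?A = "Poly_Mapping.keys p \<union> Poly_Mapping.keys q"
  have "augmentation (p + q) = (\<Sum>n\<in>?A. Poly_Mapping.lookup (p + q) n)"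
    by (rule augmentation_superset) (use keys_add[of p q] in auto)
  also have "\<dots> = augmentation p + augmentation q"
    by (simp add: lookup_add sum.distrib augmentation_superset[of ?A])
  finally show ?thesis .
qed

lemma augmentation_single [simp]: "augmentation (Poly_Mapping.single n k) = k"
  by (simp add: augmentation_def)

lemma augmentation_0 [simp]: "augmentation 0 = 0"
  by (simp add: augmentation_def)

lemma augmentation_uminus [simp]: "augmentation (- p) = - augmentation p"
  using augmentation_add[of p "- p"] by simp

lemma augmentation_diff [simp]: "augmentation (p - q) = augmentation p - augmentation q"
  using augmentation_add[of p "- q"] by simp

text \<open>As a type, the Laurent polynomials are the formal integer combinations of exponents, so
  the induction principle for free abelian groups reduces first one factor and then the other to a
  monomial.\<close>

lemma augmentation_mult [simp]: "augmentation (p * q) = augmentation p * augmentation q"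
proof (induction p rule: frag_induction[OF subset_UNIV, case_names zero one diff])
  case (one k)
  show ?case
    by (induction q rule: frag_induction[OF subset_UNIV, case_names zero one diff])
      (simp_all add: mult_single right_diff_distrib)
qed (simp_all add: left_diff_distrib)

lemma augmentation_1 [simp]: "augmentation 1 = 1"
  using augmentation_single[of 0 1] by simp

lemma augmentation_tvar [simp]: "augmentation tvar = 1"
  by (simp add: tvar_def)

definition scl :: "laurent \<Rightarrow> ('a \<Rightarrow> laurent) \<Rightarrow> 'a \<Rightarrow> laurent" (infixr \<open>*\<^sub>L\<close> 75) where
  "r *\<^sub>L x = (\<lambda>a. r * x a)"

lemma scl_apply [simp]: "(r *\<^sub>L x) a = r * x a"
  by (simp add: scl_def)

text \<open>This makes the general theory of modules over a commutative ring available for functions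
  with pointwise operations; submodules appear below as \<open>lmod.subspace\<close>.\<close>

interpretation lmod: Modules.module "scl :: laurent \<Rightarrow> ('a \<Rightarrow> laurent) \<Rightarrow> 'a \<Rightarrow> laurent"
  by standard (auto simp: fun_eq_iff algebra_simps)

definition lpow :: "bool \<Rightarrow> laurent" where
  "lpow \<eta> = (if \<eta> then tvar else tinv)"

lemma lpow_not [simp]: "lpow \<eta> * lpow (\<not> \<eta>) = 1" "lpow (\<not> \<eta>) * lpow \<eta> = 1"
  by (auto simp: lpow_def)

text \<open>
  Walking under a strand of colour \<open>a\<close> turns the colour \<open>x\<close> into \<open>under \<eta> a x\<close>, where \<open>\<eta>\<close> says
  whether the walk leads from the right-hand side of that strand to its left-hand side. This form
  of the crossing relation depends on the direction of the walk, but not on the orientation of the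
  underpassing strand.
\<close>

definition under :: "bool \<Rightarrow> ('a \<Rightarrow> laurent) \<Rightarrow> ('a \<Rightarrow> laurent) \<Rightarrow> 'a \<Rightarrow> laurent" where
  "under \<eta> a x = a + lpow \<eta> *\<^sub>L (x - a)"

text \<open>The algebraic content of the second move: the lower strand meets the same colour twice,
  from opposite sides.\<close>

lemma under_inverse [simp]: "under (\<not> \<eta>) a (under \<eta> a x) = x"
  by (simp add: under_def)

text \<open>The algebraic content of the first move: in a kink a strand passes under itself.\<close>

lemma under_self [simp]: "under \<eta> a a = a"
  by (simp add: under_def)

text \<open>The algebraic content of the third Reidemeister move.\<close>

lemma under_under: "under \<eta> a (under \<theta> b x) = under \<theta> (under \<eta> a b) (under \<eta> a x)"
  by (simp add: under_def algebra_simps)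

text \<open>
  A crossing contributes \<open>kap \<eta> *\<^sub>L (a - x)\<close> to the longitude, where \<open>x\<close> is the colour before the
  crossing.
\<close>

definition kap :: "bool \<Rightarrow> laurent" where
  "kap \<eta> = (if \<eta> then 1 else - tinv)"

text \<open>Walking backwards, the colour before the crossing is \<open>under \<eta> a x\<close>,
  and \<open>a - under \<eta> a x\<close> is \<open>lpow \<eta>\<close> times \<open>a - x\<close>.
  So this identity says that reversing the walk negates the contribution of the crossing.\<close>

lemma kap_not: "kap (\<not> \<eta>) * lpow \<eta> = - kap \<eta>"
  by (simp add: kap_def lpow_def)

section \<open>Congruence modulo a submodule, and one-sided colours\<close>

locale congruence =
  fixes K :: "('a \<Rightarrow> laurent) set"
  assumes subspace_K: "lmod.subspace K"
begin

text \<open>The submodule will be the relations of a diagram, so the quotient varies with the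
  diagram. Calculations therefore stay with representatives, and equality in the quotient is this
  relation.\<close>

definition cong :: "('a \<Rightarrow> laurent) \<Rightarrow> ('a \<Rightarrow> laurent) \<Rightarrow> bool" (infix \<open>\<doteq>\<close> 50) where
  "x \<doteq> y \<longleftrightarrow> x - y \<in> K"

lemma cong_refl [simp, intro]: "x \<doteq> x"
  by (simp add: cong_def lmod.subspace_0[OF subspace_K])

lemma cong_sym: "x \<doteq> y \<Longrightarrow> y \<doteq> x"
  unfolding cong_def using lmod.subspace_neg[OF subspace_K, of "x - y"] by simp

lemma cong_trans [trans]: "x \<doteq> y \<Longrightarrow> y \<doteq> z \<Longrightarrow> x \<doteq> z"
  unfolding cong_def using lmod.subspace_add[OF subspace_K, of "x - y" "y - z"] by simp

lemma cong_eq [trans]: "x \<doteq> y \<Longrightarrow> y = z \<Longrightarrow> x \<doteq> z" and eq_cong [trans]: "x = y \<Longrightarrow> y \<doteq> z \<Longrightarrow> x \<doteq> z"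
  by simp_all

lemma cong_trans_sym: "x \<doteq> y \<Longrightarrow> z \<doteq> y \<Longrightarrow> x \<doteq> z"
  by (metis cong_sym cong_trans)

lemma cong_add: "x \<doteq> y \<Longrightarrow> x' \<doteq> y' \<Longrightarrow> x + x' \<doteq> y + y'"
  unfolding cong_def using lmod.subspace_add[OF subspace_K, of "x - y" "x' - y'"]
  by (simp add: algebra_simps)

lemma cong_diff: "x \<doteq> y \<Longrightarrow> x' \<doteq> y' \<Longrightarrow> x - x' \<doteq> y - y'"
  unfolding cong_def using lmod.subspace_diff[OF subspace_K, of "x - y" "x' - y'"]
  by (simp add: algebra_simps)

lemma cong_scale: "x \<doteq> y \<Longrightarrow> r *\<^sub>L x \<doteq> r *\<^sub>L y"
  unfolding cong_def using lmod.subspace_scale[OF subspace_K, of "x - y" r]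
  by (simp add: algebra_simps)

lemma cong_sum: "(\<And>a. a \<in> A \<Longrightarrow> f a \<doteq> g a) \<Longrightarrow> sum f A \<doteq> sum g A"
  by (induction A rule: infinite_finite_induct) (auto intro: cong_add)

lemma cong_under: "a \<doteq> a' \<Longrightarrow> x \<doteq> x' \<Longrightarrow> under \<eta> a x \<doteq> under \<eta> a' x'"
  unfolding under_def by (intro cong_add cong_scale cong_diff)

lemma under_cong_flip: "y \<doteq> under \<eta> a x \<Longrightarrow> x \<doteq> under (\<not> \<eta>) a y"
  using cong_under[of a a y "under \<eta> a x" "\<not> \<eta>"] cong_sym by auto

text \<open>The colours just before and just after the parameter \<open>x\<close>.\<close>

definition sides :: "(real \<Rightarrow> 'a \<Rightarrow> laurent) \<Rightarrow> real \<Rightarrow> ('a \<Rightarrow> laurent) \<Rightarrow> ('a \<Rightarrow> laurent) \<Rightarrow> bool" where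
  "sides f x B B' \<longleftrightarrow> (\<exists>e>0. \<forall>d. 0 < d \<and> d < e \<longrightarrow> f (x - d) \<doteq> B \<and> f (x + d) \<doteq> B')"

text \<open>Continuity at \<open>x\<close> with respect to the discrete topology on the quotient by
  \<open>K\<close>.\<close>

abbreviation loc_const :: "(real \<Rightarrow> 'a \<Rightarrow> laurent) \<Rightarrow> real \<Rightarrow> bool" where
  "loc_const f x \<equiv> sides f x (f x) (f x)"

lemma sides_unique:
  assumes "sides f x B B'" "sides f x C C'"
  shows "B \<doteq> C" "B' \<doteq> C'"
proof -
  obtain e where e: "e > 0" "\<And>d. 0 < d \<Longrightarrow> d < e \<Longrightarrow> f (x - d) \<doteq> B \<and> f (x + d) \<doteq> B'"
    using assms(1) unfolding sides_def by blast
  obtain e' where e': "e' > 0" "\<And>d. 0 < d \<Longrightarrow> d < e' \<Longrightarrow> f (x - d) \<doteq> C \<and> f (x + d) \<doteq> C'"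
    using assms(2) unfolding sides_def by blast
  define d where "d = min e e' / 2"
  have "0 < d" "d < e" "d < e'"
    using e(1) e'(1) by (auto simp: d_def min_def)
  then show "B \<doteq> C" "B' \<doteq> C'"
    using e(2)[of d] e'(2)[of d] cong_sym cong_trans by blast+
qed

lemma sides_cong: "sides f x B B' \<Longrightarrow> B \<doteq> C \<Longrightarrow> B' \<doteq> C' \<Longrightarrow> sides f x C C'"
  unfolding sides_def using cong_trans by blast

text \<open>The point \<open>x\<close> itself is exempt from the comparison, because
  \<open>x\<close> may be an undercrossing, where the colour is a mere placeholder.\<close>

lemma sides_near:
  assumes "sides f x B B'" "e > 0" "\<And>y. y \<noteq> x \<Longrightarrow> \<bar>y - x\<bar> < e \<Longrightarrow> g y \<doteq> f y"
  shows "sides g x B B'"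
proof -
  obtain e' where e': "e' > 0" "\<And>d. 0 < d \<Longrightarrow> d < e' \<Longrightarrow> f (x - d) \<doteq> B \<and> f (x + d) \<doteq> B'"
    using assms(1) unfolding sides_def by blast
  show ?thesis
    unfolding sides_def
  proof (intro exI[of _ "min e e'"] conjI allI impI)
    fix d assume d: "0 < d \<and> d < min e e'"
    show "g (x - d) \<doteq> B" "g (x + d) \<doteq> B'"
      using d e'(2)[of d] assms(3)[of "x - d"] assms(3)[of "x + d"] cong_trans by auto
  qed (use assms(2) e'(1) in auto)
qed

lemma sides_const: "e > 0 \<Longrightarrow> (\<And>y. y \<noteq> x \<Longrightarrow> \<bar>y - x\<bar> < e \<Longrightarrow> g y \<doteq> B) \<Longrightarrow> sides g x B B"
  by (rule sides_near[of "\<lambda>_. B"]) (auto simp: sides_def intro: exI[of _ 1])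

lemma sides_affine:
  assumes "sides f (m + k * v) B B'" "k \<noteq> 0"
  shows "sides (\<lambda>v. f (m + k * v)) v (if k > 0 then B else B') (if k > 0 then B' else B)"
proof -
  obtain e where e: "e > 0" "\<And>d. 0 < d \<Longrightarrow> d < e \<Longrightarrow> f (m + k * v - d) \<doteq> B \<and> f (m + k * v + d) \<doteq> B'"
    using assms(1) unfolding sides_def by blast
  show ?thesis
    unfolding sides_def
  proof (intro exI[of _ "e / \<bar>k\<bar>"] conjI allI impI)
    fix d assume d: "0 < d \<and> d < e / \<bar>k\<bar>"
    then have "0 < \<bar>k\<bar> * d" "\<bar>k\<bar> * d < e"
      using assms(2) by (auto simp: field_simps)
    then show "f (m + k * (v - d)) \<doteq> (if k > 0 then B else B')"
      "f (m + k * (v + d)) \<doteq> (if k > 0 then B' else B)"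
      using e(2)[of "\<bar>k\<bar> * d"] by (auto simp: algebra_simps abs_if split: if_splits)
  qed (use e(1) assms(2) in auto)
qed

lemma loc_const_connected:
  assumes "\<And>z. z \<in> closed_segment x y \<Longrightarrow> loc_const f z"
  shows "f x \<doteq> f y"
proof -
  \<comment> \<open>\<open>connected_local_const\<close> speaks about equality of values, so every
    colour is replaced by its congruence class.\<close>
  define c where "c = (\<lambda>z. {u. u \<doteq> f z})"
  have ceq: "c z = c w" if "f w \<doteq> f z" for z w
    using that unfolding c_def by (auto intro: cong_trans cong_trans_sym)
  have "c x = c y"
  proof (rule connected_local_const[of "closed_segment x y"])
    show "\<forall>a\<in>closed_segment x y. eventually (\<lambda>b. c a = c b) (at a within closed_segment x y)"
    proof
      fix z assume "z \<in> closed_segment x y"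
      from assms[OF this] obtain e where e: "e > 0"
        "\<And>d. 0 < d \<Longrightarrow> d < e \<Longrightarrow> f (z - d) \<doteq> f z \<and> f (z + d) \<doteq> f z"
        unfolding sides_def by blast
      have "c z = c w" if "w \<noteq> z" "dist w z < e" for w
      proof (cases "w < z")
        case True
        with that e(2)[of "z - w"] show ?thesis by (intro ceq) (auto simp: dist_real_def)
      next
        case False
        with that e(2)[of "w - z"] show ?thesis by (intro ceq) (auto simp: dist_real_def)
      qed
      then show "eventually (\<lambda>b. c z = c b) (at z within closed_segment x y)"
        unfolding eventually_at using e(1) by blast
    qed
  qed auto
  then have "f x \<in> c y" by (auto simp: c_def)
  then show ?thesis by (simp add: c_def)
qed

text \<open>The colour before a crossing is only determined modulo \<open>K\<close>; a choice turns
  it into a term that can occur in the sum for the longitude.\<close>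

definition left_colour :: "(real \<Rightarrow> 'a \<Rightarrow> laurent) \<Rightarrow> real \<Rightarrow> 'a \<Rightarrow> laurent" where
  "left_colour f x = (SOME B. \<exists>B'. sides f x B B')"

lemma left_colour: "sides f x B B' \<Longrightarrow> left_colour f x \<doteq> B"
  unfolding left_colour_def by (rule someI2[of _ B]) (auto dest: sides_unique(1))

end

section \<open>Arcs\<close>

lemma frac_plus_int [simp]: "frac (x + of_int n) = frac x"
  by (simp add: frac_def)

lemma frac_minus_int [simp]: "frac (x - of_int n) = frac x"
  by (simp add: frac_def)

lemma frac_eq_obtain:
  assumes "frac x = frac y"
  obtains n :: int where "x = y + of_int n"
  using assms by (auto simp: frac_def intro: that[of "\<lfloor>x\<rfloor> - \<lfloor>y\<rfloor>"])

text \<open>Intended for \<open>arc_of\<close>, which takes at most three values near each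
  parameter.\<close>

lemma compact_imp_finite_image:
  assumes "compact S" "\<And>x. x \<in> S \<Longrightarrow> \<exists>U. open U \<and> x \<in> U \<and> finite (f ` U)"
  shows "finite (f ` S)"
proof -
  obtain U where U: "\<And>x. x \<in> S \<Longrightarrow> open (U x) \<and> x \<in> U x \<and> finite (f ` U x)"
    using assms(2) by metis
  obtain T where T: "T \<subseteq> S" "finite T" "S \<subseteq> (\<Union>x\<in>T. U x)"
    by (rule compactE_image[OF assms(1), of S U]) (use U in blast)+
  have "f ` S \<subseteq> (\<Union>x\<in>T. f ` U x)"
    using T(3) by blast
  moreover have "finite (\<Union>x\<in>T. f ` U x)"
    using T U by blast
  ultimately show ?thesis
    by (rule finite_subset)
qed

definition clear :: "diagram \<Rightarrow> nat \<Rightarrow> real \<Rightarrow> real \<Rightarrow> bool" where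
  "clear D i x y \<longleftrightarrow> closed_segment x y \<inter> under_params D i = {}"

lemma under_params_shift [simp]: "x + of_int n \<in> under_params D i \<longleftrightarrow> x \<in> under_params D i"
  by (simp add: under_params_def)

lemma clear_sym: "clear D i x y \<Longrightarrow> clear D i y x"
  by (simp add: clear_def closed_segment_commute)

lemma clear_trans: "clear D i x y \<Longrightarrow> clear D i y z \<Longrightarrow> clear D i x z"
  by (auto simp: clear_def closed_segment_eq_real_ivl disjoint_iff split: if_splits)
     (metis linear order_trans)+

lemma clear_shift: "clear D i x y \<Longrightarrow> clear D i (x + of_int n) (y + of_int n)"
  unfolding clear_def disjoint_iff
proof (intro allI impI)
  fix z
  assume *: "\<forall>z. z \<in> closed_segment x y \<longrightarrow> z \<notin> under_params D i"
    and "z \<in> closed_segment (x + of_int n) (y + of_int n)"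
  then have "z - of_int n \<in> closed_segment x y"
    by (auto simp: closed_segment_eq_real_ivl split: if_splits)
  then show "z \<notin> under_params D i"
    using * under_params_shift[of "z - of_int n" n] by auto
qed

lemma arc_of_iff: "(j, y) \<in> arc_of D i x \<longleftrightarrow> j = i \<and> (\<exists>n :: int. clear D i x (y + of_int n))"
  by (auto simp: arc_of_def clear_def)

lemma arc_of_memD: "(j, y) \<in> arc_of D i x \<Longrightarrow> j = i"
  by (simp add: arc_of_iff)

lemma arc_of_subset: "arc_of D i x \<subseteq> arc_of D i x'" if "clear D i x' x"
proof clarify
  fix j y assume "(j, y) \<in> arc_of D i x"
  then show "(j, y) \<in> arc_of D i x'"
    using clear_trans[OF that] unfolding arc_of_iff by blast
qed

lemma arc_of_eq: "clear D i x y \<Longrightarrow> arc_of D i x = arc_of D i y"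
  using arc_of_subset clear_sym by blast

lemma arc_of_shift: "arc_of D i (x + of_int n) = arc_of D i x"
proof -
  have *: "arc_of D i (x + of_int n) \<subseteq> arc_of D i x" for x n
  proof clarify
    fix j y assume "(j, y) \<in> arc_of D i (x + of_int n)"
    then obtain k :: int where k: "j = i" "clear D i (x + of_int n) (y + of_int k)"
      by (auto simp: arc_of_iff)
    from clear_shift[OF k(2), of "- n"] show "(j, y) \<in> arc_of D i x"
      unfolding arc_of_iff by (auto simp: k(1) algebra_simps intro!: exI[of _ "k - n"])
  qed
  from *[of x n] *[of "x + of_int n" "- n"] show ?thesis by auto
qed

lemma arc_of_frac: "arc_of D i (frac x) = arc_of D i x"
  using arc_of_shift[of D i "frac x" "\<lfloor>x\<rfloor>"] by (simp add: frac_def)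

lemma arc_of_self: "x \<notin> under_params D i \<Longrightarrow> (i, x) \<in> arc_of D i x"
  by (auto simp: arc_of_iff clear_def intro: exI[of _ 0])

lemma component_of_arc_of: "x \<notin> under_params D i \<Longrightarrow> component_of (arc_of D i x) = i"
  unfolding component_of_def
proof (rule the_equality)
  assume "x \<notin> under_params D i"
  then show "\<exists>y. (i, y) \<in> arc_of D i x"
    using arc_of_self by blast
qed (auto simp: arc_of_iff)

section \<open>Undercrossings and arcs of a valid diagram\<close>

locale valid_diagram =
  fixes D :: diagram
  assumes valid: "link_diagram D"
begin

lemma classical_double: "classical D \<subseteq> double_points D"
  and finite_double: "finite (double_points D)"
  and double_unique: "(p, q) \<in> double_points D \<Longrightarrow> (p, r) \<in> double_points D \<Longrightarrow> q = r"
  and classical_asym: "(p, q) \<in> classical D \<Longrightarrow> (q, p) \<notin> classical D"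
  using valid unfolding link_diagram_def by blast+

lemma finite_classical: "finite (classical D)"
  using classical_double finite_double finite_subset by blast

lemma classical_points:
  assumes "(p, q) \<in> classical D"
  shows "p \<in> points D" "q \<in> points D"
  using assms classical_double by (auto simp: double_points_def)

lemma classical_params:
  assumes "((i, x), (j, y)) \<in> classical D"
  shows "i \<in> {1..ncomp D}" "j \<in> {1..ncomp D}" "frac x = x" "frac y = y"
  using classical_points[OF assms] by (auto simp: points_def)

lemma double_sym: "(p, q) \<in> double_points D \<Longrightarrow> (q, p) \<in> double_points D"
  by (auto simp: double_points_def)

lemma classical_unique: "(p, q) \<in> classical D \<Longrightarrow> (p', q) \<in> classical D \<Longrightarrow> p = p'"
  using classical_double double_sym double_unique by blast

lemma over_not_under: "(p, q) \<in> classical D \<Longrightarrow> (r, p) \<notin> classical D"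
  using classical_double double_sym double_unique classical_asym by blast

lemma over_param: "((i, x), q) \<in> classical D \<Longrightarrow> x \<notin> under_params D i"
  using over_not_under classical_points[of "(i, x)" q] by (fastforce simp: under_params_def points_def)

lemma under_param: "(p, (j, y)) \<in> classical D \<Longrightarrow> y \<in> under_params D j"
  using classical_points[of p "(j, y)"] by (auto simp: under_params_def points_def)

lemma finite_under_params: "finite (under_params D i \<inter> {a..b})"
proof (rule finite_subset)
  let ?U = "(\<lambda>c. snd (snd c)) ` classical D"
  show "under_params D i \<inter> {a..b} \<subseteq> (\<lambda>(u, n). u + of_int n) ` (?U \<times> {\<lfloor>a\<rfloor>..\<lfloor>b\<rfloor>})"
  proof
    fix x assume x: "x \<in> under_params D i \<inter> {a..b}"
    then have "frac x \<in> ?U"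
      by (force simp: under_params_def)
    moreover have "\<lfloor>x\<rfloor> \<in> {\<lfloor>a\<rfloor>..\<lfloor>b\<rfloor>}"
      using x floor_mono by auto
    moreover have "x = frac x + of_int \<lfloor>x\<rfloor>"
      by (simp add: frac_def)
    ultimately show "x \<in> (\<lambda>(u, n). u + of_int n) ` (?U \<times> {\<lfloor>a\<rfloor>..\<lfloor>b\<rfloor>})"
      by (metis (no_types, lifting) SigmaI case_prod_conv rev_image_eqI)
  qed
qed (use finite_classical in auto)

lemma under_params_isolated: "\<exists>e>0. \<forall>y. y \<noteq> x \<and> \<bar>y - x\<bar> < e \<longrightarrow> y \<notin> under_params D i"
proof -
  have "finite (under_params D i \<inter> {x - 1..x + 1})"
    by (rule finite_under_params)
  from finite_set_avoid[OF this, of x] obtain e where e: "e > 0"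
    "\<forall>y \<in> under_params D i \<inter> {x - 1..x + 1}. y \<noteq> x \<longrightarrow> e \<le> dist x y"
    by blast
  show ?thesis
  proof (intro exI[of _ "min e 1"] conjI allI impI notI)
    fix y assume y: "y \<noteq> x \<and> \<bar>y - x\<bar> < min e 1" "y \<in> under_params D i"
    then have "e \<le> dist x y" using e(2) by (auto simp: abs_less_iff)
    then show False using y by (auto simp: dist_real_def)
  qed (use e(1) in auto)
qed

text \<open>Undercrossings are isolated, so the arc does not change on a punctured one-sided
  neighbourhood of \<open>x\<close>. This turns the filters in the definitions of
  \<open>incoming_arc\<close> and \<open>outgoing_arc\<close> into concrete nearby parameters. It
  applies at every parameter, whether an undercrossing or not.\<close>

lemma arc_of_sides:
  "\<exists>e>0. \<forall>d. 0 < d \<and> d < e \<longrightarrow> x - d \<notin> under_params D i \<and> x + d \<notin> under_params D i \<and>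
    arc_of D i (x - d) = incoming_arc D (p, (i, x)) \<and> arc_of D i (x + d) = outgoing_arc D (p, (i, x))"
proof -
  obtain e where e: "e > 0" "\<And>y. y \<noteq> x \<Longrightarrow> \<bar>y - x\<bar> < e \<Longrightarrow> y \<notin> under_params D i"
    using under_params_isolated by blast
  have clr: "clear D i u w" if "\<bar>u - x\<bar> < e" "\<bar>w - x\<bar> < e" "u < x \<and> w < x \<or> x < u \<and> x < w" for u w
  proof -
    have "z \<notin> under_params D i" if "z \<in> closed_segment u w" for z
      using that \<open>\<bar>u - x\<bar> < e\<close> \<open>\<bar>w - x\<bar> < e\<close> \<open>u < x \<and> w < x \<or> x < u \<and> x < w\<close>
      by (intro e(2)) (auto simp: closed_segment_eq_real_ivl split: if_splits)
    then show ?thesis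
      by (auto simp: clear_def)
  qed
  have l: "arc_of D i (x - d) = incoming_arc D (p, (i, x))" if d: "0 < d" "d < e" for d
  proof -
    have *: "arc_of D i u = arc_of D i (x - d)" if "x - e < u" "u < x" for u
      by (rule arc_of_eq, rule clr) (use that d in auto)
    have "(\<forall>\<^sub>F u in at_left x. (i, y) \<in> arc_of D i u) \<longleftrightarrow> (i, y) \<in> arc_of D i (x - d)" for y
    proof -
      have "eventually (\<lambda>u. (i, y) \<in> arc_of D i u \<longleftrightarrow> (i, y) \<in> arc_of D i (x - d)) (at_left x)"
        by (rule eventually_at_leftI[of "x - e"]) (use e(1) * in auto)
      from eventually_subst[OF this] show ?thesis
        by simp
    qed
    then show ?thesis
      by (auto simp: incoming_arc_def dest: arc_of_memD)
  qed
  have r: "arc_of D i (x + d) = outgoing_arc D (p, (i, x))" if d: "0 < d" "d < e" for d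
  proof -
    have *: "arc_of D i u = arc_of D i (x + d)" if "x < u" "u < x + e" for u
      by (rule arc_of_eq, rule clr) (use that d in auto)
    have "(\<forall>\<^sub>F u in at_right x. (i, y) \<in> arc_of D i u) \<longleftrightarrow> (i, y) \<in> arc_of D i (x + d)" for y
    proof -
      have "eventually (\<lambda>u. (i, y) \<in> arc_of D i u \<longleftrightarrow> (i, y) \<in> arc_of D i (x + d)) (at_right x)"
        by (rule eventually_at_rightI[of _ "x + e"]) (use e(1) * in auto)
      from eventually_subst[OF this] show ?thesis
        by simp
    qed
    then show ?thesis
      by (auto simp: outgoing_arc_def dest: arc_of_memD)
  qed
  show ?thesis
  proof (intro exI[of _ e] conjI allI impI)
    fix d assume "0 < d \<and> d < e"
    then show "x - d \<notin> under_params D i" "x + d \<notin> under_params D i"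
      "arc_of D i (x - d) = incoming_arc D (p, (i, x))" "arc_of D i (x + d) = outgoing_arc D (p, (i, x))"
      using e(2)[of "x - d"] e(2)[of "x + d"] l r by auto
  qed (rule e(1))
qed

lemma arc_of_sides_obtain:
  obtains e where "e > 0" "\<And>d. 0 < d \<Longrightarrow> d < e \<Longrightarrow> x - d \<notin> under_params D i"
    "\<And>d. 0 < d \<Longrightarrow> d < e \<Longrightarrow> x + d \<notin> under_params D i"
    "\<And>d. 0 < d \<Longrightarrow> d < e \<Longrightarrow> arc_of D i (x - d) = incoming_arc D (p, (i, x))"
    "\<And>d. 0 < d \<Longrightarrow> d < e \<Longrightarrow> arc_of D i (x + d) = outgoing_arc D (p, (i, x))"
  using arc_of_sides[of x i p] by (elim exE conjE) presburger

lemma incoming_arc_obtain: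
  obtains y where "y \<notin> under_params D i" "incoming_arc D (p, (i, x)) = arc_of D i y"
proof -
  obtain e where e: "e > 0" "\<And>d. 0 < d \<Longrightarrow> d < e \<Longrightarrow> x - d \<notin> under_params D i"
    "\<And>d. 0 < d \<Longrightarrow> d < e \<Longrightarrow> arc_of D i (x - d) = incoming_arc D (p, (i, x))"
    by (rule arc_of_sides_obtain[of x i p]) simp
  show thesis
    by (rule that[of "x - e / 2"]) (use e(1) e(2,3)[of "e / 2"] in simp_all)
qed

lemma outgoing_arc_obtain:
  obtains y where "y \<notin> under_params D i" "outgoing_arc D (p, (i, x)) = arc_of D i y"
proof -
  obtain e where e: "e > 0" "\<And>d. 0 < d \<Longrightarrow> d < e \<Longrightarrow> x + d \<notin> under_params D i"
    "\<And>d. 0 < d \<Longrightarrow> d < e \<Longrightarrow> arc_of D i (x + d) = outgoing_arc D (p, (i, x))"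
    by (rule arc_of_sides_obtain[of x i p]) simp
  show thesis
    by (rule that[of "x + e / 2"]) (use e(1) e(2,3)[of "e / 2"] in simp_all)
qed

text \<open>Close to a parameter \<open>x\<close> only the arc of \<open>x\<close> itself and the
  arcs just before and just after it occur; the rest is compactness of a period.\<close>

lemma finite_arcs: "finite (arcs D)"
proof -
  have fin: "finite (arc_of D i ` {0..1})" for i
  proof (rule compact_imp_finite_image)
    fix x :: real
    let ?p = "undefined :: pnt"
    obtain e where e: "e > 0"
      "\<And>d. 0 < d \<Longrightarrow> d < e \<Longrightarrow> arc_of D i (x - d) = incoming_arc D (?p, (i, x))"
      "\<And>d. 0 < d \<Longrightarrow> d < e \<Longrightarrow> arc_of D i (x + d) = outgoing_arc D (?p, (i, x))"
      by (rule arc_of_sides_obtain[of x i ?p]) simp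
    have "arc_of D i ` ball x e \<subseteq>
        {arc_of D i x, incoming_arc D (?p, (i, x)), outgoing_arc D (?p, (i, x))}"
    proof (rule image_subsetI)
      fix y assume "y \<in> ball x e"
      with e(2)[of "x - y"] e(3)[of "y - x"]
      show "arc_of D i y \<in> {arc_of D i x, incoming_arc D (?p, (i, x)), outgoing_arc D (?p, (i, x))}"
        by (cases y x rule: linorder_cases) (auto simp: dist_real_def)
    qed
    then show "\<exists>U. open U \<and> x \<in> U \<and> finite (arc_of D i ` U)"
      using e(1) by (intro exI[of _ "ball x e"]) (auto intro: finite_subset)
  qed simp
  have "arcs D \<subseteq> (\<Union>i\<in>{1..ncomp D}. arc_of D i ` {0..1})"
  proof
    fix a assume "a \<in> arcs D"
    then obtain i x where "i \<in> {1..ncomp D}" "a = arc_of D i (frac x)"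
      by (auto simp: arcs_def arc_of_frac)
    then show "a \<in> (\<Union>i\<in>{1..ncomp D}. arc_of D i ` {0..1})"
      using frac_lt_1[of x] by (auto intro!: bexI[of _ i] imageI simp: less_imp_le)
  qed
  then show ?thesis using fin by (auto intro: finite_subset)
qed

lemma arc_of_in_arcs: "i \<in> {1..ncomp D} \<Longrightarrow> x \<notin> under_params D i \<Longrightarrow> arc_of D i x \<in> arcs D"
  by (auto simp: arcs_def)

lemma crossing_arcs:
  assumes "c \<in> classical D"
  shows "over_arc D c \<in> arcs D" "incoming_arc D c \<in> arcs D" "outgoing_arc D c \<in> arcs D"
    "b1 D c \<in> arcs D" "b2 D c \<in> arcs D"
proof -
  obtain i x j y where c: "c = ((i, x), (j, y))" by (metis surj_pair)
  note p = classical_params[OF assms[unfolded c]]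
  show "over_arc D c \<in> arcs D"
    using p over_param assms by (auto simp: over_arc_def c intro!: arc_of_in_arcs)
  show *: "incoming_arc D c \<in> arcs D"
    by (rule incoming_arc_obtain[of j "(i, x)" y]) (use p in \<open>auto simp: c intro!: arc_of_in_arcs\<close>)
  show **: "outgoing_arc D c \<in> arcs D"
    by (rule outgoing_arc_obtain[of j "(i, x)" y]) (use p in \<open>auto simp: c intro!: arc_of_in_arcs\<close>)
  show "b1 D c \<in> arcs D" "b2 D c \<in> arcs D"
    using * ** by (auto simp: b1_def b2_def)
qed

lemma component_of_crossing:
  shows "component_of (incoming_arc D c) = fst (snd c)" "component_of (outgoing_arc D c) = fst (snd c)"
    "component_of (b1 D c) = fst (snd c)" "component_of (b2 D c) = fst (snd c)"
proof -
  obtain p j y where c: "c = (p, (j, y))" by (metis surj_pair)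
  show *: "component_of (incoming_arc D c) = fst (snd c)"
    by (rule incoming_arc_obtain[of j p y]) (auto simp: c component_of_arc_of)
  show **: "component_of (outgoing_arc D c) = fst (snd c)"
    by (rule outgoing_arc_obtain[of j p y]) (auto simp: c component_of_arc_of)
  show "component_of (b1 D c) = fst (snd c)" "component_of (b2 D c) = fst (snd c)"
    using * ** by (auto simp: b1_def b2_def)
qed

text \<open>For a component without arcs the condition that defines \<open>meridians\<close> would
  be vacuous.\<close>

lemma ex_arc_on_component:
  assumes "i \<in> {1..ncomp D}"
  shows "\<exists>a \<in> arcs D. component_of a = i"
proof -
  obtain x where "x \<notin> under_params D i"
    using incoming_arc_obtain by metis
  then show ?thesis
    using assms arc_of_in_arcs component_of_arc_of by blast
qed

end

section \<open>Colourings\<close>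

lemma sum_apply: "(\<Sum>a\<in>A. f a) x = (\<Sum>a\<in>A. f a x)" for f :: "'a \<Rightarrow> 'b \<Rightarrow> 'c::comm_monoid_add"
  by (induction A rule: infinite_finite_induct) auto

lemma free_module_conv:
  assumes "finite A" "x \<in> free_module A"
  shows "x = (\<Sum>a\<in>A. x a *\<^sub>L basis a)"
proof
  fix b
  have "(\<Sum>a\<in>A. x a * basis a b) = (\<Sum>a\<in>A. if a = b then x b else 0)"
    by (intro sum.cong) (auto simp: basis_def)
  also have "\<dots> = x b"
    using assms by (auto simp: free_module_def)
  finally show "x b = (\<Sum>a\<in>A. x a *\<^sub>L basis a) b"
    by (simp add: sum_apply)
qed

lemma subspace_free_module: "lmod.subspace (free_module A)"
  by (rule lmod.subspaceI) (auto simp: free_module_def)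

lemma basis_in_free_module: "a \<in> A \<Longrightarrow> basis a \<in> free_module A"
  by (auto simp: free_module_def basis_def)

definition relator :: "diagram \<Rightarrow> crossing \<Rightarrow> arc \<Rightarrow> laurent" where
  "relator D c = (1 - tvar) *\<^sub>L basis (over_arc D c) + tvar *\<^sub>L basis (b1 D c) - basis (b2 D c)"

lemma rho_conv: "rho D y = (\<Sum>c\<in>classical D. y c *\<^sub>L relator D c)"
  by (auto simp: rho_def relator_def sum_apply)

text \<open>\<open>rho\<close> only sees the coefficients at classical crossings, so its full range
  is already the image of the free module on them; \<open>quot_conv\<close> confirms this.\<close>

definition rels :: "diagram \<Rightarrow> (arc \<Rightarrow> laurent) set" where
  "rels D = range (rho D)"

lemma rho_plus: "rho D (y + z) = rho D y + rho D z"
  by (simp add: rho_conv lmod.scale_left_distrib sum.distrib)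

lemma rho_scl: "rho D (r *\<^sub>L y) = r *\<^sub>L rho D y"
  by (simp add: rho_conv lmod.scale_sum_right)

lemma subspace_rels: "lmod.subspace (rels D)"
proof (rule lmod.subspaceI)
  show "0 \<in> rels D"
    unfolding rels_def by (rule range_eqI[of _ _ 0]) (simp add: rho_conv)
qed (auto simp: rels_def rho_plus[symmetric] rho_scl[symmetric])

lemma congruence_rels: "congruence (rels D)"
  by standard (rule subspace_rels)

lemma quot_conv: "quot D x = {x + r |r. r \<in> rels D}"
proof -
  have "rho D y \<in> rho D ` free_module (classical D)" for y
  proof (rule image_eqI)
    show "rho D y = rho D (\<lambda>c. if c \<in> classical D then y c else 0)"
      by (simp add: rho_def fun_eq_iff)
  qed (auto simp: free_module_def)
  then have "rels D = rho D ` free_module (classical D)"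
    unfolding rels_def by blast
  then show ?thesis
    unfolding quot_def by (auto simp: plus_fun_def)
qed

lemma quot_eq_iff: "quot D x = quot D y \<longleftrightarrow> x - y \<in> rels D"
proof
  assume "quot D x = quot D y"
  then have "x \<in> quot D y"
    using quot_self by blast
  then show "x - y \<in> rels D"
    by (auto simp: quot_conv)
next
  assume *: "x - y \<in> rels D"
  have "quot D x \<subseteq> quot D y" if *: "x - y \<in> rels D" for x y
  proof
    fix z assume "z \<in> quot D x"
    then obtain r where "z = x + r" "r \<in> rels D"
      by (auto simp: quot_conv)
    then have "z = y + ((x - y) + r)" "(x - y) + r \<in> rels D"
      using * lmod.subspace_add[OF subspace_rels] by auto
    then show "z \<in> quot D y"
      unfolding quot_conv by blast
  qed
  from this[OF *] this[of y x] show "quot D x = quot D y"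
    using lmod.subspace_neg[OF subspace_rels *] by auto
qed

text \<open>
  A colouring of \<open>D\<close> assigns to the points of \<open>D\<close> elements of a module, here a module of functions
  modulo \<open>K\<close>, such that the relations of the Alexander module hold. As its definition is local,
  colourings can be glued.
\<close>

context congruence
begin

definition colouring :: "diagram \<Rightarrow> (nat \<Rightarrow> real \<Rightarrow> 'a \<Rightarrow> laurent) \<Rightarrow> bool" where
  "colouring D g \<longleftrightarrow>
    (\<forall>i\<in>{1..ncomp D}. \<forall>x. g i (x + 1) \<doteq> g i x \<and> (x \<notin> under_params D i \<longrightarrow> loc_const (g i) x)) \<and>
    (\<forall>i x j y. ((i, x), (j, y)) \<in> classical D \<longrightarrow>
      (\<exists>B. sides (g j) y B (under (right_to_left D ((i, x), (j, y))) (g i x) B)))"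

text \<open>The value of the longitude under a colouring. The factor \<open>kap\<close> combines the
  writhe with the passage from the colour of \<open>b1\<close> to the colour before the crossing, so
  that no arcs remain in the sum.\<close>

definition lonsum :: "diagram \<Rightarrow> (nat \<Rightarrow> real \<Rightarrow> 'a \<Rightarrow> laurent) \<Rightarrow> nat \<Rightarrow> 'a \<Rightarrow> laurent" where
  "lonsum D g i = (\<Sum>c\<in>{c \<in> classical D. fst (snd c) = i}. kap (right_to_left D c) *\<^sub>L
    (g (fst (fst c)) (snd (fst c)) - left_colour (g i) (snd (snd c))))"

end

text \<open>A representative of the longitude in which the factor 1/2 has been carried out; see
  \<open>longitude_lonrep\<close>.\<close>

definition lonrep :: "diagram \<Rightarrow> nat \<Rightarrow> arc \<Rightarrow> laurent" where
  "lonrep D i = (\<Sum>c\<in>{c \<in> classical D. fst (snd c) = i}.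
    of_int (writhe D c) *\<^sub>L (basis (over_arc D c) - basis (b1 D c)))"

text \<open>The linear extension of a colouring: each arc goes to the colour of a point chosen on
  it. For a colouring the choice does not matter modulo \<open>K\<close>, since the colour is
  constant along arcs.\<close>

definition lin :: "diagram \<Rightarrow> (nat \<Rightarrow> real \<Rightarrow> 'a \<Rightarrow> laurent) \<Rightarrow> (arc \<Rightarrow> laurent) \<Rightarrow> 'a \<Rightarrow> laurent" where
  "lin D g x = (\<Sum>a\<in>arcs D. x a *\<^sub>L (case SOME p. p \<in> a of (i, y) \<Rightarrow> g i y))"

lemma lin_add: "lin D g (x + y) = lin D g x + lin D g y"
  by (simp add: lin_def lmod.scale_left_distrib sum.distrib)

lemma lin_scale: "lin D g (r *\<^sub>L x) = r *\<^sub>L lin D g x"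
  by (simp add: lin_def lmod.scale_sum_right)

lemma lin_0: "lin D g 0 = 0"
  by (simp add: lin_def)

lemma lin_diff: "lin D g (x - y) = lin D g x - lin D g y"
  by (simp add: lin_def lmod.scale_left_diff_distrib sum_subtractf)

lemma lin_sum: "lin D g (sum f A) = (\<Sum>a\<in>A. lin D g (f a))"
  by (induction A rule: infinite_finite_induct)
    (simp_all only: lin_add lin_0 sum.insert sum.empty sum.infinite not_False_eq_True)

text \<open>At an undercrossing \<open>arc_of D i x\<close> is empty, so the colour there is a basis
  vector outside the free module on the arcs and serves as a placeholder.\<close>

definition colour :: "diagram \<Rightarrow> nat \<Rightarrow> real \<Rightarrow> arc \<Rightarrow> laurent" where
  "colour D i x = basis (arc_of D i x)"

context valid_diagram
begin

lemma lin_basis: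
  assumes "a \<in> arcs D"
  shows "lin D g (basis a) = (case SOME p. p \<in> a of (i, y) \<Rightarrow> g i y)"
proof -
  have "lin D g (basis a) = (\<Sum>b\<in>arcs D. if b = a then (case SOME p. p \<in> a of (i, y) \<Rightarrow> g i y) else 0)"
    unfolding lin_def by (intro sum.cong) (auto simp: basis_def)
  then show ?thesis
    using finite_arcs assms by simp
qed

lemma rep_arc:
  assumes "x \<notin> under_params D i"
  obtains y n where "(SOME p. p \<in> arc_of D i x) = (i, y)" "clear D i x (y + of_int n)"
proof -
  have "(SOME p. p \<in> arc_of D i x) \<in> arc_of D i x"
    using arc_of_self[OF assms] by (rule someI)
  then show thesis
    by (metis (no_types, lifting) arc_of_iff surj_pair that)
qed

text \<open>An exact equality and not just a congruence, because the tautological colouring is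
  literally constant along each arc.\<close>

lemma lin_colour:
  assumes "x \<in> free_module (arcs D)"
  shows "lin D (colour D) x = x"
proof -
  have "(case SOME p. p \<in> a of (i, y) \<Rightarrow> colour D i y) = basis a" if a_in: "a \<in> arcs D" for a
  proof -
    obtain i x where a: "a = arc_of D i x" "x \<notin> under_params D i"
      using a_in unfolding arcs_def by blast
    obtain y n where "(SOME p. p \<in> a) = (i, y)" "clear D i x (y + of_int n)"
      using rep_arc[OF a(2)] a(1) by metis
    then show ?thesis
      using arc_of_eq[of D i x "y + of_int n"] by (simp add: colour_def arc_of_shift a(1))
  qed
  then show ?thesis
    using free_module_conv[OF finite_arcs assms] by (simp add: lin_def)
qed

end

section \<open>The linear map induced by a colouring\<close>

locale coloured_diagram = valid_diagram D + congruence K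
  for D and K :: "('a \<Rightarrow> laurent) set" +
  fixes g :: "nat \<Rightarrow> real \<Rightarrow> 'a \<Rightarrow> laurent"
  assumes colouring: "colouring D g"
begin

lemma g_clear: "i \<in> {1..ncomp D} \<Longrightarrow> clear D i x y \<Longrightarrow> g i x \<doteq> g i y"
  using colouring by (intro loc_const_connected) (auto simp: colouring_def clear_def disjoint_iff)

lemma g_shift:
  assumes "i \<in> {1..ncomp D}"
  shows "g i (x + of_int n) \<doteq> g i x"
proof (induction n rule: int_induct[of _ 0])
  case (step1 n)
  have "g i (x + of_int n + 1) \<doteq> g i (x + of_int n)"
    using colouring assms by (simp add: colouring_def)
  then show ?case
    using step1.IH cong_trans by (simp add: algebra_simps)
next
  case (step2 n)
  have "g i (x + of_int (n - 1) + 1) \<doteq> g i (x + of_int (n - 1))"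
    using colouring assms unfolding colouring_def by blast
  then have "g i (x + of_int (n - 1)) \<doteq> g i (x + of_int n)"
    using cong_sym by (simp add: algebra_simps)
  then show ?case
    using step2.IH cong_trans by blast
qed simp

lemma lin_arc_of:
  assumes "i \<in> {1..ncomp D}" "x \<notin> under_params D i"
  shows "lin D g (basis (arc_of D i x)) \<doteq> g i x"
proof -
  obtain y n where y: "(SOME p. p \<in> arc_of D i x) = (i, y)" "clear D i x (y + of_int n)"
    using rep_arc[OF assms(2)] .
  have "g i y \<doteq> g i x"
    using g_clear[OF assms(1) y(2)] g_shift[OF assms(1), of y n] cong_sym cong_trans by blast
  then show ?thesis
    using lin_basis[OF arc_of_in_arcs[OF assms], of g] y(1) by simp
qed

lemma lin_incoming:
  assumes "j \<in> {1..ncomp D}" "sides (g j) y B B'"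
  shows "lin D g (basis (incoming_arc D (p, (j, y)))) \<doteq> B" "lin D g (basis (outgoing_arc D (p, (j, y)))) \<doteq> B'"
proof -
  obtain e where e: "e > 0" "\<And>d. 0 < d \<Longrightarrow> d < e \<Longrightarrow> y - d \<notin> under_params D j"
    "\<And>d. 0 < d \<Longrightarrow> d < e \<Longrightarrow> y + d \<notin> under_params D j"
    "\<And>d. 0 < d \<Longrightarrow> d < e \<Longrightarrow> arc_of D j (y - d) = incoming_arc D (p, (j, y))"
    "\<And>d. 0 < d \<Longrightarrow> d < e \<Longrightarrow> arc_of D j (y + d) = outgoing_arc D (p, (j, y))"
    by (rule arc_of_sides_obtain[of y j p]) simp
  obtain e' where e': "e' > 0" "\<And>d. 0 < d \<Longrightarrow> d < e' \<Longrightarrow> g j (y - d) \<doteq> B \<and> g j (y + d) \<doteq> B'"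
    using assms(2) unfolding sides_def by blast
  define d where "d = min e e' / 2"
  have d: "0 < d" "d < e" "d < e'"
    using e(1) e'(1) by (auto simp: d_def min_def)
  from lin_arc_of[OF assms(1) e(2)[OF d(1,2)]] e(4)[OF d(1,2)] e'(2)[OF d(1,3)]
  show "lin D g (basis (incoming_arc D (p, (j, y)))) \<doteq> B"
    using cong_trans by metis
  from lin_arc_of[OF assms(1) e(3)[OF d(1,2)]] e(5)[OF d(1,2)] e'(2)[OF d(1,3)]
  show "lin D g (basis (outgoing_arc D (p, (j, y)))) \<doteq> B'"
    using cong_trans by metis
qed

text \<open>A colouring only guarantees that some colour before the crossing exists;
  \<open>left_colour\<close> is congruent to it and takes its place.\<close>

lemma crossing_colours:
  assumes c: "c \<in> classical D"
  defines "a \<equiv> g (fst (fst c)) (snd (fst c))" and "B \<equiv> left_colour (g (fst (snd c))) (snd (snd c))"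
  shows "sides (g (fst (snd c))) (snd (snd c)) B (under (right_to_left D c) a B)"
    "lin D g (basis (over_arc D c)) \<doteq> a"
    "lin D g (basis (incoming_arc D c)) \<doteq> B"
    "lin D g (basis (outgoing_arc D c)) \<doteq> under (right_to_left D c) a B"
proof -
  obtain i x j y where cc: "c = ((i, x), (j, y))"
    by (metis surj_pair)
  note p = classical_params[OF c[unfolded cc]]
  obtain B' where B': "sides (g j) y B' (under (right_to_left D c) a B')"
    using colouring c unfolding colouring_def a_def cc by fastforce
  have "B' \<doteq> B"
    using left_colour[OF B'] cong_sym by (simp add: B_def cc)
  then show *: "sides (g (fst (snd c))) (snd (snd c)) B (under (right_to_left D c) a B)"
    using sides_cong[OF B'] by (simp add: cc cong_under)
  show "lin D g (basis (over_arc D c)) \<doteq> a"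
    using lin_arc_of[OF p(1) over_param[OF c[unfolded cc]]] by (simp add: over_arc_def cc a_def)
  show "lin D g (basis (incoming_arc D c)) \<doteq> B" "lin D g (basis (outgoing_arc D c)) \<doteq> under (right_to_left D c) a B"
    using lin_incoming[of j y _ _ "(i, x)"] p(2) * by (auto simp: cc)
qed

text \<open>The rule \<open>under\<close> is the crossing relation solved for the outgoing colour.
  At a positive crossing that is the colour of \<open>b2\<close>, which gives the factor t; at a
  negative one it is the colour of \<open>b1\<close>, which gives its inverse.\<close>

lemma lin_relator:
  assumes c: "c \<in> classical D"
  shows "lin D g (relator D c) \<in> K"
proof -
  define a where "a = g (fst (fst c)) (snd (fst c))"
  define B where "B = left_colour (g (fst (snd c))) (snd (snd c))"
  note * = crossing_colours[OF c, folded a_def B_def]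
  have "lin D g (relator D c) \<doteq> 0"
  proof (cases "right_to_left D c")
    case True
    have "lin D g (relator D c) \<doteq> (1 - tvar) *\<^sub>L a + tvar *\<^sub>L B - under True a B"
      using * True by (auto simp: relator_def lin_add lin_diff lin_scale b1_def b2_def intro!: cong_diff cong_add cong_scale)
    also have "\<dots> = 0"
      by (simp add: under_def lpow_def algebra_simps)
    finally show ?thesis .
  next
    case False
    have "lin D g (relator D c) \<doteq> (1 - tvar) *\<^sub>L a + tvar *\<^sub>L under False a B - B"
      using * False by (auto simp: relator_def lin_add lin_diff lin_scale b1_def b2_def intro!: cong_diff cong_add cong_scale)
    also have "\<dots> = 0"
      by (simp add: under_def lpow_def algebra_simps)
    finally show ?thesis .
  qed
  then show ?thesis
    by (simp add: cong_def)
qed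

lemma lin_rels: "x \<in> rels D \<Longrightarrow> lin D g x \<in> K"
  by (auto simp: rels_def rho_conv lin_sum lin_scale
      intro!: lmod.subspace_sum[OF subspace_K] lmod.subspace_scale[OF subspace_K] lin_relator)

lemma lin_lonrep: "lin D g (lonrep D i) \<doteq> lonsum D g i"
  unfolding lonrep_def lonsum_def lin_sum lin_scale lin_diff
proof (rule cong_sum)
  fix c assume c': "c \<in> {c \<in> classical D. fst (snd c) = i}"
  then have c: "c \<in> classical D" by simp
  define a where "a = g (fst (fst c)) (snd (fst c))"
  define B where "B = left_colour (g (fst (snd c))) (snd (snd c))"
  note * = crossing_colours[OF c, folded a_def B_def]
  have "of_int (writhe D c) *\<^sub>L (lin D g (basis (over_arc D c)) - lin D g (basis (b1 D c)))
      \<doteq> kap (right_to_left D c) *\<^sub>L (a - B)"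
  proof (cases "right_to_left D c")
    case True
    then show ?thesis
      using * by (auto simp: kap_def writhe_def b1_def intro!: cong_diff)
  next
    case False
    have "of_int (writhe D c) *\<^sub>L (lin D g (basis (over_arc D c)) - lin D g (basis (b1 D c)))
        \<doteq> (- 1) *\<^sub>L (a - under False a B)"
      using * False by (simp add: writhe_def b1_def cong_scale cong_diff del: lmod.scale_minus_left)
    also have "\<dots> = kap False *\<^sub>L (a - B)"
      by (simp add: kap_def under_def lpow_def algebra_simps)
    finally show ?thesis
      using False by simp
  qed
  then show "of_int (writhe D c) *\<^sub>L (lin D g (basis (over_arc D c)) - lin D g (basis (b1 D c)))
      \<doteq> kap (right_to_left D c) *\<^sub>L (g (fst (fst c)) (snd (fst c)) - left_colour (g i) (snd (snd c)))"
    using c' by (simp add: a_def B_def)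
qed

end

context valid_diagram
begin

text \<open>The universal colouring, by which every point gets the class of its own arc. The
  outgoing arc minus its prescribed value is a unit times the relator, the unit being -1 or
  \<open>tinv\<close> according to the sign of the crossing.\<close>

lemma coloured_diagram_colour: "coloured_diagram D (rels D) (colour D)"
proof -
  interpret R: congruence "rels D"
    by (rule congruence_rels)
  have sd: "R.sides (colour D i) x (basis (incoming_arc D (p, (i, x)))) (basis (outgoing_arc D (p, (i, x))))" for i x p
  proof -
    obtain e where e: "e > 0"
      "\<And>d. 0 < d \<Longrightarrow> d < e \<Longrightarrow> arc_of D i (x - d) = incoming_arc D (p, (i, x))"
      "\<And>d. 0 < d \<Longrightarrow> d < e \<Longrightarrow> arc_of D i (x + d) = outgoing_arc D (p, (i, x))"
      by (rule arc_of_sides_obtain[of x i p]) simp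
    then show ?thesis
      unfolding R.sides_def colour_def by (intro exI[of _ e]) auto
  qed
  show ?thesis
  proof (unfold_locales, unfold R.colouring_def, intro conjI allI impI ballI)
    fix i x
    show "R.cong (colour D i (x + 1)) (colour D i x)"
      using arc_of_shift[of D i x 1] by (simp add: colour_def)
    assume x: "x \<notin> under_params D i"
    obtain e where e: "e > 0" "\<And>y. y \<noteq> x \<Longrightarrow> \<bar>y - x\<bar> < e \<Longrightarrow> y \<notin> under_params D i"
      using under_params_isolated by blast
    show "R.sides (colour D i) x (colour D i x) (colour D i x)"
    proof (rule R.sides_const[OF e(1)])
      fix y assume y: "y \<noteq> x" "\<bar>y - x\<bar> < e"
      have "clear D i y x"
        unfolding clear_def
      proof (rule equals0I)
        fix z assume z: "z \<in> closed_segment y x \<inter> under_params D i"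
        then have "\<bar>z - x\<bar> < e"
          using y by (auto simp: closed_segment_eq_real_ivl split: if_splits)
        then show False
          using e(2)[of z] x z by blast
      qed
      then show "R.cong (colour D i y) (colour D i x)"
        using arc_of_eq by (simp add: colour_def)
    qed
  next
    fix i x j y assume c: "((i, x), (j, y)) \<in> classical D"
    let ?c = "((i, x), (j, y))"
    have rel: "relator D ?c \<in> rels D"
    proof -
      have "rho D (basis ?c) = (\<Sum>c\<in>classical D. if c = ?c then relator D ?c else 0)"
        unfolding rho_conv by (intro sum.cong) (auto simp: basis_def)
      then have "relator D ?c = rho D (basis ?c)"
        using finite_classical c by simp
      then show ?thesis
        by (simp add: rels_def)
    qed
    let ?\<eta> = "right_to_left D ?c"
    let ?a = "colour D i x" and ?B = "basis (incoming_arc D ?c)" and ?B' = "basis (outgoing_arc D ?c)"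
    have "?B' - under ?\<eta> ?a ?B \<in> rels D"
    proof (cases ?\<eta>)
      case True
      then have "?B' - under ?\<eta> ?a ?B = - relator D ?c"
        by (simp add: relator_def b1_def b2_def under_def lpow_def colour_def over_arc_def algebra_simps)
      then show ?thesis
        using lmod.subspace_neg[OF subspace_rels rel] by simp
    next
      case False
      then have "?B' - under ?\<eta> ?a ?B = tinv *\<^sub>L relator D ?c"
        by (simp add: relator_def b1_def b2_def under_def lpow_def colour_def over_arc_def algebra_simps)
      then show ?thesis
        using lmod.subspace_scale[OF subspace_rels rel] by simp
    qed
    then have "R.cong ?B' (under ?\<eta> ?a ?B)"
      by (simp add: R.cong_def)
    then show "\<exists>B. R.sides (colour D j) y B (under ?\<eta> ?a B)"
      using R.sides_cong[OF sd[of j y "(i, x)"]] by blast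
  qed
qed

text \<open>The special case of \<open>lin_lonrep\<close> in which the induced linear map is the
  identity.\<close>

lemma lonrep_lonsum: "congruence.cong (rels D) (lonrep D i) (congruence.lonsum (rels D) D (colour D) i)"
proof -
  interpret C: coloured_diagram D "rels D" "colour D"
    by (rule coloured_diagram_colour)
  have "lonrep D i \<in> free_module (arcs D)"
    unfolding lonrep_def
    by (intro lmod.subspace_sum[OF subspace_free_module] lmod.subspace_scale[OF subspace_free_module]
        lmod.subspace_diff[OF subspace_free_module] basis_in_free_module) (auto intro: crossing_arcs)
  from C.lin_lonrep[of i, unfolded lin_colour[OF this]] show ?thesis .
qed

end

section \<open>Longitudes\<close>

context valid_diagram
begin

lemma incoming_shift: "incoming_arc D (p, (i, x + of_int n)) = incoming_arc D (p, (i, x))"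
proof -
  obtain e where e: "e > 0" "\<And>d. 0 < d \<Longrightarrow> d < e \<Longrightarrow> arc_of D i (x - d) = incoming_arc D (p, (i, x))"
    by (rule arc_of_sides_obtain[of x i p]) simp
  obtain e' where e': "e' > 0"
    "\<And>d. 0 < d \<Longrightarrow> d < e' \<Longrightarrow> arc_of D i (x + of_int n - d) = incoming_arc D (p, (i, x + of_int n))"
    by (rule arc_of_sides_obtain[of "x + of_int n" i p]) simp
  define d where "d = min e e' / 2"
  have "0 < d" "d < e" "d < e'"
    using e(1) e'(1) by (auto simp: d_def min_def)
  with e(2)[of d] e'(2)[of d] arc_of_shift[of D i "x - d" n] show ?thesis
    by (simp add: algebra_simps)
qed

text \<open>Each underpassing arc comes out of one crossing and goes into the next one on its component.\<close>

lemma sum_incoming_outgoing: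
  fixes F :: "arc \<Rightarrow> 'b::comm_monoid_add"
  shows "(\<Sum>c\<in>{c \<in> classical D. fst (snd c) = i}. F (incoming_arc D c)) =
    (\<Sum>c\<in>{c \<in> classical D. fst (snd c) = i}. F (outgoing_arc D c))"
proof -
  let ?C = "{c \<in> classical D. fst (snd c) = i}"
  let ?p = "undefined :: pnt"
  define U where "U = (\<lambda>c. snd (snd c)) ` ?C"
  have inj: "inj_on (\<lambda>c. snd (snd c)) ?C"
    by (intro inj_onI) (auto dest: classical_unique)
  have finU: "finite U"
    unfolding U_def using finite_classical by simp
  have U: "u \<in> U \<longleftrightarrow> u \<in> under_params D i \<and> 0 \<le> u \<and> u < 1" for u
  proof
    assume "u \<in> U"
    then show "u \<in> under_params D i \<and> 0 \<le> u \<and> u < 1"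
      using under_param classical_points by (fastforce simp: U_def points_def)
  next
    assume u: "u \<in> under_params D i \<and> 0 \<le> u \<and> u < 1"
    then obtain p where "(p, (i, u)) \<in> classical D"
      by (auto simp: under_params_def)
    then show "u \<in> U"
      unfolding U_def by force
  qed
  define nx where "nx u = Min (under_params D i \<inter> {u<..u + 1})" for u
  have nx: "nx u \<in> under_params D i" "u < nx u" "\<And>v. v \<in> under_params D i \<Longrightarrow> u < v \<Longrightarrow> nx u \<le> v"
    if "u \<in> under_params D i" for u
  proof -
    have fin: "finite (under_params D i \<inter> {u<..u + 1})"
      by (rule finite_subset[OF _ finite_under_params[of i u "u + 1"]]) auto
    have mem: "u + 1 \<in> under_params D i \<inter> {u<..u + 1}"
      using that under_params_shift[of u 1] by simp
    have "nx u \<in> under_params D i \<inter> {u<..u + 1}"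
      unfolding nx_def using fin mem by (intro Min_in) auto
    then show "nx u \<in> under_params D i" "u < nx u" by auto
    fix v assume v: "v \<in> under_params D i" "u < v"
    show "nx u \<le> v"
    proof (cases "v \<le> u + 1")
      case True
      then show ?thesis unfolding nx_def using fin v by (intro Min_le) auto
    next
      case False
      have "nx u \<le> u + 1" unfolding nx_def using fin mem by (intro Min_le) auto
      then show ?thesis using False by simp
    qed
  qed
  have out_in: "outgoing_arc D (?p, (i, u)) = incoming_arc D (?p, (i, nx u))" if u: "u \<in> under_params D i" for u
  proof -
    obtain e where e: "e > 0" "\<And>d. 0 < d \<Longrightarrow> d < e \<Longrightarrow> arc_of D i (u + d) = outgoing_arc D (?p, (i, u))"
      by (rule arc_of_sides_obtain[of u i ?p]) simp
    obtain e' where e': "e' > 0" "\<And>d. 0 < d \<Longrightarrow> d < e' \<Longrightarrow> arc_of D i (nx u - d) = incoming_arc D (?p, (i, nx u))"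
      by (rule arc_of_sides_obtain[of "nx u" i ?p]) simp
    define d where "d = min (min e e') (nx u - u) / 2"
    have d: "0 < d" "d < e" "d < e'" "u + d \<le> nx u - d"
      using e(1) e'(1) nx(2)[OF u] by (auto simp: d_def min_def field_simps)
    have "z \<notin> under_params D i" if "z \<in> {u + d..nx u - d}" for z
      using nx(3)[OF u, of z] d(1) that by auto
    then have "clear D i (u + d) (nx u - d)"
      using d(4) by (auto simp: clear_def closed_segment_eq_real_ivl)
    from arc_of_eq[OF this] e(2)[OF d(1,2)] e'(2)[OF d(1,3)] show ?thesis
      by simp
  qed
  \<comment> \<open>With a single undercrossing on the component \<open>nx u\<close> is
    \<open>u + 1\<close>, and \<open>frac\<close> leads back to \<open>u\<close>.\<close>
  define succ where "succ u = frac (nx u)" for u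
  have in_succ: "incoming_arc D (?p, (i, succ u)) = incoming_arc D (?p, (i, nx u))" for u
    using incoming_shift[of ?p i "succ u" "\<lfloor>nx u\<rfloor>"] by (simp add: succ_def frac_def)
  have succ_U: "succ ` U \<subseteq> U"
  proof
    fix v assume "v \<in> succ ` U"
    then obtain u where u: "u \<in> under_params D i" "v = frac (nx u)"
      by (auto simp: U succ_def)
    then show "v \<in> U"
      using nx(1)[OF u(1)] by (auto simp: U under_params_def frac_lt_1)
  qed
  have succ_inj: "inj_on succ U"
  proof (rule inj_onI)
    fix u v assume *: "u \<in> U" "v \<in> U" "succ u = succ v"
    then have u: "u \<in> under_params D i" "v \<in> under_params D i"
      by (auto simp: U)
    obtain n :: int where n: "nx u = nx v + of_int n"
      using *(3) unfolding succ_def by (rule frac_eq_obtain)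
    \<comment> \<open>If \<open>u\<close> were less than \<open>v + n\<close>, then
      \<open>nx u \<le> v + n < nx v + n = nx u\<close>; the opposite order is excluded in the same
      way.\<close>
    have "v + of_int n \<in> under_params D i" "u - of_int n \<in> under_params D i"
      using u under_params_shift[of v n] under_params_shift[of u "- n"] by auto
    then have "u = v + of_int n"
      using nx(3)[OF u(1), of "v + of_int n"] nx(3)[OF u(2), of "u - of_int n"] nx(2)[OF u(1)] nx(2)[OF u(2)] n
      by (cases u "v + of_int n" rule: linorder_cases) auto
    then have "frac u = frac v" by simp
    then show "u = v"
      using *(1,2) by (simp add: U)
  qed
  have "(\<Sum>c\<in>?C. F (outgoing_arc D c)) = (\<Sum>c\<in>?C. F (outgoing_arc D (?p, (i, snd (snd c)))))"
    by (intro sum.cong) (auto simp: outgoing_arc_def)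
  also have "\<dots> = (\<Sum>u\<in>U. F (outgoing_arc D (?p, (i, u))))"
    unfolding U_def by (simp add: sum.reindex[OF inj])
  also have "\<dots> = (\<Sum>u\<in>U. F (incoming_arc D (?p, (i, succ u))))"
    by (intro sum.cong) (auto simp: in_succ out_in U)
  also have "\<dots> = (\<Sum>u\<in>succ ` U. F (incoming_arc D (?p, (i, u))))"
    by (simp add: sum.reindex[OF succ_inj])
  also have "\<dots> = (\<Sum>u\<in>U. F (incoming_arc D (?p, (i, u))))"
    using endo_inj_surj[OF finU succ_U succ_inj] by simp
  also have "\<dots> = (\<Sum>c\<in>?C. F (incoming_arc D (?p, (i, snd (snd c)))))"
    unfolding U_def by (simp add: sum.reindex[OF inj])
  also have "\<dots> = (\<Sum>c\<in>?C. F (incoming_arc D c))"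
    by (intro sum.cong) (auto simp: incoming_arc_def)
  finally show ?thesis ..
qed

text \<open>
  Half of the second sum in the longitude equals the sum of \<open>w(c) b1(c)\<close>, as the sums of
  \<open>w(c) b1(c)\<close> and of \<open>w(c) b2(c)\<close> differ by the sum of all outgoing minus all incoming arcs.
\<close>

lemma longitude_lonrep: "longitude D i = quot D (lonrep D i)"
proof -
  let ?C = "{c \<in> classical D. fst (snd c) = i}"
  have half: "(\<Sum>c\<in>?C. writhe D c * (of_bool (a = b1 D c) + of_bool (a = b2 D c))) div 2 =
      (\<Sum>c\<in>?C. writhe D c * of_bool (a = b1 D c))" for a
  proof -
    have "(\<Sum>c\<in>?C. writhe D c * of_bool (a = b2 D c)) - (\<Sum>c\<in>?C. writhe D c * of_bool (a = b1 D c)) =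
        (\<Sum>c\<in>?C. of_bool (a = outgoing_arc D c) - of_bool (a = incoming_arc D c))"
      unfolding sum_subtractf[symmetric] by (intro sum.cong) (auto simp: writhe_def b1_def b2_def)
    also have "\<dots> = (0 :: int)"
      using sum_incoming_outgoing[of "\<lambda>b. of_bool (a = b) :: int" i] by (simp add: sum_subtractf)
    finally show ?thesis
      by (simp add: distrib_left sum.distrib)
  qed
  have "lonrep D i = (\<lambda>a. (\<Sum>c\<in>?C. of_int (writhe D c) * basis (over_arc D c) a) -
      of_int ((\<Sum>c\<in>?C. writhe D c * (of_bool (a = b1 D c) + of_bool (a = b2 D c))) div 2))"
  proof
    fix a :: arc
    have "basis b a = of_int (of_bool (a = b))" for b
      by (simp add: basis_def)
    then show "lonrep D i a = (\<Sum>c\<in>?C. of_int (writhe D c) * basis (over_arc D c) a) -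
        of_int ((\<Sum>c\<in>?C. writhe D c * (of_bool (a = b1 D c) + of_bool (a = b2 D c))) div 2)"
      unfolding half by (simp add: lonrep_def sum_apply right_diff_distrib sum_subtractf)
  qed
  then show ?thesis
    by (simp only: longitude_def Let_def component_of_crossing)
qed

lemma lonrep_in_free_module: "lonrep D i \<in> free_module (arcs D)"
  unfolding lonrep_def
  by (intro lmod.subspace_sum[OF subspace_free_module] lmod.subspace_scale[OF subspace_free_module]
      lmod.subspace_diff[OF subspace_free_module] basis_in_free_module) (auto intro: crossing_arcs)

lemma longitude_in_carrier: "longitude D i \<in> carrier (M_red D)"
  using lonrep_in_free_module by (auto simp: longitude_lonrep M_red_def)

lemma rels_subset: "rels D \<subseteq> free_module (arcs D)"
  by (auto simp: rels_def rho_conv relator_def intro!: lmod.subspace_sum[OF subspace_free_module]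
      lmod.subspace_scale[OF subspace_free_module] lmod.subspace_diff[OF subspace_free_module]
      lmod.subspace_add[OF subspace_free_module] basis_in_free_module crossing_arcs)

end


section \<open>Meridians\<close>

lemma phi_lift_add: "phi_lift D (x + y) = phi_lift D x + phi_lift D y"
  by (auto simp: phi_lift_def sum.distrib fun_eq_iff)

lemma phi_lift_scale:
  "phi_lift D (r *\<^sub>L x) = (case phi_lift D x of (p, n) \<Rightarrow> (r * p, \<lambda>i. augmentation r * n i))"
  by (auto simp: phi_lift_def sum_distrib_left fun_eq_iff)

text \<open>The common value of \<open>phi\<close> on the arcs of component \<open>i\<close> in a
  diagram with \<open>n\<close> components. For the first component all integer coordinates vanish,
  because they start at index 2.\<close>

definition phi_unit :: "nat \<Rightarrow> nat \<Rightarrow> laurent \<times> (nat \<Rightarrow> int)" where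
  "phi_unit n i = (1, \<lambda>j. if j \<in> {2..n} \<and> i = j then 1 else 0)"

lemma subspace_phi_lift:
  assumes "\<And>x y. F (x + y) = F x + F y" "\<And>r x. F (r *\<^sub>L x) = r *\<^sub>L F x"
  shows "lmod.subspace {x. phi_lift D' (F x) = phi_lift D x}"
proof (rule lmod.subspaceI)
  have "F 0 = 0"
    using assms(2)[of 0 0] by simp
  then show "0 \<in> {x. phi_lift D' (F x) = phi_lift D x}"
    by (simp add: phi_lift_def fun_eq_iff)
qed (auto simp: assms phi_lift_add phi_lift_scale)

context valid_diagram
begin

lemma phi_lift_basis: "a \<in> arcs D \<Longrightarrow> phi_lift D (basis a) = phi_unit (ncomp D) (component_of a)"
  using finite_arcs by (auto simp: phi_lift_def phi_unit_def basis_def fun_eq_iff if_distrib[of augmentation] cong: if_cong)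

text \<open>This makes \<open>phi\<close> independent of the chosen representative. In the first
  coordinate (1 - t) + t - 1 = 0; in the others the overpassing arc has the coefficient 0, and the
  two underpassing arcs cancel because they lie on the same component.\<close>

lemma phi_lift_rels:
  assumes "x \<in> rels D"
  shows "phi_lift D x = 0"
proof -
  have zero: "phi_lift D 0 = 0"
    by (simp add: phi_lift_def fun_eq_iff prod_eq_iff)
  have sub: "lmod.subspace {x. phi_lift D x = 0}"
    by (rule lmod.subspaceI) (auto simp: phi_lift_add phi_lift_scale zero, simp_all add: zero_prod_def zero_fun_def)
  have "phi_lift D (relator D c) = 0" if c: "c \<in> classical D" for c
  proof -
    have "relator D c = ((1 - tvar) *\<^sub>L basis (over_arc D c) + tvar *\<^sub>L basis (b1 D c)) + (- 1) *\<^sub>L basis (b2 D c)"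
      by (simp add: relator_def)
    then show ?thesis
      using crossing_arcs[OF c] component_of_crossing[of c]
      by (simp only: phi_lift_add phi_lift_scale phi_lift_basis)
        (auto simp: phi_unit_def zero_prod_def fun_eq_iff)
  qed
  then have "rho D y \<in> {x. phi_lift D x = 0}" for y
    unfolding rho_conv by (intro lmod.subspace_sum[OF sub] lmod.subspace_scale[OF sub]) auto
  then show ?thesis
    using assms by (auto simp: rels_def)
qed

lemma phi_quot: "phi D (quot D x) = phi_lift D x"
proof -
  have "(SOME y. y \<in> quot D x) \<in> quot D x"
    by (rule someI[of "\<lambda>y. y \<in> quot D x"]) (rule quot_self)
  then show ?thesis
    unfolding phi_def using phi_lift_rels by (auto simp: quot_conv phi_lift_add)
qed

lemma meridians_conv:
  assumes "i \<in> {1..ncomp D}"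
  shows "meridians D i = {X \<in> carrier (M_red D). phi D X = phi_unit (ncomp D) i}"
  using ex_arc_on_component[OF assms] by (auto simp: meridians_def phi_quot phi_lift_basis)

end


section \<open>Isomorphisms of enhanced modules\<close>

text \<open>Equality of the numbers of components is part of the relation so that isomorphisms along
  a chain of moves can be composed.\<close>

definition enhanced_isomorphic :: "diagram \<Rightarrow> diagram \<Rightarrow> bool" where
  "enhanced_isomorphic D D' \<longleftrightarrow> ncomp D = ncomp D' \<and> (\<exists>f. f \<in> enhanced_iso (ncomp D) (M_enr D) (M_enr D'))"

lemma enhanced_isoI:
  assumes "\<And>X Y. X \<in> carrier (M_red D) \<Longrightarrow> Y \<in> carrier (M_red D) \<Longrightarrow>
      f (X \<oplus>\<^bsub>M_red D\<^esub> Y) = f X \<oplus>\<^bsub>M_red D'\<^esub> f Y"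
    and "\<And>r X. X \<in> carrier (M_red D) \<Longrightarrow> f (r \<odot>\<^bsub>M_red D\<^esub> X) = r \<odot>\<^bsub>M_red D'\<^esub> f X"
    and "bij_betw f (carrier (M_red D)) (carrier (M_red D'))"
    and "\<And>i. i \<in> {1..\<mu>} \<Longrightarrow> f ` meridians D i = meridians D' i"
    and "\<And>i. i \<in> {1..\<mu>} \<Longrightarrow> f (longitude D i) = longitude D' i"
  shows "f \<in> enhanced_iso \<mu> (M_enr D) (M_enr D')"
  using assms bij_betwE[OF assms(3)]
  by (auto simp: enhanced_iso_def M_enr_def module_iso_def iso_def hom_def)

lemma enhanced_isoD:
  assumes "f \<in> enhanced_iso \<mu> (M_enr D) (M_enr D')"
  shows "\<And>X Y. X \<in> carrier (M_red D) \<Longrightarrow> Y \<in> carrier (M_red D) \<Longrightarrow>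
      f (X \<oplus>\<^bsub>M_red D\<^esub> Y) = f X \<oplus>\<^bsub>M_red D'\<^esub> f Y"
    and "\<And>r X. X \<in> carrier (M_red D) \<Longrightarrow> f (r \<odot>\<^bsub>M_red D\<^esub> X) = r \<odot>\<^bsub>M_red D'\<^esub> f X"
    and "bij_betw f (carrier (M_red D)) (carrier (M_red D'))"
    and "\<And>i. i \<in> {1..\<mu>} \<Longrightarrow> f ` meridians D i = meridians D' i"
    and "\<And>i. i \<in> {1..\<mu>} \<Longrightarrow> f (longitude D i) = longitude D' i"
  using assms by (auto simp: enhanced_iso_def M_enr_def module_iso_def iso_def hom_def Laurent_ring_def)

lemma enhanced_isomorphic_refl: "enhanced_isomorphic D D"
  unfolding enhanced_isomorphic_def by (auto intro!: exI[of _ id] enhanced_isoI)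

lemma enhanced_isomorphic_trans:
  assumes "enhanced_isomorphic D D'" "enhanced_isomorphic D' D''"
  shows "enhanced_isomorphic D D''"
proof -
  obtain f where f: "f \<in> enhanced_iso (ncomp D) (M_enr D) (M_enr D')"
    using assms(1) by (auto simp: enhanced_isomorphic_def)
  obtain g where g: "g \<in> enhanced_iso (ncomp D) (M_enr D') (M_enr D'')"
    using assms by (auto simp: enhanced_isomorphic_def)
  note f' = enhanced_isoD[OF f] and g' = enhanced_isoD[OF g]
  have "g \<circ> f \<in> enhanced_iso (ncomp D) (M_enr D) (M_enr D'')"
  proof (rule enhanced_isoI)
    fix i assume "i \<in> {1..ncomp D}"
    then show "(g \<circ> f) ` meridians D i = meridians D'' i"
      unfolding image_comp[symmetric] by (simp only: f' g')
  qed (use bij_betwE[OF f'(3)] in \<open>auto simp: f' g' intro!: bij_betw_trans[OF f'(3) g'(3)]\<close>)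
  then show ?thesis
    using assms by (auto simp: enhanced_isomorphic_def)
qed

lemma enhanced_isomorphic_sym:
  assumes "enhanced_isomorphic D D'" "link_diagram D"
  shows "enhanced_isomorphic D' D"
proof -
  interpret valid_diagram D
    by standard (rule assms(2))
  interpret M: Module.module Laurent_ring "M_red D"
    by (rule module_M_red)
  let ?n = "ncomp D" and ?M = "carrier (M_red D)" and ?M' = "carrier (M_red D')"
  obtain f where f: "f \<in> enhanced_iso ?n (M_enr D) (M_enr D')"
    using assms(1) by (auto simp: enhanced_isomorphic_def)
  note f' = enhanced_isoD[OF f]
  let ?g = "inv_into ?M f"
  have g: "bij_betw ?g ?M' ?M"
    by (rule bij_betw_inv_into[OF f'(3)])
  have inj: "inj_on f ?M" and im: "f ` ?M = ?M'"
    using f'(3) by (auto simp: bij_betw_def)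
  have gf: "?g (f X) = X" if "X \<in> ?M" for X
    by (rule inv_into_f_f[OF inj that])
  have gX: "?g Y \<in> ?M" "f (?g Y) = Y" if "Y \<in> ?M'" for Y
    using that im inv_into_into[of Y f ?M] f_inv_into_f[of Y f ?M] by blast+
  have "?g \<in> enhanced_iso ?n (M_enr D') (M_enr D)"
  proof (rule enhanced_isoI)
    fix X Y assume X: "X \<in> ?M'" "Y \<in> ?M'"
    have "f (?g X \<oplus>\<^bsub>M_red D\<^esub> ?g Y) = X \<oplus>\<^bsub>M_red D'\<^esub> Y"
      using X by (simp add: f' gX)
    then show "?g (X \<oplus>\<^bsub>M_red D'\<^esub> Y) = ?g X \<oplus>\<^bsub>M_red D\<^esub> ?g Y"
      using gf[of "?g X \<oplus>\<^bsub>M_red D\<^esub> ?g Y"] X gX by (simp add: M.a_closed)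
  next
    fix r X assume X: "X \<in> ?M'"
    have "f (r \<odot>\<^bsub>M_red D\<^esub> ?g X) = r \<odot>\<^bsub>M_red D'\<^esub> X"
      using X by (simp add: f' gX)
    moreover have "r \<odot>\<^bsub>M_red D\<^esub> ?g X \<in> ?M"
      using X gX by (intro M.smult_closed) (auto simp: Laurent_ring_def)
    ultimately show "?g (r \<odot>\<^bsub>M_red D'\<^esub> X) = r \<odot>\<^bsub>M_red D\<^esub> ?g X"
      using gf by metis
  next
    fix i assume i: "i \<in> {1..?n}"
    have "meridians D i \<subseteq> ?M"
      by (auto simp: meridians_def)
    then show "?g ` meridians D' i = meridians D i"
      using f'(4)[OF i] inj by (metis inv_into_image_cancel)
    show "?g (longitude D' i) = longitude D i"
      using f'(5)[OF i] gf longitude_in_carrier by metis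
  qed (rule g)
  then show ?thesis
    using assms(1) by (auto simp: enhanced_isomorphic_def)
qed

text \<open>The colours of the points with \<open>P i x\<close> generate the module.\<close>

definition generating :: "diagram \<Rightarrow> (nat \<Rightarrow> real \<Rightarrow> bool) \<Rightarrow> bool" where
  "generating D P \<longleftrightarrow> (\<forall>Z. lmod.subspace Z \<longrightarrow> rels D \<subseteq> Z \<longrightarrow> (\<forall>i x. P i x \<longrightarrow> colour D i x \<in> Z) \<longrightarrow>
    (\<forall>i\<in>{1..ncomp D}. \<forall>x. x \<notin> under_params D i \<longrightarrow> colour D i x \<in> Z))"

lemma (in valid_diagram) generating_free_module:
  assumes "generating D P" "lmod.subspace Z" "rels D \<subseteq> Z" "\<And>i x. P i x \<Longrightarrow> colour D i x \<in> Z"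
  shows "free_module (arcs D) \<subseteq> Z"
proof
  fix x assume "x \<in> free_module (arcs D)"
  then have x: "x = (\<Sum>a\<in>arcs D. x a *\<^sub>L basis a)"
    by (rule free_module_conv[OF finite_arcs])
  have "basis a \<in> Z" if "a \<in> arcs D" for a
    using that assms unfolding generating_def arcs_def colour_def by fastforce
  then show "x \<in> Z"
    by (subst x) (intro lmod.subspace_sum[OF assms(2)] lmod.subspace_scale[OF assms(2)], auto)
qed

lemma M_red_plus: "quot D x \<oplus>\<^bsub>M_red D\<^esub> quot D y = quot D (x + y)"
  by (simp add: M_red_add plus_fun_def)

lemma M_red_scl: "r \<odot>\<^bsub>M_red D\<^esub> quot D x = quot D (r *\<^sub>L x)"
  by (simp add: M_red_smult scl_def)

text \<open>The values of a colouring are arbitrary functions on sets of points and need not be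
  supported on arcs. Truncation forces the images into the free module and is the identity on
  everything congruent to one of its elements.\<close>

definition proj :: "'a set \<Rightarrow> ('a \<Rightarrow> laurent) \<Rightarrow> 'a \<Rightarrow> laurent" where
  "proj A x = (\<lambda>a. if a \<in> A then x a else 0)"

lemma proj_add: "proj A (x + y) = proj A x + proj A y"
  and proj_scale: "proj A (r *\<^sub>L x) = r *\<^sub>L proj A x"
  and proj_in_free_module: "proj A x \<in> free_module A"
  and proj_id: "x \<in> free_module A \<Longrightarrow> proj A x = x"
  by (auto simp: proj_def free_module_def fun_eq_iff)

text \<open>One half of the isomorphism, on representatives: a colouring of \<open>D\<close> by the
  module of \<open>D'\<close> gives the linear map \<open>F\<close>. It is stated separately to be
  used once more with the diagrams exchanged. \<open>R i x x'\<close> relates points whose colours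
  are to correspond.\<close>

lemma enhanced_isomorphicI_aux:
  assumes D: "link_diagram D" and g: "congruence.colouring (rels D') D g"
    and D': "link_diagram D'"
    and R: "\<forall>i x x'. R i x x' \<longrightarrow> i \<in> {1..ncomp D} \<and> x \<notin> under_params D i \<and> x' \<notin> under_params D' i \<and>
      congruence.cong (rels D') (g i x) (colour D' i x')"
    and n: "ncomp D' = ncomp D"
  defines "F \<equiv> \<lambda>x. proj (arcs D') (lin D g x)"
  shows "F (x + y) = F x + F y" "F (r *\<^sub>L x) = r *\<^sub>L F x" "F x \<in> free_module (arcs D')"
    "x \<in> rels D \<Longrightarrow> F x \<in> rels D'" "R i u u' \<Longrightarrow> F (colour D i u) - colour D' i u' \<in> rels D'"
    "congruence.cong (rels D') (congruence.lonsum (rels D') D g j) z \<Longrightarrow> z \<in> free_module (arcs D') \<Longrightarrow>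
      F (lonrep D j) - z \<in> rels D'"
proof -
  interpret D: valid_diagram D by standard (rule D)
  interpret D': valid_diagram D' by standard (rule D')
  interpret K: congruence "rels D'" by (rule congruence_rels)
  interpret C: coloured_diagram D "rels D'" g by standard (rule g)
  show "F (x + y) = F x + F y" "F (r *\<^sub>L x) = r *\<^sub>L F x" "F x \<in> free_module (arcs D')"
    by (auto simp: F_def proj_add proj_scale lin_add lin_scale proj_in_free_module)
  have pr: "proj (arcs D') x = x" if "x \<in> rels D'" for x
    using that D'.rels_subset by (intro proj_id) auto
  show "F x \<in> rels D'" if "x \<in> rels D"
    using C.lin_rels[OF that] by (simp add: F_def pr)
  have diff: "proj (arcs D') x - x' \<in> rels D'" if "x - x' \<in> rels D'" "x' \<in> free_module (arcs D')" for x x'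
  proof -
    have "proj (arcs D') x = proj (arcs D') (x - x') + proj (arcs D') x'"
      by (simp add: proj_add[symmetric])
    then show ?thesis
      using that by (simp add: pr proj_id)
  qed
  show "F (colour D i u) - colour D' i u' \<in> rels D'" if "R i u u'"
  proof -
    note r = R[rule_format, OF that]
    have "K.cong (lin D g (colour D i u)) (colour D' i u')"
      using C.lin_arc_of[of i u] r K.cong_trans unfolding colour_def by blast
    then show ?thesis
      unfolding F_def using r n D'.arc_of_in_arcs
      by (intro diff) (auto simp: K.cong_def colour_def intro!: basis_in_free_module)
  qed
  show "F (lonrep D j) - z \<in> rels D'" if "K.cong (K.lonsum D g j) z" "z \<in> free_module (arcs D')"
    unfolding F_def using K.cong_trans[OF C.lin_lonrep[of j] that(1)]
    by (intro diff that(2)) (simp add: K.cong_def)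
qed

text \<open>The criterion for all moves that change the set of arcs. The related points generate
  both modules, so they determine the compositions of the two maps as well as the effect on
  \<open>phi\<close>. As meridians are the fibres of \<open>phi\<close>, a bijection compatible with
  \<open>phi\<close> maps meridians onto meridians. Longitudes need to be compared for one of the
  two maps only.\<close>

lemma enhanced_isomorphicI:
  assumes D: "link_diagram D" and D': "link_diagram D'" and n: "ncomp D' = ncomp D"
    and g: "congruence.colouring (rels D') D g" and g': "congruence.colouring (rels D) D' g'"
    and R: "\<And>i x x'. R i x x' \<Longrightarrow> i \<in> {1..ncomp D} \<and> x \<notin> under_params D i \<and> x' \<notin> under_params D' i \<and>
      congruence.cong (rels D') (g i x) (colour D' i x') \<and> congruence.cong (rels D) (g' i x') (colour D i x)"
    and gen: "generating D (\<lambda>i x. \<exists>x'. R i x x')" and gen': "generating D' (\<lambda>i x'. \<exists>x. R i x x')"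
    and lon: "\<And>i. i \<in> {1..ncomp D} \<Longrightarrow> congruence.cong (rels D')
      (congruence.lonsum (rels D') D g i) (congruence.lonsum (rels D') D' (colour D') i)"
  shows "enhanced_isomorphic D D'"
proof -
  interpret D: valid_diagram D by standard (rule D)
  interpret D': valid_diagram D' by standard (rule D')
  interpret K': congruence "rels D'" by (rule congruence_rels)
  define F where "F x = proj (arcs D') (lin D g x)" for x
  define F' where "F' x = proj (arcs D) (lin D' g' x)" for x
  have R1: "\<forall>i x x'. R i x x' \<longrightarrow> i \<in> {1..ncomp D} \<and> x \<notin> under_params D i \<and> x' \<notin> under_params D' i \<and>
      congruence.cong (rels D') (g i x) (colour D' i x')"
    using R by blast
  have R2: "\<forall>i x' x. R i x x' \<longrightarrow> i \<in> {1..ncomp D'} \<and> x' \<notin> under_params D' i \<and> x \<notin> under_params D i \<and>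
      congruence.cong (rels D) (g' i x') (colour D i x)"
    using R n by simp
  note F = enhanced_isomorphicI_aux[where R = R, OF D g D' R1 n, folded F_def]
  note F' = enhanced_isomorphicI_aux[where R = "\<lambda>i x' x. R i x x'", OF D' g' D R2 n[symmetric], folded F'_def]
  have diff: "F (x - y) = F x - F y" for x y
    using F(1)[of "x - y" y] by simp
  have diff': "F' (x - y) = F' x - F' y" for x y
    using F'(1)[of "x - y" y] by simp
  have F'F: "F' (F x) - x \<in> rels D" if "x \<in> free_module (arcs D)" for x
  proof -
    \<comment> \<open>The elements fixed modulo the relations form a submodule that contains the
      relations, so it suffices to look at generators.\<close>
    let ?Z = "{x. F' (F x) - x \<in> rels D}"
    have "free_module (arcs D) \<subseteq> ?Z"
    proof (rule D.generating_free_module[OF gen])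
      show "lmod.subspace ?Z"
      proof (rule lmod.subspaceI)
        have "F 0 = 0" "F' 0 = 0"
          using F(2)[of 0 0] F'(2)[of 0 0] by simp_all
        then show "0 \<in> ?Z" by (simp add: lmod.subspace_0[OF subspace_rels])
      next
        fix x y assume "x \<in> ?Z" "y \<in> ?Z"
        then have "(F' (F x) - x) + (F' (F y) - y) \<in> rels D"
          by (auto intro: lmod.subspace_add[OF subspace_rels])
        then show "x + y \<in> ?Z" by (simp add: F F' algebra_simps)
      next
        fix r x assume "x \<in> ?Z"
        then have "r *\<^sub>L (F' (F x) - x) \<in> rels D"
          by (auto intro: lmod.subspace_scale[OF subspace_rels])
        then show "r *\<^sub>L x \<in> ?Z" by (simp add: F F' lmod.scale_right_diff_distrib)
      qed
      show "rels D \<subseteq> ?Z"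
        using F(4) F'(4) by (auto intro!: lmod.subspace_diff[OF subspace_rels])
      fix i x assume "\<exists>x'. R i x x'"
      then obtain x' where r: "R i x x'" by blast
      from lmod.subspace_add[OF subspace_rels F'(4)[OF F(5)[OF r]] F'(5)[OF r]]
      show "colour D i x \<in> ?Z" by (simp add: diff')
    qed
    then show ?thesis using that by blast
  qed
  have FF': "F (F' x) - x \<in> rels D'" if "x \<in> free_module (arcs D')" for x
  proof -
    let ?Z = "{x. F (F' x) - x \<in> rels D'}"
    have "free_module (arcs D') \<subseteq> ?Z"
    proof (rule D'.generating_free_module[OF gen'])
      show "lmod.subspace ?Z"
      proof (rule lmod.subspaceI)
        have "F 0 = 0" "F' 0 = 0"
          using F(2)[of 0 0] F'(2)[of 0 0] by simp_all
        then show "0 \<in> ?Z" by (simp add: lmod.subspace_0[OF subspace_rels])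
      next
        fix x y assume "x \<in> ?Z" "y \<in> ?Z"
        then have "(F (F' x) - x) + (F (F' y) - y) \<in> rels D'"
          by (auto intro: lmod.subspace_add[OF subspace_rels])
        then show "x + y \<in> ?Z" by (simp add: F F' algebra_simps)
      next
        fix r x assume "x \<in> ?Z"
        then have "r *\<^sub>L (F (F' x) - x) \<in> rels D'"
          by (auto intro: lmod.subspace_scale[OF subspace_rels])
        then show "r *\<^sub>L x \<in> ?Z" by (simp add: F F' lmod.scale_right_diff_distrib)
      qed
      show "rels D' \<subseteq> ?Z"
        using F(4) F'(4) by (auto intro!: lmod.subspace_diff[OF subspace_rels])
      fix i x' assume "\<exists>x. R i x x'"
      then obtain x where r: "R i x x'" by blast
      from lmod.subspace_add[OF subspace_rels F(4)[OF F'(5)[OF r]] F(5)[OF r]]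
      show "colour D' i x' \<in> ?Z" by (simp add: diff)
    qed
    then show ?thesis using that by blast
  qed
  have phiF: "phi_lift D' (F x) = phi_lift D x" if "x \<in> free_module (arcs D)" for x
  proof -
    let ?Z = "{x. phi_lift D' (F x) = phi_lift D x}"
    have "free_module (arcs D) \<subseteq> ?Z"
    proof (rule D.generating_free_module[OF gen])
      show "lmod.subspace ?Z" by (rule subspace_phi_lift) (rule F)+
      show "rels D \<subseteq> ?Z" using F(4) D.phi_lift_rels D'.phi_lift_rels by auto
      fix i x assume "\<exists>x'. R i x x'"
      then obtain x' where r: "R i x x'" by blast
      have "F (colour D i x) = colour D' i x' + (F (colour D i x) - colour D' i x')"
        by simp
      then have "phi_lift D' (F (colour D i x)) = phi_lift D' (colour D' i x')"
        using D'.phi_lift_rels[OF F(5)[OF r]] phi_lift_add by (metis add.right_neutral)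
      also have "\<dots> = phi_lift D (colour D i x)"
        using R[OF r] n by (simp add: colour_def D.phi_lift_basis D'.phi_lift_basis
            D.arc_of_in_arcs D'.arc_of_in_arcs component_of_arc_of)
      finally show "colour D i x \<in> ?Z" by simp
    qed
    then show ?thesis using that by blast
  qed
  let ?M = "carrier (M_red D)" and ?M' = "carrier (M_red D')"
  \<comment> \<open>As \<open>F\<close> respects relations, all the cosets in this union
    coincide.\<close>
  define f where "f = (\<lambda>X. \<Union>x\<in>X. quot D' (F x))"
  have f: "f (quot D x) = quot D' (F x)" for x
  proof -
    have "quot D' (F y) = quot D' (F x)" if "y \<in> quot D x" for y
      using that F(4) unfolding quot_eq_iff by (auto simp: quot_conv F(1))
    then have "f (quot D x) = (\<Union>y\<in>quot D x. quot D' (F x))"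
      unfolding f_def by (intro SUP_cong refl)
    then show ?thesis
      using quot_self[of x D] by auto
  qed
  have M: "?M = quot D ` free_module (arcs D)" "?M' = quot D' ` free_module (arcs D')"
    by (simp_all add: M_red_def)
  have bij: "bij_betw f ?M ?M'"
  proof (rule bij_betw_imageI)
    show "inj_on f ?M"
    proof (rule inj_onI)
      fix X Y assume XY: "X \<in> ?M" "Y \<in> ?M" "f X = f Y"
      obtain x y where xy: "x \<in> free_module (arcs D)" "y \<in> free_module (arcs D)" "X = quot D x" "Y = quot D y"
        using XY(1,2) unfolding M by blast
      have "F' (F (x - y)) \<in> rels D"
        using XY(3) xy F'(4) by (simp add: f quot_eq_iff diff)
      moreover have "F' (F (x - y)) - (x - y) \<in> rels D"
        using xy by (intro F'F lmod.subspace_diff[OF subspace_free_module])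
      ultimately have "F' (F (x - y)) - (F' (F (x - y)) - (x - y)) \<in> rels D"
        by (rule lmod.subspace_diff[OF subspace_rels])
      then show "X = Y"
        by (simp add: xy quot_eq_iff)
    qed
    show "f ` ?M = ?M'"
    proof (intro equalityI subsetI)
      fix Y assume "Y \<in> ?M'"
      then obtain y where "y \<in> free_module (arcs D')" "Y = quot D' y"
        unfolding M by blast
      then have "Y = f (quot D (F' y))"
        using FF'[of y] by (simp add: f quot_eq_iff[symmetric])
      then show "Y \<in> f ` ?M"
        using F'(3) unfolding M by blast
    qed (use F(3) in \<open>auto simp: M f\<close>)
  qed
  have phif: "phi D' (f X) = phi D X" if "X \<in> ?M" for X
    using that phiF unfolding M by (auto simp: f D.phi_quot D'.phi_quot)
  have "f \<in> enhanced_iso (ncomp D) (M_enr D) (M_enr D')"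
  proof (rule enhanced_isoI)
    fix i assume i: "i \<in> {1..ncomp D}"
    show "f ` meridians D i = meridians D' i"
    proof -
      have "i \<in> {1..ncomp D'}" using i n by simp
      moreover have "f ` {X \<in> ?M. phi D X = u} = {Y \<in> ?M'. phi D' Y = u}" for u
        unfolding bij_betw_imp_surj_on[OF bij, symmetric] using phif by auto
      ultimately show ?thesis
        using D.meridians_conv[OF i] D'.meridians_conv[of i] n by simp
    qed
    have "F (lonrep D i) - lonrep D' i \<in> rels D'"
      using K'.cong_trans[OF lon[OF i] K'.cong_sym[OF D'.lonrep_lonsum]]
      by (rule F(6)) (rule D'.lonrep_in_free_module)
    then show "f (longitude D i) = longitude D' i"
      by (simp add: D.longitude_lonrep D'.longitude_lonrep f quot_eq_iff)
  next
    fix X Y assume "X \<in> ?M" "Y \<in> ?M"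
    then obtain x y where "X = quot D x" "Y = quot D y"
      unfolding M by blast
    then show "f (X \<oplus>\<^bsub>M_red D\<^esub> Y) = f X \<oplus>\<^bsub>M_red D'\<^esub> f Y"
      by (simp only: M_red_plus f F(1))
  next
    fix r X assume "X \<in> ?M"
    then obtain x where "X = quot D x"
      unfolding M by blast
    then show "f (r \<odot>\<^bsub>M_red D\<^esub> X) = r \<odot>\<^bsub>M_red D'\<^esub> f X"
      by (simp only: M_red_scl f F(2))
  qed (rule bij)
  then show ?thesis
    using n by (auto simp: enhanced_isomorphic_def)
qed

section \<open>Velocities\<close>

lemma velocity_eqI:
  assumes "e > 0" "\<And>y. \<bar>y - x\<bar> < e \<Longrightarrow> curve D' i y = curve D i y"
  shows "velocity D' (i, x) = velocity D (i, x)"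
proof -
  have "eventually (\<lambda>y. curve D' i y = curve D i y) (nhds x)"
    unfolding eventually_nhds_metric using assms by (auto simp: dist_real_def)
  then show ?thesis
    unfolding velocity_def by (intro vector_derivative_cong_eq) (auto elim: eventually_mono)
qed

lemma right_to_left_cong:
  assumes "velocity D' (fst c) = velocity D (fst c)" "velocity D' (snd c) = velocity D (snd c)"
  shows "right_to_left D' c = right_to_left D c"
  using assms by (simp add: right_to_left_def)

lemma det2_scale: "det2 (r *\<^sub>R v) (s *\<^sub>R w) = r * s * det2 v w"
  by (simp add: det2_def algebra_simps)

text \<open>The factor is the determinant of \<open>L\<close>, which is positive for the derivative
  of an orientation-preserving diffeomorphism.\<close>

lemma det2_linear:
  assumes "linear L"
  shows "det2 (L v) (L w) = det2 (L 1) (L \<i>) * det2 v w"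
proof -
  have L: "L z = Re z *\<^sub>R L 1 + Im z *\<^sub>R L \<i>" for z
  proof -
    have "z = Re z *\<^sub>R 1 + Im z *\<^sub>R \<i>"
      by (simp add: complex_eq_iff)
    then have "L z = L (Re z *\<^sub>R 1 + Im z *\<^sub>R \<i>)"
      by (rule arg_cong)
    also have "\<dots> = Re z *\<^sub>R L 1 + Im z *\<^sub>R L \<i>"
      using assms by (simp add: linear_add linear_scale)
    finally show ?thesis .
  qed
  show ?thesis
    by (simp add: L[of v] L[of w] det2_def algebra_simps)
qed

lemma has_vector_derivative_shift_period:
  assumes "\<And>x. f (x + 1) = f x" "(f has_vector_derivative v) (at (x + of_int n))"
  shows "(f has_vector_derivative v) (at x)"
proof -
  have *: "f (y + of_nat k) = f y" for y and k :: nat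
  proof (induction k)
    case (Suc k)
    have "f (y + of_nat (Suc k)) = f (y + of_nat k + 1)"
      by (simp add: algebra_simps)
    then show ?case
      using Suc assms(1) by simp
  qed simp
  have f: "f (y + of_int n) = f y" for y
    using *[of y "nat n"] *[of "y + of_int n" "nat (- n)"] by (cases "n \<ge> 0") auto
  have "((\<lambda>y. y + of_int n) has_vector_derivative 1) (at x)"
    by (auto intro!: derivative_eq_intros)
  from vector_diff_chain_at[OF this assms(2)] show ?thesis
    by (simp add: o_def f)
qed

lemma has_vector_derivative_lim:
  assumes "(f has_vector_derivative v) (at x)"
  shows "((\<lambda>h. (f (x + h) - f x) /\<^sub>R h) \<longlongrightarrow> v) (at 0)"
proof -
  have "((\<lambda>h. norm (f (x + h) - f x - h *\<^sub>R v) / norm h) \<longlongrightarrow> 0) (at 0)"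
    using assms by (simp add: has_vector_derivative_def has_derivative_at)
  moreover have "eventually (\<lambda>h. norm (f (x + h) - f x - h *\<^sub>R v) / norm h = norm ((f (x + h) - f x) /\<^sub>R h - v)) (at 0)"
    unfolding eventually_at
  proof (intro exI[of _ 1] conjI ballI impI)
    fix h :: real assume "h \<noteq> 0 \<and> dist h 0 < 1"
    then have "(f (x + h) - f x) /\<^sub>R h - v = (f (x + h) - f x - h *\<^sub>R v) /\<^sub>R h"
      by (simp add: scaleR_diff_right)
    then show "norm (f (x + h) - f x - h *\<^sub>R v) / norm h = norm ((f (x + h) - f x) /\<^sub>R h - v)"
      by (simp add: divide_inverse)
  qed auto
  ultimately have "((\<lambda>h. norm ((f (x + h) - f x) /\<^sub>R h - v)) \<longlongrightarrow> 0) (at 0)"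
    by (rule Lim_transform_eventually)
  then show ?thesis
    by (simp add: tendsto_norm_zero_iff LIM_zero_iff)
qed

text \<open>The reparametrization \<open>\<phi>\<close> itself need not be differentiable.\<close>

lemma velocity_reparametrized:
  fixes f :: "real \<Rightarrow> complex"
  assumes v: "(f has_vector_derivative v) (at (\<phi> x))" "v \<noteq> 0"
    and w: "((\<lambda>x. f (\<phi> x)) has_vector_derivative w) (at x)" "w \<noteq> 0"
    and \<phi>: "continuous_on UNIV \<phi>" "strict_mono (\<phi> :: real \<Rightarrow> real)"
  shows "\<exists>r>0. w = r *\<^sub>R v"
proof -
  define k where "k h = \<phi> (x + h) - \<phi> x" for h
  define A where "A h = (f (\<phi> (x + h)) - f (\<phi> x)) /\<^sub>R k h" for h
  have k_pos: "k h > 0" if "h > 0" for h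
    using \<phi>(2) that by (simp add: k_def strict_mono_def)
  have ev: "eventually (\<lambda>h. h > 0 \<and> k h > 0) (at_right 0)"
    using k_pos by (intro eventually_at_rightI[of 0 1]) auto
  have "isCont \<phi> x"
    using \<phi>(1) by (simp add: continuous_on_eq_continuous_at)
  then have "((\<lambda>h. \<phi> (x + h)) \<longlongrightarrow> \<phi> x) (at 0)"
    by (simp add: isCont_def LIM_offset_zero_iff)
  then have "((\<lambda>h. \<phi> (x + h)) \<longlongrightarrow> \<phi> x) (at_right 0)"
    by (simp add: filterlim_at_split)
  then have "(k \<longlongrightarrow> 0) (at_right 0)"
    unfolding k_def by (intro tendsto_eq_intros) auto
  then have "filterlim k (at 0) (at_right 0)"
    using ev by (auto simp: filterlim_at elim: eventually_mono)
  from filterlim_compose[OF has_vector_derivative_lim[OF v(1)] this]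
  have A: "(A \<longlongrightarrow> v) (at_right 0)"
    by (simp add: A_def[abs_def] k_def)
  have "((\<lambda>h. (f (\<phi> (x + h)) - f (\<phi> x)) /\<^sub>R h) \<longlongrightarrow> w) (at_right 0)"
    using has_vector_derivative_lim[OF w(1)] by (simp add: filterlim_at_split)
  moreover have eq: "eventually (\<lambda>h. (f (\<phi> (x + h)) - f (\<phi> x)) /\<^sub>R h = (k h / h) *\<^sub>R A h) (at_right 0)"
    using ev by (rule eventually_mono) (auto simp: A_def divide_inverse)
  ultimately have qA: "((\<lambda>h. (k h / h) *\<^sub>R A h) \<longlongrightarrow> w) (at_right 0)"
    by (rule Lim_transform_eventually)
  \<comment> \<open>The quotients \<open>k h / h\<close> are isolated by an inner product with
    \<open>v\<close>: both \<open>A h\<close> and the product with \<open>A h\<close> converge, and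
    \<open>A h \<bullet> v\<close> tends to \<open>v \<bullet> v\<close>, which is positive.\<close>
  have "((\<lambda>h. ((k h / h) *\<^sub>R A h) \<bullet> v / (A h \<bullet> v)) \<longlongrightarrow> (w \<bullet> v) / (v \<bullet> v)) (at_right 0)"
    by (rule tendsto_divide[OF tendsto_inner[OF qA tendsto_const] tendsto_inner[OF A tendsto_const]])
      (use v(2) in simp)
  moreover have "eventually (\<lambda>h. A h \<bullet> v > 0) (at_right 0)"
  proof -
    have "((\<lambda>h. A h \<bullet> v) \<longlongrightarrow> v \<bullet> v) (at_right 0)"
      by (intro tendsto_intros A)
    then show ?thesis
      by (rule order_tendstoD(1)) (use v(2) in simp)
  qed
  then have "eventually (\<lambda>h. ((k h / h) *\<^sub>R A h) \<bullet> v / (A h \<bullet> v) = k h / h) (at_right 0)"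
    by (rule eventually_mono) auto
  ultimately have "((\<lambda>h. k h / h) \<longlongrightarrow> (w \<bullet> v) / (v \<bullet> v)) (at_right 0)"
    by (rule Lim_transform_eventually)
  then obtain r where q: "((\<lambda>h. k h / h) \<longlongrightarrow> r) (at_right 0)" ..
  have w_eq: "w = r *\<^sub>R v"
    by (rule tendsto_unique[OF _ qA tendsto_scaleR[OF q A]]) simp
  moreover have "r \<ge> 0"
  proof (rule tendsto_lowerbound[OF q])
    show "eventually (\<lambda>h. 0 \<le> k h / h) (at_right 0)"
      using ev by (rule eventually_mono) simp
  qed simp
  moreover have "r \<noteq> 0"
    using w_eq w(2) by auto
  ultimately show ?thesis
    by (intro exI[of _ r]) simp
qed

context valid_diagram
begin

lemma curve_period: "i \<in> {1..ncomp D} \<Longrightarrow> curve D i (x + 1) = curve D i x"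
  using valid[unfolded link_diagram_def, THEN conjunct2, THEN conjunct1] by simp

lemma curve_shift:
  assumes "i \<in> {1..ncomp D}"
  shows "curve D i (x + of_int n) = curve D i x"
proof (induction n rule: int_induct[of _ 0])
  case (step1 n)
  then show ?case
    using curve_period[OF assms, of "x + of_int n"] by (simp add: algebra_simps)
next
  case (step2 n)
  then show ?case
    using curve_period[OF assms, of "x + of_int (n - 1)"] by (simp add: algebra_simps)
qed simp

lemma crossing_velocity:
  assumes "((i, x), (j, y)) \<in> classical D"
  shows "(curve D i has_vector_derivative velocity D (i, x)) (at x)"
    "(curve D j has_vector_derivative velocity D (j, y)) (at y)"
    "velocity D (i, x) \<noteq> 0" "velocity D (j, y) \<noteq> 0"
proof -
  have dbl: "((i, x), (j, y)) \<in> double_points D"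
    using assms classical_double by blast
  have "\<forall>(p, q) \<in> double_points D.
      curve D (fst p) differentiable (at (snd p)) \<and>
      curve D (fst q) differentiable (at (snd q)) \<and>
      det2 (velocity D p) (velocity D q) \<noteq> 0"
    using valid[unfolded link_diagram_def, THEN conjunct2, THEN conjunct2, THEN conjunct2, THEN conjunct2, THEN conjunct1] .
  with dbl have d: "curve D i differentiable (at x)" "curve D j differentiable (at y)"
    "det2 (velocity D (i, x)) (velocity D (j, y)) \<noteq> 0"
    by auto
  then show "(curve D i has_vector_derivative velocity D (i, x)) (at x)"
    "(curve D j has_vector_derivative velocity D (j, y)) (at y)"
    by (simp_all add: velocity_def vector_derivative_works)
  show "velocity D (i, x) \<noteq> 0" "velocity D (j, y) \<noteq> 0"
    using d(3) by (auto simp: det2_def)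
qed

end


section \<open>Moves that keep the classical crossings\<close>

text \<open>The arcs depend only on the number of components and on the names of the classical
  crossings, and the remaining data only on these and on the signs. So the two enhanced modules are
  equal, and the identity is an isomorphism.\<close>

lemma enhanced_isomorphic_same_crossings:
  assumes n: "ncomp D' = ncomp D" and cl: "classical D' = classical D"
    and rtl: "\<And>c. c \<in> classical D \<Longrightarrow> right_to_left D' c = right_to_left D c"
  shows "enhanced_isomorphic D D'"
proof -
  have under: "under_params D' = under_params D"
    by (simp add: under_params_def cl fun_eq_iff)
  have arc: "arc_of D' = arc_of D"
    by (simp add: arc_of_def under fun_eq_iff)
  have arcs: "arcs D' = arcs D"
    by (simp add: arcs_def arc under n)
  have over: "over_arc D' = over_arc D" "incoming_arc D' = incoming_arc D" "outgoing_arc D' = outgoing_arc D"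
    by (simp_all add: over_arc_def incoming_arc_def outgoing_arc_def arc fun_eq_iff split: prod.splits)
  have b: "b1 D' c = b1 D c" "b2 D' c = b2 D c" "writhe D' c = writhe D c" if "c \<in> classical D" for c
    using rtl[OF that] by (simp_all add: b1_def b2_def writhe_def over)
  have "rho D' = rho D"
    unfolding rho_def by (intro ext, simp add: cl over, intro sum.cong, auto simp: b)
  then have quot: "quot D' = quot D"
    by (simp add: quot_def fun_eq_iff cl)
  have M: "M_red D' = M_red D"
    by (simp add: M_red_def quot arcs)
  have "phi D' = phi D"
    by (simp add: phi_def phi_lift_def fun_eq_iff arcs n)
  then have mer: "meridians D' = meridians D"
    by (simp add: meridians_def fun_eq_iff M arcs quot)
  have "longitude D' i = longitude D i" for i
  proof -
    have C: "{c \<in> classical D'. component_of (b1 D' c) = i} = {c \<in> classical D. component_of (b1 D c) = i}"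
      using b by (auto simp: cl)
    show ?thesis
      unfolding longitude_def Let_def C quot
      by (intro arg_cong[of _ _ "quot D"] ext arg_cong2[of _ _ _ _ "(-)"] arg_cong[of _ _ of_int]
          arg_cong[of _ _ "\<lambda>x. x div 2"] sum.cong) (auto simp: b over)
  qed
  then have "M_enr D' = M_enr D"
    by (simp add: M_enr_def M mer fun_eq_iff)
  then show ?thesis
    using enhanced_isomorphic_refl[of D] n by (auto simp: enhanced_isomorphic_def)
qed

lemma planar_isotopy_invariance:
  assumes "link_diagram D" "link_diagram D'" "planar_isotopy D D'"
  shows "enhanced_isomorphic D D'"
proof -
  interpret D: valid_diagram D by standard (rule assms)
  interpret D': valid_diagram D' by standard (rule assms)
  obtain h where h: "orientation_preserving_diffeo h"
    "\<And>i x. i \<in> {1..ncomp D} \<Longrightarrow> curve D' i x = h (curve D i x)"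
    and n: "ncomp D' = ncomp D" and cl: "classical D' = classical D"
    using assms(3) unfolding planar_isotopy_def by auto
  obtain h' where h': "\<And>z. (h has_derivative h' z) (at z)" "\<And>z. det2 (h' z 1) (h' z \<i>) > 0"
    using h(1) unfolding orientation_preserving_diffeo_def by auto
  have vel: "velocity D' (i, x) = h' (curve D i x) (velocity D (i, x))"
    if "i \<in> {1..ncomp D}" "(curve D i has_vector_derivative velocity D (i, x)) (at x)" for i x
  proof -
    have "((h \<circ> curve D i) has_derivative (h' (curve D i x) \<circ> (\<lambda>t. t *\<^sub>R velocity D (i, x)))) (at x)"
      using that(2) h'(1) unfolding has_vector_derivative_def by (rule diff_chain_at)
    moreover have "h' (curve D i x) \<circ> (\<lambda>t. t *\<^sub>R velocity D (i, x)) = (\<lambda>t. t *\<^sub>R h' (curve D i x) (velocity D (i, x)))"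
      using has_derivative_linear[OF h'(1)] by (auto simp: linear_scale)
    moreover have "h \<circ> curve D i = curve D' i"
      using h(2) that(1) by auto
    ultimately have "(curve D' i has_vector_derivative h' (curve D i x) (velocity D (i, x))) (at x)"
      by (simp add: has_vector_derivative_def)
    then show ?thesis
      unfolding velocity_def by (simp add: vector_derivative_at)
  qed
  show ?thesis
  proof (rule enhanced_isomorphic_same_crossings[OF n cl])
    fix c assume c: "c \<in> classical D"
    obtain i x j y where cc: "c = ((i, x), (j, y))" by (metis surj_pair)
    \<comment> \<open>Both branches run through the same point of the plane, so one and the same
      derivative acts on both velocities.\<close>
    have pos: "curve D j y = curve D i x"
      using c D.classical_double unfolding cc by (auto simp: double_points_def position_def)
    note p = D.classical_params[OF c[unfolded cc]] and v = D.crossing_velocity[OF c[unfolded cc]]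
    have "det2 (velocity D' (i, x)) (velocity D' (j, y)) =
        det2 (h' (curve D i x) 1) (h' (curve D i x) \<i>) * det2 (velocity D (i, x)) (velocity D (j, y))"
      using vel[OF p(1) v(1)] vel[OF p(2) v(2)]
        det2_linear[OF has_derivative_linear[OF h'(1)], of "curve D i x" "velocity D (i, x)" "velocity D (j, y)"]
      by (simp only: pos)
    then show "right_to_left D' c = right_to_left D c"
      using h'(2)[of "curve D i x"] by (simp add: right_to_left_def cc zero_less_mult_iff)
  qed
qed

text \<open>Parameters count modulo 1, so a neighbourhood avoiding a compact set must avoid all its
  integer translates at once. Their union is closed, being the sum of a compact and a closed
  set.\<close>

lemma closed_integer_translates:
  assumes "compact (C :: real set)"
  shows "closed {x. \<exists>n :: int. x + of_int n \<in> C}"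
proof -
  have "{x. \<exists>n :: int. x + of_int n \<in> C} = (\<Union>x\<in>C. \<Union>y\<in>\<int>. {x + y})"
  proof (intro equalityI subsetI)
    fix x assume "x \<in> {x. \<exists>n :: int. x + of_int n \<in> C}"
    then obtain n :: int where n: "x + of_int n \<in> C" by blast
    have "x = (x + of_int n) + of_int (- n)" by simp
    then show "x \<in> (\<Union>x\<in>C. \<Union>y\<in>\<int>. {x + y})"
      using n Ints_of_int by blast
  next
    fix x assume "x \<in> (\<Union>x\<in>C. \<Union>y\<in>\<int>. {x + y})"
    then obtain y and n :: int where "y \<in> C" "x = y + of_int n"
      by (auto elim!: Ints_cases)
    then show "x \<in> {x. \<exists>n :: int. x + of_int n \<in> C}"
      by (auto intro!: exI[of _ "- n"])
  qed
  then show ?thesis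
    using compact_closed_sums[OF assms closed_Ints] by simp
qed

lemma integer_translates_avoid:
  assumes "compact (C :: real set)" "\<And>n :: int. x + of_int n \<notin> C"
  obtains e where "e > 0" "\<And>y n. \<bar>y - x\<bar> < e \<Longrightarrow> y + of_int n \<notin> C"
proof -
  have "open (- {x. \<exists>n :: int. x + of_int n \<in> C})"
    using closed_integer_translates[OF assms(1)] by (simp add: open_Compl)
  moreover have "x \<in> - {x. \<exists>n :: int. x + of_int n \<in> C}"
    using assms(2) by simp
  ultimately obtain e where "e > 0" "\<forall>y. dist y x < e \<longrightarrow> y \<in> - {x. \<exists>n :: int. x + of_int n \<in> C}"
    unfolding open_dist by blast
  then show thesis
    by (intro that[of e]) (auto simp: dist_real_def)
qed

lemma detour_move_invariance:
  assumes "link_diagram D" "link_diagram D'" "detour_move D D'"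
  shows "enhanced_isomorphic D D'"
proof -
  interpret D: valid_diagram D by standard (rule assms)
  note move = assms(3)[unfolded detour_move_def]
  have n: "ncomp D' = ncomp D"
    using move by (rule conjunct1)
  have cl: "classical D' = classical D"
    using move[THEN conjunct2] by (rule conjunct2)
  obtain i s t where st: "s < t"
    "\<And>x. (\<And>n :: int. x + of_int n \<notin> {s<..<t}) \<Longrightarrow> curve D' i x = curve D i x"
    "\<And>j x. j \<in> {1..ncomp D} \<Longrightarrow> j \<noteq> i \<Longrightarrow> curve D' j x = curve D j x"
    "\<And>x q. x \<in> {s..t} \<Longrightarrow> ((i, frac x), q) \<notin> classical D \<and> (q, (i, frac x)) \<notin> classical D"
  proof -
    have "\<exists>i \<in> {1..ncomp D}. \<exists>s t. s < t \<and> t < s + 1 \<and>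
      (\<forall>x. (\<forall>n :: int. x + of_int n \<notin> {s<..<t}) \<longrightarrow> curve D' i x = curve D i x) \<and>
      (\<forall>j \<in> {1..ncomp D} - {i}. \<forall>x. curve D' j x = curve D j x) \<and>
      (\<forall>x \<in> {s..t}. \<forall>q. ((i, frac x), q) \<notin> classical D \<and> (q, (i, frac x)) \<notin> classical D)"
      using move[THEN conjunct2] by (rule conjunct1)
    then show thesis
      by (elim bexE exE conjE) (rule that, assumption, blast, blast, blast)
  qed
  have vel: "velocity D' (j, x) = velocity D (j, x)"
    if "j \<in> {1..ncomp D}" "frac x = x" "((j, x), q) \<in> classical D \<or> (q, (j, x)) \<in> classical D" for j x q
  proof (cases "j = i")
    case True
    \<comment> \<open>The closed segment is essential: if a crossing could sit at an end of the
      segment, the velocity there might change on one side. Off a closed set there is a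
      neighbourhood in which the curve stays the same.\<close>
    have "x + of_int n \<notin> {s..t}" for n :: int
      using st(4)[of "x + of_int n" q] that True by auto
    then obtain e where e: "e > 0" "\<And>y n. \<bar>y - x\<bar> < e \<Longrightarrow> y + of_int n \<notin> {s..t}"
      by (rule integer_translates_avoid[OF compact_Icc]) blast
    show ?thesis
    proof (rule velocity_eqI[OF e(1)])
      fix y assume y: "\<bar>y - x\<bar> < e"
      have "y + of_int n \<notin> {s<..<t}" for n :: int
        using e(2)[OF y, of n] by auto
      then show "curve D' j y = curve D j y"
        unfolding True by (rule st(2))
    qed
  next
    case False
    show ?thesis
      by (rule velocity_eqI[of 1]) (simp_all add: st(3)[OF that(1) False])
  qed
  show ?thesis
  proof (rule enhanced_isomorphic_same_crossings[OF n cl])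
    fix c assume c: "c \<in> classical D"
    obtain i x j y where cc: "c = ((i, x), (j, y))" by (metis surj_pair)
    note p = D.classical_params[OF c[unfolded cc]]
    show "right_to_left D' c = right_to_left D c"
      using vel[OF p(1,3), of "(j, y)"] vel[OF p(2,4), of "(i, x)"] c
      by (intro right_to_left_cong) (simp_all add: cc)
  qed
qed

section \<open>Reparametrizations\<close>

text \<open>These functions are the lifts to the line of the orientation-preserving homeomorphisms
  of the circle.\<close>

definition circle_reparam :: "(real \<Rightarrow> real) \<Rightarrow> bool" where
  "circle_reparam \<phi> \<longleftrightarrow> continuous_on UNIV \<phi> \<and> strict_mono \<phi> \<and> (\<forall>x. \<phi> (x + 1) = \<phi> x + 1)"

lemma circle_reparam_shift:
  assumes "circle_reparam \<phi>"
  shows "\<phi> (x + of_int n) = \<phi> x + of_int n"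
proof (induction n rule: int_induct[of _ 0])
  case (step1 n)
  have "\<phi> (x + of_int n + 1) = \<phi> (x + of_int n) + 1"
    using assms by (simp add: circle_reparam_def)
  then show ?case
    using step1 by (simp add: algebra_simps)
next
  case (step2 n)
  have "\<phi> (x + of_int (n - 1) + 1) = \<phi> (x + of_int (n - 1)) + 1"
    using assms unfolding circle_reparam_def by blast
  then show ?case
    using step2 by (simp add: algebra_simps)
qed simp

lemma circle_reparam_frac:
  assumes "circle_reparam \<phi>"
  shows "\<phi> (frac x) = \<phi> x - of_int \<lfloor>x\<rfloor>" "frac (\<phi> (frac x)) = frac (\<phi> x)"
proof -
  show *: "\<phi> (frac x) = \<phi> x - of_int \<lfloor>x\<rfloor>"
    using circle_reparam_shift[OF assms, of x "- \<lfloor>x\<rfloor>"] by (simp add: frac_def)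
  show "frac (\<phi> (frac x)) = frac (\<phi> x)"
    by (simp add: *)
qed

lemma circle_reparam_surj:
  assumes "circle_reparam \<phi>"
  shows "surj \<phi>"
proof -
  have "\<exists>x. \<phi> x = y" for y
  proof -
    \<comment> \<open>Over \<open>n\<close> periods \<open>\<phi>\<close> grows by \<open>n\<close>,
      so its values at \<open>-n\<close> and \<open>n\<close> enclose \<open>y\<close>.\<close>
    define n where "n = \<lceil>\<bar>y - \<phi> 0\<bar>\<rceil>"
    have n: "\<bar>y - \<phi> 0\<bar> \<le> of_int n"
      by (simp add: n_def)
    have "\<phi> (0 + of_int n) = \<phi> 0 + of_int n" "\<phi> (0 + of_int (- n)) = \<phi> 0 + of_int (- n)"
      by (rule circle_reparam_shift[OF assms])+
    then have v: "\<phi> (- of_int n) \<le> y" "y \<le> \<phi> (of_int n)"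
      using n by (auto simp: abs_le_iff)
    have n0: "0 \<le> n"
      using n by linarith
    have "continuous_on {- of_int n..of_int n} \<phi>"
      using assms continuous_on_subset unfolding circle_reparam_def by blast
    from IVT'[OF v _ this] n0 show ?thesis
      by auto
  qed
  then show ?thesis
    by (metis surjI)
qed

lemma circle_reparam_inv:
  assumes "circle_reparam \<phi>"
  shows "circle_reparam (inv_into UNIV \<phi>)" "\<phi> (inv_into UNIV \<phi> x) = x" "inv_into UNIV \<phi> (\<phi> x) = x"
proof -
  have mono: "strict_mono \<phi>" and inj: "inj \<phi>"
    using assms by (auto simp: circle_reparam_def strict_mono_imp_inj_on)
  show r: "\<phi> (inv_into UNIV \<phi> x) = x" for x
    using surj_f_inv_f[OF circle_reparam_surj[OF assms]] .
  show l: "inv_into UNIV \<phi> (\<phi> x) = x" for x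
    using inv_f_f[OF inj] .
  have mono': "strict_mono (inv_into UNIV \<phi>)"
  proof (rule strict_monoI)
    fix x y :: real assume "x < y"
    then have "\<phi> (inv_into UNIV \<phi> x) < \<phi> (inv_into UNIV \<phi> y)"
      by (simp add: r)
    then show "inv_into UNIV \<phi> x < inv_into UNIV \<phi> y"
      using strict_mono_less[OF mono] by blast
  qed
  have "isCont (inv_into UNIV \<phi>) y" for y
    unfolding continuous_at_eps_delta
  proof (intro allI impI)
    fix e :: real assume e: "e > 0"
    let ?x = "inv_into UNIV \<phi> y"
    define d where "d = min (\<phi> (?x + e) - y) (y - \<phi> (?x - e))"
    have "\<phi> (?x - e) < \<phi> ?x" "\<phi> ?x < \<phi> (?x + e)"
      using e strict_mono_less[OF mono] by auto
    then have d: "d > 0"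
      by (simp add: d_def r)
    have "dist (inv_into UNIV \<phi> z) ?x < e" if "dist z y < d" for z
    proof -
      have "\<phi> (?x - e) < \<phi> (inv_into UNIV \<phi> z)" "\<phi> (inv_into UNIV \<phi> z) < \<phi> (?x + e)"
        using that by (auto simp: d_def r dist_real_def)
      then show ?thesis
        using strict_mono_less[OF mono] by (auto simp: dist_real_def)
    qed
    then show "\<exists>d>0. \<forall>z. dist z y < d \<longrightarrow> dist (inv_into UNIV \<phi> z) ?x < e"
      using d by blast
  qed
  moreover have "inv_into UNIV \<phi> (y + 1) = inv_into UNIV \<phi> y + 1" for y
  proof -
    have "y + 1 = \<phi> (inv_into UNIV \<phi> y + 1)"
      using assms by (simp add: circle_reparam_def r)
    then show ?thesis
      by (metis l)
  qed
  ultimately show "circle_reparam (inv_into UNIV \<phi>)"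
    using mono' by (simp add: circle_reparam_def continuous_on_eq_continuous_at)
qed

lemma (in congruence) sides_reparam:
  assumes "circle_reparam \<phi>" "sides f (\<phi> x) B B'"
  shows "sides (\<lambda>y. f (\<phi> y)) x B B'"
proof -
  obtain e where e: "e > 0" "\<And>d. 0 < d \<Longrightarrow> d < e \<Longrightarrow> f (\<phi> x - d) \<doteq> B \<and> f (\<phi> x + d) \<doteq> B'"
    using assms(2) unfolding sides_def by blast
  have "isCont \<phi> x"
    using assms(1) by (simp add: circle_reparam_def continuous_on_eq_continuous_at)
  then obtain d where d: "d > 0" "\<And>y. dist y x < d \<Longrightarrow> dist (\<phi> y) (\<phi> x) < e"
    using e(1) unfolding continuous_at_eps_delta by blast
  have mono: "strict_mono \<phi>"
    using assms(1) by (simp add: circle_reparam_def)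
  show ?thesis
    unfolding sides_def
  proof (intro exI[of _ d] conjI allI impI)
    fix h assume h: "0 < h \<and> h < d"
    have "\<phi> (x - h) < \<phi> x" "\<phi> x < \<phi> (x + h)"
      using h strict_mono_less[OF mono] by auto
    moreover have "dist (\<phi> (x - h)) (\<phi> x) < e" "dist (\<phi> (x + h)) (\<phi> x) < e"
      using h d(2)[of "x - h"] d(2)[of "x + h"] by (auto simp: dist_real_def)
    ultimately show "f (\<phi> (x - h)) \<doteq> B" "f (\<phi> (x + h)) \<doteq> B'"
      using e(2)[of "\<phi> x - \<phi> (x - h)"] e(2)[of "\<phi> (x + h) - \<phi> x"] by (auto simp: dist_real_def)
  qed (rule d(1))
qed

lemma (in congruence) sides_shift:
  assumes "\<And>y. f (y + of_int n) = f y" "sides f x B B'"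
  shows "sides f (x + of_int n) B B'"
proof -
  have "f (x + of_int n - d) = f (x - d)" "f (x + of_int n + d) = f (x + d)" for d
    using assms(1)[of "x - d"] assms(1)[of "x + d"] by (simp_all add: algebra_simps)
  then show ?thesis
    using assms(2) by (simp add: sides_def)
qed

text \<open>Only the effect on crossings and their signs is recorded. In this form the situation is
  symmetric: \<open>reparametrized_inv\<close> passes to the inverse of \<open>\<phi>\<close>
  without any derivative.\<close>

locale reparametrized =
  fixes D D' :: diagram and \<phi> :: "nat \<Rightarrow> real \<Rightarrow> real"
  assumes valid: "link_diagram D" "link_diagram D'"
    and ncomp_eq: "ncomp D' = ncomp D"
    and reparam: "\<And>i. i \<in> {1..ncomp D} \<Longrightarrow> circle_reparam (\<phi> i)"
    and classical_iff: "\<And>i j x y. i \<in> {1..ncomp D} \<Longrightarrow> j \<in> {1..ncomp D} \<Longrightarrow>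
      ((i, frac x), (j, frac y)) \<in> classical D' \<longleftrightarrow> ((i, frac (\<phi> i x)), (j, frac (\<phi> j y))) \<in> classical D"
    and right_to_left_eq: "\<And>i j x y. ((i, frac x), (j, frac y)) \<in> classical D' \<Longrightarrow>
      right_to_left D' ((i, frac x), (j, frac y)) = right_to_left D ((i, frac (\<phi> i x)), (j, frac (\<phi> j y)))"
begin

sublocale D: valid_diagram D by standard (rule valid)
sublocale D': valid_diagram D' by standard (rule valid)

lemma under_iff:
  assumes "i \<in> {1..ncomp D}"
  shows "x \<in> under_params D' i \<longleftrightarrow> \<phi> i x \<in> under_params D i"
proof
  assume "x \<in> under_params D' i"
  then obtain p where p: "(p, (i, frac x)) \<in> classical D'"
    by (auto simp: under_params_def)
  obtain j y where [simp]: "p = (j, y)" by (cases p)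
  have "j \<in> {1..ncomp D}" "frac y = y"
    using D'.classical_params[of j y i "frac x"] p ncomp_eq by auto
  then have "((j, frac (\<phi> j y)), (i, frac (\<phi> i x))) \<in> classical D"
    using classical_iff[of j i y x] p assms by simp
  then show "\<phi> i x \<in> under_params D i"
    by (auto simp: under_params_def)
next
  assume "\<phi> i x \<in> under_params D i"
  then obtain p where p: "(p, (i, frac (\<phi> i x))) \<in> classical D"
    by (auto simp: under_params_def)
  obtain j y where [simp]: "p = (j, y)" by (cases p)
  have j: "j \<in> {1..ncomp D}" "frac y = y"
    using D.classical_params[of j y i "frac (\<phi> i x)"] p by auto
  have "((j, frac (inv_into UNIV (\<phi> j) y)), (i, frac x)) \<in> classical D'"
    using classical_iff[of j i "inv_into UNIV (\<phi> j) y" x] p j assms circle_reparam_inv(2)[OF reparam[OF j(1)]] by simp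
  then show "x \<in> under_params D' i"
    by (auto simp: under_params_def)
qed

lemma colouring_reparam: "congruence.colouring (rels D) D' (\<lambda>i x. colour D i (\<phi> i x))"
proof -
  interpret C: coloured_diagram D "rels D" "colour D" by (rule D.coloured_diagram_colour)
  show ?thesis
    unfolding C.colouring_def
  proof (intro conjI ballI allI impI)
    fix i x assume i: "i \<in> {1..ncomp D'}"
    have "\<phi> i (x + 1) = \<phi> i x + 1"
      using reparam[of i] i ncomp_eq by (simp add: circle_reparam_def)
    then show "C.cong (colour D i (\<phi> i (x + 1))) (colour D i (\<phi> i x))"
      using C.g_shift[of i "\<phi> i x" 1] i ncomp_eq by simp
    assume "x \<notin> under_params D' i"
    then have "C.loc_const (colour D i) (\<phi> i x)"
      using C.colouring under_iff i ncomp_eq by (simp add: C.colouring_def)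
    then show "C.loc_const (\<lambda>x. colour D i (\<phi> i x)) x"
      using C.sides_reparam[OF reparam] i ncomp_eq by simp
  next
    fix i x j y assume c: "((i, x), (j, y)) \<in> classical D'"
    note p = D'.classical_params[OF c]
    let ?c = "((i, frac (\<phi> i x)), (j, frac (\<phi> j y)))"
    have c': "?c \<in> classical D"
      using classical_iff[of i j x y] p c ncomp_eq by simp
    then obtain B where B: "C.sides (colour D j) (frac (\<phi> j y)) B
        (under (right_to_left D ?c) (colour D i (frac (\<phi> i x))) B)"
      using C.colouring unfolding C.colouring_def by blast
    have per: "colour D j (u + of_int n) = colour D j u" for j u n
      by (simp add: colour_def arc_of_shift)
    have "C.sides (colour D j) (\<phi> j y) B (under (right_to_left D ?c) (colour D i (\<phi> i x)) B)"
      using C.sides_shift[where n = "\<lfloor>\<phi> j y\<rfloor>", OF per B] by (simp add: colour_def arc_of_frac) (simp add: frac_def)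
    then have "C.sides (\<lambda>x. colour D j (\<phi> j x)) y B (under (right_to_left D ?c) (colour D i (\<phi> i x)) B)"
      using C.sides_reparam[where \<phi> = "\<phi> j" and f = "colour D j" and x = y] reparam p(2) ncomp_eq by simp
    moreover have "right_to_left D' ((i, x), (j, y)) = right_to_left D ?c"
      using right_to_left_eq[of i x j y] c p by simp
    ultimately show "\<exists>B. C.sides (\<lambda>x. colour D j (\<phi> j x)) y B
        (under (right_to_left D' ((i, x), (j, y))) (colour D i (\<phi> i x)) B)"
      by (intro exI[of _ B]) simp
  qed
qed

lemma reparametrized_inv: "reparametrized D' D (\<lambda>i. inv_into UNIV (\<phi> i))"
proof
  fix i assume "i \<in> {1..ncomp D'}"
  then show "circle_reparam (inv_into UNIV (\<phi> i))"
    using circle_reparam_inv reparam ncomp_eq by simp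
next
  fix i j x y assume "i \<in> {1..ncomp D'}" "j \<in> {1..ncomp D'}"
  then show "((i, frac x), (j, frac y)) \<in> classical D \<longleftrightarrow>
      ((i, frac (inv_into UNIV (\<phi> i) x)), (j, frac (inv_into UNIV (\<phi> j) y))) \<in> classical D'"
    using classical_iff[of i j "inv_into UNIV (\<phi> i) x" "inv_into UNIV (\<phi> j) y"] reparam ncomp_eq by (simp add: circle_reparam_inv(2))
next
  fix i j x y assume c: "((i, frac x), (j, frac y)) \<in> classical D"
  note p = D.classical_params[OF c]
  show "right_to_left D ((i, frac x), (j, frac y)) =
      right_to_left D' ((i, frac (inv_into UNIV (\<phi> i) x)), (j, frac (inv_into UNIV (\<phi> j) y)))"
    using classical_iff[of i j "inv_into UNIV (\<phi> i) x" "inv_into UNIV (\<phi> j) y"] p(1,2) c reparam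
      right_to_left_eq[of i "inv_into UNIV (\<phi> i) x" j "inv_into UNIV (\<phi> j) y"] by (simp add: circle_reparam_inv(2))
qed (simp_all add: valid ncomp_eq)

lemma lonsum_reparam:
  "congruence.cong (rels D) (congruence.lonsum (rels D) D' (\<lambda>i x. colour D i (\<phi> i x)) i)
    (congruence.lonsum (rels D) D (colour D) i)"
proof -
  interpret C: coloured_diagram D "rels D" "colour D" by (rule D.coloured_diagram_colour)
  interpret C': coloured_diagram D' "rels D" "\<lambda>i x. colour D i (\<phi> i x)"
    by standard (rule colouring_reparam)
  define h where "h = (\<lambda>((i, x), (j, y)). ((i, frac (\<phi> i x)), (j :: nat, frac (\<phi> j y))))"
  define h' where "h' = (\<lambda>((i, x), (j, y)). ((i, frac (inv_into UNIV (\<phi> i) x)), (j :: nat, frac (inv_into UNIV (\<phi> j) y))))"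
  interpret inv: reparametrized D' D "\<lambda>i. inv_into UNIV (\<phi> i)" by (rule reparametrized_inv)
  have fr: "frac (\<phi> i (frac (inv_into UNIV (\<phi> i) x))) = frac x" "frac (inv_into UNIV (\<phi> i) (frac (\<phi> i x))) = frac x"
    if "i \<in> {1..ncomp D}" for i x
    using that reparam[OF that] circle_reparam_inv[OF reparam[OF that]] circle_reparam_frac(2) by simp_all
  have h: "h c \<in> classical D" "h' (h c) = c" "right_to_left D (h c) = right_to_left D' c" if "c \<in> classical D'" for c
  proof -
    obtain i x j y where cc: "c = ((i, x), (j, y))" by (metis surj_pair)
    note p = D'.classical_params[OF that[unfolded cc]]
    show "h c \<in> classical D" "h' (h c) = c" "right_to_left D (h c) = right_to_left D' c"
      using classical_iff[of i j x y] right_to_left_eq[of i x j y] p that ncomp_eq fr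
      by (simp_all add: cc h_def h'_def)
  qed
  have h': "h' c \<in> classical D'" "h (h' c) = c" if "c \<in> classical D" for c
  proof -
    obtain i x j y where cc: "c = ((i, x), (j, y))" by (metis surj_pair)
    note p = D.classical_params[OF that[unfolded cc]]
    show "h' c \<in> classical D'" "h (h' c) = c"
      using inv.classical_iff[of i j x y] p that ncomp_eq fr
      by (simp_all add: cc h_def h'_def)
  qed
  have comp: "fst (snd (h c)) = fst (snd c)" "fst (snd (h' c)) = fst (snd c)" for c
    by (simp_all add: h_def h'_def split: prod.splits)
  have bij: "bij_betw h {c \<in> classical D'. fst (snd c) = i} {c \<in> classical D. fst (snd c) = i}"
    by (rule bij_betw_byWitness[where f' = h']) (auto simp: h h' comp)
  show ?thesis
    unfolding C.lonsum_def sum.reindex_bij_betw[OF bij, symmetric]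
  proof (rule C.cong_sum)
    fix c assume "c \<in> {c \<in> classical D'. fst (snd c) = i}"
    then have c: "c \<in> classical D'" and i: "fst (snd c) = i" by auto
    obtain k x y where cc: "c = ((k, x), (i, y))" using i by (metis surj_pair fst_conv snd_conv)
    note p = D'.classical_params[OF c[unfolded cc]]
    have hc: "h c = ((k, frac (\<phi> k x)), (i, frac (\<phi> i y)))"
      by (simp add: h_def cc)
    have per: "colour D j (u + of_int n) = colour D j u" for j u n
      by (simp add: colour_def arc_of_shift)
    have fr': "colour D j (frac u) = colour D j u" for j u
      by (simp add: colour_def arc_of_frac)
    obtain B B' where B: "C.sides (colour D i) (frac (\<phi> i y)) B B'"
      using C.crossing_colours(1)[OF h(1)[OF c]] by (auto simp: hc)
    then have "C.sides (colour D i) (\<phi> i y) B B'"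
      using C.sides_shift[where n = "\<lfloor>\<phi> i y\<rfloor>", OF per B] by (simp add: frac_def)
    then have "C.sides (\<lambda>x. colour D i (\<phi> i x)) y B B'"
      using C.sides_reparam[OF reparam[of i]] p ncomp_eq by simp
    then have "C.cong (C.left_colour (\<lambda>x. colour D i (\<phi> i x)) y) (C.left_colour (colour D i) (frac (\<phi> i y)))"
      using C.left_colour[OF B] C.left_colour C.cong_trans_sym by blast
    note lc = C.cong_scale[OF C.cong_diff[OF C.cong_refl this]]
    show "C.cong (kap (right_to_left D' c) *\<^sub>L (colour D (fst (fst c)) (\<phi> (fst (fst c)) (snd (fst c)))
        - C.left_colour (\<lambda>x. colour D i (\<phi> i x)) (snd (snd c))))
      (kap (right_to_left D (h c)) *\<^sub>L (colour D (fst (fst (h c))) (snd (fst (h c)))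
        - C.left_colour (colour D i) (snd (snd (h c)))))"
      unfolding h(3)[OF c, symmetric] hc unfolding cc fst_conv snd_conv fr'
      by (rule lc)
  qed
qed

lemma enhanced_isomorphic_reparametrized: "enhanced_isomorphic D D'"
proof -
  interpret inv: reparametrized D' D "\<lambda>i. inv_into UNIV (\<phi> i)" by (rule reparametrized_inv)
  let ?R = "\<lambda>i x x'. i \<in> {1..ncomp D} \<and> x = \<phi> i x' \<and> x \<notin> under_params D i"
  show ?thesis
  proof (rule enhanced_isomorphicI[OF valid ncomp_eq inv.colouring_reparam colouring_reparam, where R = ?R])
    fix i x x' assume R: "?R i x x'"
    then have x: "x = \<phi> i x'"
      by blast
    from R show "i \<in> {1..ncomp D} \<and> x \<notin> under_params D i \<and> x' \<notin> under_params D' i \<and>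
        congruence.cong (rels D') (colour D' i (inv_into UNIV (\<phi> i) x)) (colour D' i x') \<and>
        congruence.cong (rels D) (colour D i (\<phi> i x')) (colour D i x)"
      unfolding x using under_iff[of i x'] circle_reparam_inv(3)[OF reparam, of i x']
        congruence.cong_refl[OF congruence_rels] by simp
  next
    show "generating D (\<lambda>i x. \<exists>x'. ?R i x x')"
      unfolding generating_def using circle_reparam_inv(2)[OF reparam] by metis
    show "generating D' (\<lambda>i x'. \<exists>x. ?R i x x')"
      unfolding generating_def using under_iff ncomp_eq by simp
  next
    fix i
    show "congruence.cong (rels D') (congruence.lonsum (rels D') D (\<lambda>i x. colour D' i (inv_into UNIV (\<phi> i) x)) i)
        (congruence.lonsum (rels D') D' (colour D') i)"
      by (rule inv.lonsum_reparam)
  qed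
qed

end

lemma reparametrization_invariance:
  assumes "link_diagram D" "link_diagram D'" "reparametrization D D'"
  shows "enhanced_isomorphic D D'"
proof -
  interpret D: valid_diagram D by standard (rule assms)
  interpret D': valid_diagram D' by standard (rule assms)
  note move = assms(3)[unfolded reparametrization_def]
  have n: "ncomp D' = ncomp D"
    using move by (rule conjunct1)
  obtain \<phi> where "(\<forall>i \<in> {1..ncomp D}. continuous_on UNIV (\<phi> i) \<and> strict_mono (\<phi> i) \<and>
        (\<forall>x. \<phi> i (x + 1) = \<phi> i x + 1) \<and> (\<forall>x. curve D' i x = curve D i (\<phi> i x)))"
    and cl: "classical D' = {((i, x), (j, y)). (i, x) \<in> points D' \<and> (j, y) \<in> points D' \<and>
          ((i, frac (\<phi> i x)), (j, frac (\<phi> j y))) \<in> classical D}"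
    using move[THEN conjunct2] by (elim exE conjE) (rule that)
  then have \<phi>: "circle_reparam (\<phi> i)" "curve D' i = (\<lambda>x. curve D i (\<phi> i x))" if "i \<in> {1..ncomp D}" for i
    using that by (auto simp: circle_reparam_def)
  have iff: "((i, frac x), (j, frac y)) \<in> classical D' \<longleftrightarrow> ((i, frac (\<phi> i x)), (j, frac (\<phi> j y))) \<in> classical D"
    if "i \<in> {1..ncomp D}" "j \<in> {1..ncomp D}" for i j x y
    using circle_reparam_frac(2)[OF \<phi>(1)[OF that(1)]] circle_reparam_frac(2)[OF \<phi>(1)[OF that(2)]] that n
    by (simp add: cl points_def frac_lt_1)
  have vel: "\<exists>r>0. velocity D' (i, frac x) = r *\<^sub>R velocity D (i, frac (\<phi> i x))"
    if i: "i \<in> {1..ncomp D}"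
      and v: "(curve D i has_vector_derivative velocity D (i, frac (\<phi> i x))) (at (frac (\<phi> i x)))"
        "velocity D (i, frac (\<phi> i x)) \<noteq> 0"
      and w: "(curve D' i has_vector_derivative velocity D' (i, frac x)) (at (frac x))"
        "velocity D' (i, frac x) \<noteq> 0" for i x
  proof -
    \<comment> \<open>The definition of \<open>reparametrization\<close> reduces
      \<open>\<phi> i x\<close> modulo 1, whereas the chain of maps is evaluated at
      \<open>\<phi> i (frac x)\<close>; the two parameters differ by the integer
      \<open>n\<close>.\<close>
    define n where "n = \<lfloor>\<phi> i x\<rfloor> - \<lfloor>x\<rfloor>"
    have *: "frac (\<phi> i x) = \<phi> i (frac x) + of_int (- n)"
      using circle_reparam_frac(1)[OF \<phi>(1)[OF i], of x] by (simp add: n_def frac_def)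
    have "(curve D i has_vector_derivative velocity D (i, frac (\<phi> i x))) (at (\<phi> i (frac x)))"
      using v(1) unfolding * by (rule has_vector_derivative_shift_period[where f = "curve D i", OF D.curve_period[OF i]])
    from velocity_reparametrized[where f = "curve D i" and \<phi> = "\<phi> i", OF this v(2) _ w(2)] w(1) show ?thesis
      using \<phi>[OF i] by (auto simp: circle_reparam_def)
  qed
  have "reparametrized D D' \<phi>"
  proof
    fix i j x y
    let ?c' = "((i, frac x), (j, frac y))" and ?c = "((i, frac (\<phi> i x)), (j, frac (\<phi> j y)))"
    assume c': "?c' \<in> classical D'"
    note p = D'.classical_params[OF c', unfolded n]
    have c: "?c \<in> classical D"
      using iff[OF p(1,2)] c' by simp
    note v = D.crossing_velocity[OF c] and w = D'.crossing_velocity[OF c']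
    obtain r where r: "r > 0" "velocity D' (i, frac x) = r *\<^sub>R velocity D (i, frac (\<phi> i x))"
      using vel[OF p(1) v(1,3) w(1,3)] by blast
    obtain s where s: "s > 0" "velocity D' (j, frac y) = s *\<^sub>R velocity D (j, frac (\<phi> j y))"
      using vel[OF p(2) v(2,4) w(2,4)] by blast
    show "right_to_left D' ?c' = right_to_left D ?c"
      using r s by (simp add: right_to_left_def det2_scale zero_less_mult_iff mult_less_0_iff)
  qed (use assms n \<phi>(1) iff in auto)
  then show ?thesis
    by (rule reparametrized.enhanced_isomorphic_reparametrized)
qed

section \<open>Local moves\<close>

text \<open>
  A crossing of strands is given by its overpassing point, its underpassing point, both as a pair
  of a strand and a parameter, and the direction \<open>\<eta>\<close> as in \<^const>\<open>under\<close>, the underpassing strand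
  being walked along by increasing parameter.
\<close>

type_synonym strand_crossing = "(nat \<times> real) \<times> (nat \<times> real) \<times> bool"

lemma strand_crossing_cases:
  obtains l v l' v' \<eta> where "(x :: strand_crossing) = ((l, v), (l', v'), \<eta>)"
  by (cases x, cases "fst x", cases "fst (snd x)") simp

context congruence
begin

text \<open>The ends |v| = 1 are left out, because every two-sided neighbourhood of an end leaves
  the disc.\<close>

definition strand_colouring :: "nat \<Rightarrow> strand_crossing set \<Rightarrow> (nat \<Rightarrow> real \<Rightarrow> 'a \<Rightarrow> laurent) \<Rightarrow> bool" where
  "strand_colouring n X \<gamma> \<longleftrightarrow>
    (\<forall>l<n. \<forall>v. \<bar>v\<bar> < 1 \<longrightarrow> (\<forall>p \<eta>. (p, (l, v), \<eta>) \<notin> X) \<longrightarrow> loc_const (\<gamma> l) v) \<and>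
    (\<forall>l v l' v' \<eta>. ((l, v), (l', v'), \<eta>) \<in> X \<longrightarrow> (\<exists>B. sides (\<gamma> l') v' B (under \<eta> (\<gamma> l v) B)))"

definition strand_lonsum :: "strand_crossing set \<Rightarrow> (nat \<Rightarrow> real \<Rightarrow> 'a \<Rightarrow> laurent) \<Rightarrow> nat \<Rightarrow> 'a \<Rightarrow> laurent" where
  "strand_lonsum X \<gamma> l = (\<Sum>x\<in>{x \<in> X. fst (fst (snd x)) = l}. kap (snd (snd x)) *\<^sub>L
    (\<gamma> (fst (fst x)) (snd (fst x)) - left_colour (\<gamma> l) (snd (fst (snd x)))))"

end

text \<open>This is what yields a map from the module of the diagram with inner crossings
  \<open>X\<close> to that of the diagram with inner crossings \<open>X'\<close>: the target's own
  colours are rearranged into a colouring of the source. As \<open>K\<close> is arbitrary, this is a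
  statement about the local pictures alone.\<close>

definition strands_extend :: "nat \<Rightarrow> strand_crossing set \<Rightarrow> strand_crossing set \<Rightarrow> bool" where
  "strands_extend n X X' \<longleftrightarrow> (\<forall>(K :: (arc \<Rightarrow> laurent) set) \<gamma>'. lmod.subspace K \<longrightarrow>
    congruence.strand_colouring K n X' \<gamma>' \<longrightarrow>
    (\<exists>\<gamma>. congruence.strand_colouring K n X \<gamma> \<and>
      (\<forall>l<n. \<forall>v. 3/4 \<le> \<bar>v\<bar> \<longrightarrow> \<bar>v\<bar> < 1 \<longrightarrow> congruence.cong K (\<gamma> l v) (\<gamma>' l v)) \<and>
      (\<forall>l<n. congruence.cong K (congruence.strand_lonsum K X \<gamma> l) (congruence.strand_lonsum K X' \<gamma>' l))))"

text \<open>The bound 3/4 is strict here, because the points kept by a move are those outside the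
  closed inner parts \<open>strand_pts (3/4)\<close>.\<close>

definition strands_generate :: "nat \<Rightarrow> strand_crossing set \<Rightarrow> bool" where
  "strands_generate n X \<longleftrightarrow> (\<forall>(K :: (arc \<Rightarrow> laurent) set) Z \<gamma>. lmod.subspace K \<longrightarrow>
    congruence.strand_colouring K n X \<gamma> \<longrightarrow> lmod.subspace Z \<longrightarrow> K \<subseteq> Z \<longrightarrow>
    (\<forall>l<n. \<forall>v. 3/4 < \<bar>v\<bar> \<longrightarrow> \<bar>v\<bar> < 1 \<longrightarrow> \<gamma> l v \<in> Z) \<longrightarrow>
    (\<forall>l<n. \<forall>v. \<bar>v\<bar> < 1 \<longrightarrow> (\<forall>p \<eta>. (p, (l, v), \<eta>) \<notin> X) \<longrightarrow> \<gamma> l v \<in> Z))"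

section \<open>Strands of a diagram, and gluing along their ends\<close>

locale strand_family =
  fixes n :: nat and c :: "nat \<Rightarrow> nat" and m k :: "nat \<Rightarrow> real"
  assumes k_bound: "\<And>l. l < n \<Longrightarrow> 0 < \<bar>k l\<bar> \<and> \<bar>k l\<bar> < 1/2"
begin

definition pt :: "nat \<Rightarrow> real \<Rightarrow> pnt" where
  "pt l v = (c l, frac (m l + k l * v))"

definition strand_pts :: "real \<Rightarrow> pnt set" where
  "strand_pts r = {pt l v |l v. l < n \<and> \<bar>v\<bar> \<le> r}"

lemma pt_in_strand_pts: "l < n \<Longrightarrow> \<bar>v\<bar> \<le> r \<Longrightarrow> pt l v \<in> strand_pts r"
  by (auto simp: strand_pts_def)

lemma strand_pts_mono: "r \<le> s \<Longrightarrow> strand_pts r \<subseteq> strand_pts s"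
  unfolding strand_pts_def by fastforce

text \<open>The parameters of a strand fill an interval of length
  \<open>2 * \<bar>k l\<bar>\<close>, which is less than a full turn.\<close>

lemma pt_inj:
  assumes "l < n" "\<bar>v\<bar> \<le> 1" "\<bar>w\<bar> \<le> 1" "pt l v = pt l w"
  shows "v = w"
proof -
  obtain j :: int where "m l + k l * v = m l + k l * w + of_int j"
    using assms(4) by (auto simp: pt_def elim: frac_eq_obtain)
  then have j: "k l * (v - w) = of_int j"
    by (simp add: algebra_simps)
  have "\<bar>k l\<bar> * \<bar>v - w\<bar> \<le> \<bar>k l\<bar> * 2"
    using assms by (intro mult_left_mono) auto
  then have "\<bar>k l\<bar> * \<bar>v - w\<bar> < 1"
    using k_bound[OF assms(1)] by linarith
  then have "\<bar>of_int j :: real\<bar> < 1"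
    by (simp only: j[symmetric] abs_mult)
  then have "j = 0"
    by linarith
  then show ?thesis
    using j k_bound[OF assms(1)] by simp
qed

lemma strand_pts_avoid:
  assumes "(i, frac x) \<notin> strand_pts r"
  obtains e where "e > 0" "\<And>y. \<bar>y - x\<bar> < e \<Longrightarrow> (i, frac y) \<notin> strand_pts r"
proof -
  let ?C = "\<Union>l\<in>{l. l < n \<and> c l = i}. (\<lambda>v. m l + k l * v) ` {-r..r}"
  have "compact ?C"
    by (intro compact_UN compact_continuous_image continuous_intros) auto
  have iff: "(i, frac y) \<notin> strand_pts r \<longleftrightarrow> (\<forall>j :: int. y + of_int j \<notin> ?C)" for y
  proof -
    have "(i, frac y) \<in> strand_pts r" if yj: "y + of_int j \<in> ?C" for j :: int
    proof -
      obtain l v where l: "l < n" "c l = i" "v \<in> {-r..r}" "y + of_int j = m l + k l * v"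
        using yj by blast
      then have "\<bar>v\<bar> \<le> r"
        by (auto simp: abs_le_iff)
      moreover have "frac y = frac (m l + k l * v)"
        using l(4) frac_plus_int[of y j] by simp
      then have "(i, frac y) = pt l v"
        using l(2) by (simp add: pt_def)
      ultimately show ?thesis
        using pt_in_strand_pts[OF l(1)] by simp
    qed
    moreover have "\<exists>j :: int. y + of_int j \<in> ?C" if iy: "(i, frac y) \<in> strand_pts r"
    proof -
      obtain l v where l: "l < n" "c l = i" "\<bar>v\<bar> \<le> r" "frac (m l + k l * v) = frac y"
        using iy by (auto simp: strand_pts_def pt_def)
      obtain j :: int where "m l + k l * v = y + of_int j"
        using l(4) by (rule frac_eq_obtain)
      then show ?thesis
        using l(1-3) by (intro exI[of _ j]) (auto simp: abs_le_iff intro!: bexI[of _ l] image_eqI[of _ _ v])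
    qed
    ultimately show ?thesis
      by blast
  qed
  obtain e where "e > 0" "\<And>y j. \<bar>y - x\<bar> < e \<Longrightarrow> y + of_int j \<notin> ?C"
    by (rule integer_translates_avoid[OF \<open>compact ?C\<close>]) (use assms iff in blast)+
  then show thesis
    using that iff by blast
qed

end

locale disjoint_strands = strand_family +
  assumes disjoint: "\<And>l l' v v'. l < n \<Longrightarrow> l' < n \<Longrightarrow> \<bar>v\<bar> \<le> 1 \<Longrightarrow> \<bar>v'\<bar> \<le> 1 \<Longrightarrow> pt l v = pt l' v' \<Longrightarrow> l = l'"
begin

lemma pt_inject:
  assumes "l < n" "l' < n" "\<bar>v\<bar> \<le> 1" "\<bar>v'\<bar> \<le> 1"
  shows "pt l v = pt l' v' \<longleftrightarrow> l = l' \<and> v = v'"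
  using disjoint[OF assms] pt_inj assms by blast

text \<open>The pair selected by the choice is unique by \<open>pt_inject\<close>. The ends |v| = 1
  belong to the outside and take their colours from \<open>f\<close>.\<close>

definition glue :: "(nat \<Rightarrow> real \<Rightarrow> 'b) \<Rightarrow> (nat \<Rightarrow> real \<Rightarrow> 'b) \<Rightarrow> nat \<Rightarrow> real \<Rightarrow> 'b" where
  "glue f \<gamma> i x = (if \<exists>l v. l < n \<and> \<bar>v\<bar> < 1 \<and> (i, frac x) = pt l v
    then case SOME (l, v). l < n \<and> \<bar>v\<bar> < 1 \<and> (i, frac x) = pt l v of (l, v) \<Rightarrow> \<gamma> l v
    else f i x)"

lemma glue_pt:
  assumes "l < n" "\<bar>v\<bar> < 1" "(i, frac x) = pt l v"
  shows "glue f \<gamma> i x = \<gamma> l v"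
proof -
  have "(SOME (l, v). l < n \<and> \<bar>v\<bar> < 1 \<and> (i, frac x) = pt l v) = (l, v)"
  proof (rule some_equality)
    fix p assume p: "case p of (l, v) \<Rightarrow> l < n \<and> \<bar>v\<bar> < 1 \<and> (i, frac x) = pt l v"
    obtain a b where [simp]: "p = (a, b)"
      by (cases p)
    have "pt a b = pt l v"
      using p assms(3) by simp
    then show "p = (l, v)"
      using p assms(1,2) pt_inject[of a l b v] by simp
  qed (use assms in simp)
  then show ?thesis
    unfolding glue_def using assms by auto
qed

lemma glue_outside: "(\<And>l v. l < n \<Longrightarrow> \<bar>v\<bar> < 1 \<Longrightarrow> (i, frac x) \<noteq> pt l v) \<Longrightarrow> glue f \<gamma> i x = f i x"
  unfolding glue_def by auto

lemma glue_sides: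
  assumes K: "congruence K" and l: "l < n" and v: "\<bar>v\<bar> < 1" and s: "congruence.sides K (\<gamma> l) v B B'"
    and x: "(c l, frac x) = pt l v"
  shows "congruence.sides K (glue f \<gamma> (c l)) x (if k l > 0 then B else B') (if k l > 0 then B' else B)"
proof -
  interpret K: congruence K by (rule K)
  obtain e where e: "e > 0" "\<And>d. 0 < d \<Longrightarrow> d < e \<Longrightarrow> K.cong (\<gamma> l (v - d)) B \<and> K.cong (\<gamma> l (v + d)) B'"
    using s unfolding K.sides_def by blast
  have k: "k l \<noteq> 0"
    using k_bound[OF l] by auto
  define e' where "e' = min e (1 - \<bar>v\<bar>)"
  have g: "glue f \<gamma> (c l) (x + k l * d) = \<gamma> l (v + d)" if "\<bar>d\<bar> < e'" for d
  proof (rule glue_pt[OF l])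
    show "\<bar>v + d\<bar> < 1"
      using that by (auto simp: e'_def)
    obtain j :: int where "x = m l + k l * v + of_int j"
      using x by (auto simp: pt_def elim: frac_eq_obtain)
    then have "x + k l * d = m l + k l * (v + d) + of_int j"
      by (simp add: algebra_simps)
    then show "(c l, frac (x + k l * d)) = pt l (v + d)"
      by (simp add: pt_def)
  qed
  show ?thesis
    unfolding K.sides_def
  proof (intro exI[of _ "\<bar>k l\<bar> * e'"] conjI allI impI)
    show "\<bar>k l\<bar> * e' > 0"
      using k e(1) v by (simp add: e'_def)
    fix d assume d: "0 < d \<and> d < \<bar>k l\<bar> * e'"
    define h where "h = d / \<bar>k l\<bar>"
    have h1: "0 < h" "h < e'"
      using d k by (simp_all add: h_def pos_divide_less_eq mult.commute)
    have h: "0 < h" "h < e'" "h < e"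
      using h1 by (auto simp: e'_def)
    have kh: "d = \<bar>k l\<bar> * h"
      using k by (simp add: h_def)
    show "K.cong (glue f \<gamma> (c l) (x - d)) (if k l > 0 then B else B')"
      "K.cong (glue f \<gamma> (c l) (x + d)) (if k l > 0 then B' else B)"
      using g[of h] g[of "- h"] h e(2)[OF h(1,3)] by (auto simp: kh abs_if)
  qed
qed

end

text \<open>The combinatorial residue of a Reidemeister move, symmetric in the two diagrams:
  \<open>X\<close> and \<open>X'\<close> list the crossings inside the disc, and outside the
  crossings and their signs agree. The flag \<open>\<eta>\<close> refers to increasing strand
  parameter. The component runs the other way if \<open>k l'\<close> is negative, hence the
  equivalence in the condition on signs.\<close>

locale local_pair = disjoint_strands n c m k for n c m k +
  fixes D D' :: diagram and X X' :: "strand_crossing set"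
  assumes valid: "link_diagram D" "link_diagram D'"
    and ncomp_eq: "ncomp D' = ncomp D"
    and c_range: "\<And>l. l < n \<Longrightarrow> c l \<in> {1..ncomp D}"
    and X: "\<And>l v l' v' \<eta>. ((l, v), (l', v'), \<eta>) \<in> X \<Longrightarrow> l < n \<and> l' < n \<and> \<bar>v\<bar> < 3/4 \<and> \<bar>v'\<bar> < 3/4 \<and>
      (pt l v, pt l' v') \<in> classical D \<and> (right_to_left D (pt l v, pt l' v') \<longleftrightarrow> (\<eta> \<longleftrightarrow> k l' > 0))"
    and X': "\<And>l v l' v' \<eta>. ((l, v), (l', v'), \<eta>) \<in> X' \<Longrightarrow> l < n \<and> l' < n \<and> \<bar>v\<bar> < 3/4 \<and> \<bar>v'\<bar> < 3/4 \<and>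
      (pt l v, pt l' v') \<in> classical D' \<and> (right_to_left D' (pt l v, pt l' v') \<longleftrightarrow> (\<eta> \<longleftrightarrow> k l' > 0))"
    and classical_cases: "\<And>p q. (p, q) \<in> classical D \<Longrightarrow>
      (\<exists>l v l' v' \<eta>. ((l, v), (l', v'), \<eta>) \<in> X \<and> p = pt l v \<and> q = pt l' v') \<or>
      (p, q) \<in> classical D' \<and> right_to_left D' (p, q) = right_to_left D (p, q) \<and>
      p \<notin> strand_pts 1 \<and> q \<notin> strand_pts 1"
    and classical_cases': "\<And>p q. (p, q) \<in> classical D' \<Longrightarrow>
      (\<exists>l v l' v' \<eta>. ((l, v), (l', v'), \<eta>) \<in> X' \<and> p = pt l v \<and> q = pt l' v') \<or>
      (p, q) \<in> classical D \<and> right_to_left D (p, q) = right_to_left D' (p, q) \<and>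
      p \<notin> strand_pts 1 \<and> q \<notin> strand_pts 1"
begin

sublocale D: valid_diagram D by standard (rule valid)
sublocale D': valid_diagram D' by standard (rule valid)

lemma local_pair_sym: "local_pair n c m k D' D X' X"
  using valid ncomp_eq c_range X X' classical_cases classical_cases' by unfold_locales simp_all

definition strand_colour :: "nat \<Rightarrow> real \<Rightarrow> arc \<Rightarrow> laurent" where
  "strand_colour l v = colour D (c l) (m l + k l * v)"

lemma strand_colour_pt: "(c l, frac x) = pt l v \<Longrightarrow> colour D (c l) x = strand_colour l v"
  by (auto simp: strand_colour_def colour_def pt_def) (metis arc_of_frac)+

text \<open>It allows \<open>lonsum_split\<close> to be applied to the tautological colouring as
  well as to the glued one.\<close>

lemma glue_strand_colour: "glue (colour D) strand_colour = colour D"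
proof (rule ext, rule ext)
  fix i x
  show "glue (colour D) strand_colour i x = colour D i x"
  proof (cases "\<exists>l v. l < n \<and> \<bar>v\<bar> < 1 \<and> (i, frac x) = pt l v")
    case True
    then obtain l v where l: "l < n" "\<bar>v\<bar> < 1" "(i, frac x) = pt l v"
      by blast
    then have "i = c l"
      by (simp add: pt_def)
    then show ?thesis
      using glue_pt[OF l] strand_colour_pt[of l x v] l(3) by simp
  next
    case False
    then show ?thesis
      by (intro glue_outside) blast
  qed
qed

lemma strand_colouring_colour: "congruence.strand_colouring (rels D) n X strand_colour"
proof -
  interpret C: coloured_diagram D "rels D" "colour D" by (rule D.coloured_diagram_colour)
  have k: "k l \<noteq> 0" if "l < n" for l
    using k_bound[OF that] by auto
  show ?thesis
    unfolding C.strand_colouring_def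
  proof (intro conjI allI impI)
    fix l v assume l: "l < n" "\<bar>v\<bar> < 1" "\<forall>p \<eta>. (p, (l, v), \<eta>) \<notin> X"
    have "m l + k l * v \<notin> under_params D (c l)"
    proof
      assume "m l + k l * v \<in> under_params D (c l)"
      then obtain p where "(p, pt l v) \<in> classical D"
        by (auto simp: under_params_def pt_def)
      from classical_cases[OF this] obtain l0 v0 l' v' \<eta> where
        x: "((l0, v0), (l', v'), \<eta>) \<in> X" "pt l v = pt l' v'"
        using pt_in_strand_pts[of l v 1] l by auto
      then have "l' = l" "v' = v"
        using X[OF x(1)] l pt_inject[of l l' v v'] by auto
      then show False
        using l(3) x(1) by blast
    qed
    then have "C.loc_const (colour D (c l)) (m l + k l * v)"
      using C.colouring c_range[OF l(1)] by (simp add: C.colouring_def)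
    then show "C.loc_const (strand_colour l) v"
      using C.sides_affine[OF _ k[OF l(1)]] unfolding strand_colour_def by fastforce
  next
    fix l v l' v' \<eta> assume x: "((l, v), (l', v'), \<eta>) \<in> X"
    note Xx = X[OF x]
    define y where "y = m l' + k l' * v'"
    let ?r = "right_to_left D (pt l v, pt l' v')"
    have per: "colour D j (u + of_int n) = colour D j u" for j u n
      by (simp add: colour_def arc_of_shift)
    have "((c l, frac (m l + k l * v)), (c l', frac y)) \<in> classical D"
      using Xx by (simp add: pt_def y_def)
    then obtain B where "C.sides (colour D (c l')) (frac y) B
        (under (right_to_left D ((c l, frac (m l + k l * v)), (c l', frac y))) (colour D (c l) (frac (m l + k l * v))) B)"
      using C.colouring unfolding C.colouring_def by blast
    then have "C.sides (colour D (c l')) (frac y) B (under ?r (strand_colour l v) B)"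
      by (simp add: strand_colour_def colour_def arc_of_frac pt_def y_def)
    from C.sides_shift[where n = "\<lfloor>y\<rfloor>", OF per this]
    have "C.sides (colour D (c l')) (m l' + k l' * v') B (under ?r (strand_colour l v) B)"
      by (simp add: frac_def y_def)
    from C.sides_affine[OF this] k[of l'] Xx
    have s: "C.sides (strand_colour l') v' (if k l' > 0 then B else under ?r (strand_colour l v) B)
        (if k l' > 0 then under ?r (strand_colour l v) B else B)"
      unfolding strand_colour_def by blast
    show "\<exists>B. C.sides (strand_colour l') v' B (under \<eta> (strand_colour l v) B)"
    proof (cases "k l' > 0")
      case True
      then have "?r = \<eta>"
        using Xx by auto
      then show ?thesis
        using s True by auto
    next
      case False
      \<comment> \<open>Along a reversed strand the walk starts on the far side, so its first colour
        is the one that the component has after the crossing.\<close>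
      then have "\<eta> = (\<not> ?r)"
        using Xx by auto
      then show ?thesis
        using s False by (intro exI[of _ "under ?r (strand_colour l v) B"]) simp
    qed
  qed
qed

lemma not_strand_pts_iff:
  "(i, frac x) \<notin> strand_pts r \<Longrightarrow> l < n \<Longrightarrow> \<bar>v\<bar> \<le> r \<Longrightarrow> (i, frac x) \<noteq> pt l v"
  using pt_in_strand_pts by metis

text \<open>Good points are those off the inner parts |v| \<le> 3/4 of the strands. They lie either
  outside the disc, where the old colours are kept, or in the collar, where the new colours agree
  with the old ones.\<close>

lemma glue_good:
  assumes "\<And>l v. l < n \<Longrightarrow> 3/4 \<le> \<bar>v\<bar> \<Longrightarrow> \<bar>v\<bar> < 1 \<Longrightarrow> congruence.cong K (\<gamma> l v) (strand_colour l v)"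
    and K: "congruence K" and x: "(i, frac x) \<notin> strand_pts (3/4)"
  shows "congruence.cong K (glue (colour D) \<gamma> i x) (colour D i x)"
proof -
  interpret K: congruence K by (rule K)
  show ?thesis
  proof (cases "\<exists>l v. l < n \<and> \<bar>v\<bar> < 1 \<and> (i, frac x) = pt l v")
    case True
    then obtain l v where l: "l < n" "\<bar>v\<bar> < 1" "(i, frac x) = pt l v"
      by blast
    then have i: "i = c l"
      by (simp add: pt_def)
    have "3/4 \<le> \<bar>v\<bar>"
      using not_strand_pts_iff[OF x l(1), of v] l(3) by force
    then show ?thesis
      using assms(1)[OF l(1)] l glue_pt[OF l, of "colour D" \<gamma>] strand_colour_pt[of l x v] by (simp add: i)
  next
    case False
    then have "glue (colour D) \<gamma> i x = colour D i x"
      by (intro glue_outside) blast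
    then show ?thesis by simp
  qed
qed

lemma classical_good:
  assumes "(p, q) \<in> classical D" "q \<notin> strand_pts (3/4)"
  shows "(p, q) \<in> classical D'"
  using classical_cases[OF assms(1)]
proof (elim disjE exE conjE)
  fix l v l' v' \<eta> assume x: "((l, v), (l', v'), \<eta>) \<in> X" "q = pt l' v'"
  have "pt l' v' \<in> strand_pts (3/4)"
    by (rule pt_in_strand_pts) (use X[OF x(1)] in auto)
  then show ?thesis
    using assms(2) x(2) by simp
qed

lemma under_params_good:
  assumes "(i, frac x) \<notin> strand_pts (3/4)"
  shows "x \<in> under_params D i \<longleftrightarrow> x \<in> under_params D' i"
proof -
  interpret sym: local_pair n c m k D' D X' X by (rule local_pair_sym)
  show ?thesis
    unfolding under_params_def mem_Collect_eq
    by (intro iff_exI iffI) (erule classical_good[OF _ assms], erule sym.classical_good[OF _ assms])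
qed

lemma glue_near:
  assumes ends: "\<And>l v. l < n \<Longrightarrow> 3/4 \<le> \<bar>v\<bar> \<Longrightarrow> \<bar>v\<bar> < 1 \<Longrightarrow> congruence.cong K (\<gamma> l v) (strand_colour l v)"
    and K: "congruence K" and x: "(i, frac x) \<notin> strand_pts (3/4)" and s: "congruence.sides K (colour D i) x B B'"
  shows "congruence.sides K (glue (colour D) \<gamma> i) x B B'"
proof -
  interpret K: congruence K by (rule K)
  obtain e where "e > 0" "\<And>y. \<bar>y - x\<bar> < e \<Longrightarrow> (i, frac y) \<notin> strand_pts (3/4)"
    using strand_pts_avoid[OF x] by blast
  then show ?thesis
    using glue_good[OF ends K] by (intro K.sides_near[OF s]) auto
qed

text \<open>
  A colouring of the strands of \<open>D'\<close> that fits the colours of \<open>D\<close> near the ends of the strands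
  extends by the colours of \<open>D\<close> to a colouring of \<open>D'\<close>.
\<close>

lemma colouring_glue:
  assumes col: "congruence.strand_colouring (rels D) n X' \<gamma>"
    and ends: "\<And>l v. l < n \<Longrightarrow> 3/4 \<le> \<bar>v\<bar> \<Longrightarrow> \<bar>v\<bar> < 1 \<Longrightarrow> congruence.cong (rels D) (\<gamma> l v) (strand_colour l v)"
  shows "congruence.colouring (rels D) D' (glue (colour D) \<gamma>)"
proof -
  interpret C: coloured_diagram D "rels D" "colour D" by (rule D.coloured_diagram_colour)
  note K = congruence_rels[of D]
  let ?g = "glue (colour D) \<gamma>"
  have near: "C.sides (?g i) x B B'" if "(i, frac x) \<notin> strand_pts (3/4)" "C.sides (colour D i) x B B'" for i x B B'
    by (rule glue_near[OF _ K that]) (rule ends)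
  have sub: "(i, frac x) \<notin> strand_pts 1 \<Longrightarrow> (i, frac x) \<notin> strand_pts (3/4)" for i x
    using strand_pts_mono[of "3/4" 1] by auto
  have good: "x \<in> under_params D i \<longleftrightarrow> x \<in> under_params D' i" if "(i, frac x) \<notin> strand_pts (3/4)" for i x
    using under_params_good[OF that] .
  show ?thesis
    unfolding C.colouring_def
  proof (intro conjI ballI allI impI)
    fix i x assume i: "i \<in> {1..ncomp D'}"
    have "arc_of D i (x + 1) = arc_of D i x"
      using arc_of_shift[of D i x 1] by simp
    then have "?g i (x + 1) = ?g i x"
      by (simp only: glue_def frac_1_eq colour_def)
    then show "C.cong (?g i (x + 1)) (?g i x)"
      by simp
    assume x: "x \<notin> under_params D' i"
    \<comment> \<open>Two overlapping regions: on the open strands |v| < 1 the colours are given by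
      \<open>\<gamma>\<close>, and at good points they are the colours of \<open>D\<close> up to
      congruence.\<close>
    show "C.loc_const (?g i) x"
    proof (cases "(i, frac x) \<in> strand_pts (3/4)")
      case True
      then obtain l v where l: "l < n" "\<bar>v\<bar> \<le> 3/4" "(i, frac x) = pt l v"
        by (auto simp: strand_pts_def)
      then have v: "\<bar>v\<bar> < 1" and ci: "i = c l"
        by (auto simp: pt_def)
      have "(p, (l, v), \<eta>) \<notin> X'" for p \<eta>
      proof
        assume "(p, (l, v), \<eta>) \<in> X'"
        then have "(pt (fst p) (snd p), pt l v) \<in> classical D'"
          using X'[of "fst p" "snd p" l v \<eta>] by simp
        then have "\<exists>p. (p, (i, frac x)) \<in> classical D'"
          unfolding l(3)[symmetric] by (rule exI)
        then show False
          using x by (simp add: under_params_def)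
      qed
      then have "C.loc_const (\<gamma> l) v"
        using col l(1) v by (simp add: C.strand_colouring_def)
      from glue_sides[where \<gamma> = \<gamma> and f = "colour D" and x = x, OF K l(1) v this] l(3) glue_pt[OF l(1) v l(3), of "colour D" \<gamma>] show ?thesis
        by (simp add: ci)
    next
      case False
      then have "C.loc_const (colour D i) x"
        using C.colouring x i ncomp_eq good[OF False] by (simp add: C.colouring_def)
      from C.sides_cong[OF near[OF False this]] show ?thesis
        using glue_good[OF ends K False] C.cong_sym by blast
    qed
  next
    fix i x j y assume cr: "((i, x), (j, y)) \<in> classical D'"
    note p = D'.classical_params[OF cr]
    let ?r = "right_to_left D' ((i, x), (j, y))"
    from classical_cases'[OF cr]
    show "\<exists>B. C.sides (?g j) y B (under ?r (?g i x) B)"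
    proof (elim disjE exE conjE)
      fix l v l' v' \<eta> assume x': "((l, v), (l', v'), \<eta>) \<in> X'" "(i, x) = pt l v" "(j, y) = pt l' v'"
      note Xx = X'[OF x'(1)]
      have v: "\<bar>v\<bar> < 1" "\<bar>v'\<bar> < 1" and l: "l < n" "l' < n" and r: "?r \<longleftrightarrow> (\<eta> \<longleftrightarrow> k l' > 0)"
        using Xx x'(2,3) by auto
      have j: "j = c l'"
        using x'(3) by (simp add: pt_def)
      have g: "?g i x = \<gamma> l v"
        by (rule glue_pt[OF l(1) v(1)]) (use x'(2) p in simp)
      obtain B where B: "C.sides (\<gamma> l') v' B (under \<eta> (\<gamma> l v) B)"
        using col x'(1) unfolding C.strand_colouring_def by blast
      have s: "C.sides (?g j) y (if k l' > 0 then B else under \<eta> (\<gamma> l v) B) (if k l' > 0 then under \<eta> (\<gamma> l v) B else B)"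
        unfolding j by (rule glue_sides[where \<gamma> = \<gamma>, OF K l(2) v(2) B]) (use x'(3) p in \<open>simp add: j\<close>)
      show ?thesis
      proof (cases "k l' > 0")
        case True
        then show ?thesis
          using s r by (intro exI[of _ B]) (simp add: g)
      next
        case False
        then have "?r = (\<not> \<eta>)"
          using r by auto
        then show ?thesis
          using s False by (intro exI[of _ "under \<eta> (\<gamma> l v) B"]) (simp add: g)
      qed
    next
      assume *: "((i, x), (j, y)) \<in> classical D" "right_to_left D ((i, x), (j, y)) = ?r"
        "(i, x) \<notin> strand_pts 1" "(j, y) \<notin> strand_pts 1"
      have g: "?g i x = colour D i x"
        using not_strand_pts_iff[of i x 1] *(3) p by (intro glue_outside) (auto simp: less_imp_le)
      have "\<exists>B. C.sides (colour D j) y B (under ?r (colour D i x) B)"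
        using C.colouring *(1) unfolding C.colouring_def *(2)[symmetric] by blast
      then obtain B where B: "C.sides (colour D j) y B (under ?r (colour D i x) B)" ..
      have "(j, frac y) \<notin> strand_pts (3/4)"
        using sub[of j y] *(4) p by simp
      from near[OF this B] show ?thesis
        unfolding g by (rule exI[of "\<lambda>B. C.sides (?g j) y B (under ?r (colour D i x) B)" B])
    qed
  qed
qed

definition inner_crossing :: "strand_crossing \<Rightarrow> crossing" where
  "inner_crossing x = (case x of ((l, v), (l', v'), \<eta>) \<Rightarrow> (pt l v, pt l' v'))"

text \<open>The flag that \<open>inner_crossing\<close> drops can be recovered from the sign of the
  crossing and the direction of the lower strand.\<close>

lemma inner_crossing_inj: "inj_on inner_crossing X"
proof (rule inj_onI)
  fix x y assume xy: "x \<in> X" "y \<in> X" "inner_crossing x = inner_crossing y"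
  obtain l v l' v' \<eta> where x: "x = ((l, v), (l', v'), \<eta>)" by (rule strand_crossing_cases)
  obtain l2 v2 l2' v2' \<eta>2 where y: "y = ((l2, v2), (l2', v2'), \<eta>2)" by (rule strand_crossing_cases)
  note Xx = X[OF xy(1)[unfolded x]] and Xy = X[OF xy(2)[unfolded y]]
  have eq: "pt l v = pt l2 v2" "pt l' v' = pt l2' v2'"
    using xy(3) by (simp_all add: inner_crossing_def x y)
  then have "l = l2 \<and> v = v2" "l' = l2' \<and> v' = v2'"
    using Xx Xy pt_inject[of l l2 v v2] pt_inject[of l' l2' v' v2'] by auto
  then show "x = y"
    using Xx Xy eq by (auto simp: x y)
qed

lemma inner_crossing_classical: "x \<in> X \<Longrightarrow> inner_crossing x \<in> classical D"
  using X by (cases x rule: strand_crossing_cases) (simp add: inner_crossing_def)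

lemma component_inner_crossing: "fst (snd (inner_crossing x)) = c (fst (fst (snd x)))"
  by (cases x rule: strand_crossing_cases) (simp add: inner_crossing_def pt_def)

lemma finite_X: "finite X"
  using D.finite_classical inner_crossing_inj inner_crossing_classical by (blast intro: inj_on_finite)

text \<open>
  The contribution of a crossing to the longitude changes its sign if the underpassing strand runs
  against its parametrization.
\<close>

lemma lonsum_split:
  assumes K: "congruence K" and col: "congruence.strand_colouring K n X \<gamma>"
    and gl: "\<And>l v. l < n \<Longrightarrow> \<bar>v\<bar> < 1 \<Longrightarrow> g (fst (pt l v)) (snd (pt l v)) = \<gamma> l v"
    and sd: "\<And>l v B B'. l < n \<Longrightarrow> \<bar>v\<bar> < 1 \<Longrightarrow> congruence.sides K (\<gamma> l) v B B' \<Longrightarrow>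
      congruence.sides K (g (c l)) (snd (pt l v)) (if k l > 0 then B else B') (if k l > 0 then B' else B)"
  shows "congruence.cong K (congruence.lonsum K D g i)
    ((\<Sum>l\<in>{l. l < n \<and> c l = i}. (if k l > 0 then 1 else - 1) *\<^sub>L congruence.strand_lonsum K X \<gamma> l) +
     (\<Sum>q\<in>{q \<in> classical D. fst (snd q) = i} - inner_crossing ` X. kap (right_to_left D q) *\<^sub>L
       (g (fst (fst q)) (snd (fst q)) - congruence.left_colour K (g i) (snd (snd q)))))"
proof -
  interpret K: congruence K by (rule K)
  let ?C = "{q \<in> classical D. fst (snd q) = i}"
  let ?t = "\<lambda>q. kap (right_to_left D q) *\<^sub>L (g (fst (fst q)) (snd (fst q)) - K.left_colour (g i) (snd (snd q)))"
  let ?Y = "{x \<in> X. c (fst (fst (snd x))) = i}"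
  let ?s = "\<lambda>x. kap (snd (snd x)) *\<^sub>L (\<gamma> (fst (fst x)) (snd (fst x)) - K.left_colour (\<gamma> (fst (fst (snd x)))) (snd (fst (snd x))))"
  have img: "inner_crossing ` ?Y = ?C \<inter> inner_crossing ` X"
    using inner_crossing_classical by (auto simp: component_inner_crossing)
  have inj: "inj_on inner_crossing ?Y"
    by (rule inj_on_subset[OF inner_crossing_inj]) auto
  have each: "K.cong (?t (inner_crossing x)) ((if k (fst (fst (snd x))) > 0 then 1 else - 1) *\<^sub>L ?s x)" if xY: "x \<in> ?Y" for x
  proof -
    obtain l v l' v' \<eta> where x: "x = ((l, v), (l', v'), \<eta>)" by (rule strand_crossing_cases)
    have Xx: "((l, v), (l', v'), \<eta>) \<in> X" and i: "c l' = i"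
      using xY by (auto simp: x)
    note X1 = X[OF Xx]
    have lv: "l < n" "l' < n" "\<bar>v\<bar> < 1" "\<bar>v'\<bar> < 1"
      using X1 by auto
    have r: "right_to_left D (pt l v, pt l' v') \<longleftrightarrow> (\<eta> \<longleftrightarrow> k l' > 0)"
      using X1 by blast
    obtain B where B: "K.sides (\<gamma> l') v' B (under \<eta> (\<gamma> l v) B)"
      using col Xx unfolding K.strand_colouring_def by blast
    note s = sd[OF lv(2,4) B, unfolded i]
    have lc: "K.cong (K.left_colour (\<gamma> l') v') B"
      by (rule K.left_colour[OF B])
    have tx: "?t (inner_crossing x) = kap (right_to_left D (pt l v, pt l' v')) *\<^sub>L (\<gamma> l v - K.left_colour (g i) (snd (pt l' v')))"
      using gl[OF lv(1,3)] by (simp add: inner_crossing_def x)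
    show ?thesis
    proof (cases "k l' > 0")
      case True
      then have "K.cong (K.left_colour (g i) (snd (pt l' v'))) B"
        using K.left_colour[OF s] by simp
      then have "K.cong (K.left_colour (g i) (snd (pt l' v'))) (K.left_colour (\<gamma> l') v')"
        using lc K.cong_trans_sym by blast
      then show ?thesis
        unfolding tx using True r by (auto simp: x intro!: K.cong_scale K.cong_diff)
    next
      case False
      then have r': "right_to_left D (pt l v, pt l' v') = (\<not> \<eta>)"
        using r by auto
      have "K.cong (K.left_colour (g i) (snd (pt l' v'))) (under \<eta> (\<gamma> l v) B)"
        using K.left_colour[OF s] False by simp
      then have "K.cong (?t (inner_crossing x)) (kap (\<not> \<eta>) *\<^sub>L (\<gamma> l v - under \<eta> (\<gamma> l v) B))"
        unfolding tx r' by (intro K.cong_scale K.cong_diff K.cong_refl)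
      also have "kap (\<not> \<eta>) *\<^sub>L (\<gamma> l v - under \<eta> (\<gamma> l v) B) = (kap (\<not> \<eta>) * lpow \<eta>) *\<^sub>L (\<gamma> l v - B)"
        by (simp add: under_def algebra_simps)
      also have "\<dots> = - 1 *\<^sub>L (kap \<eta> *\<^sub>L (\<gamma> l v - B))"
        by (simp add: kap_not)
      also have "K.cong \<dots> (- 1 *\<^sub>L (kap \<eta> *\<^sub>L (\<gamma> l v - K.left_colour (\<gamma> l') v')))"
        by (intro K.cong_scale K.cong_diff K.cong_refl K.cong_sym[OF lc])
      finally show ?thesis
        using False by (simp add: x)
    qed
  qed
  have "(\<Sum>q\<in>?C \<inter> inner_crossing ` X. ?t q) = (\<Sum>x\<in>?Y. ?t (inner_crossing x))"
    unfolding img[symmetric] by (simp only: sum.reindex[OF inj] o_def)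
  also have "K.cong \<dots> (\<Sum>x\<in>?Y. (if k (fst (fst (snd x))) > 0 then 1 else - 1) *\<^sub>L ?s x)"
    by (intro K.cong_sum each)
  also have "\<dots> = (\<Sum>l\<in>{l. l < n \<and> c l = i}. \<Sum>x\<in>{x \<in> ?Y. fst (fst (snd x)) = l}. (if k (fst (fst (snd x))) > 0 then 1 else - 1) *\<^sub>L ?s x)"
  proof (rule sum.group[symmetric])
    show "finite ?Y"
      using finite_X by simp
    show "(\<lambda>x. fst (fst (snd x))) ` ?Y \<subseteq> {l. l < n \<and> c l = i}"
      using X by (auto simp: image_subset_iff)
  qed simp
  also have "\<dots> = (\<Sum>l\<in>{l. l < n \<and> c l = i}. (if k l > 0 then 1 else - 1) *\<^sub>L K.strand_lonsum X \<gamma> l)"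
    unfolding K.strand_lonsum_def lmod.scale_sum_right
  proof (intro sum.cong refl)
    fix l assume "l \<in> {l. l < n \<and> c l = i}"
    then show "{x \<in> ?Y. fst (fst (snd x)) = l} = {x \<in> X. fst (fst (snd x)) = l}"
      by auto
  qed auto
  finally have inner: "K.cong (\<Sum>q\<in>?C \<inter> inner_crossing ` X. ?t q) \<dots>" .
  have "K.lonsum D g i = (\<Sum>q\<in>?C \<inter> inner_crossing ` X. ?t q) + (\<Sum>q\<in>?C - inner_crossing ` X. ?t q)"
    unfolding K.lonsum_def by (rule sum.Int_Diff) (simp add: D.finite_classical)
  then show ?thesis
    using K.cong_add[OF inner K.cong_refl] by simp
qed

lemma outer_crossing:
  assumes "q \<in> classical D" "q \<notin> inner_crossing ` X"
  shows "q \<in> classical D' \<and> q \<notin> inner_crossing ` X' \<and> right_to_left D' q = right_to_left D q \<and>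
    fst q \<notin> strand_pts 1 \<and> snd q \<notin> strand_pts 1"
proof -
  have "(fst q, snd q) \<in> classical D"
    using assms(1) by simp
  from classical_cases[OF this] show ?thesis
  proof (elim disjE exE conjE)
    fix l v l' v' \<eta> assume "((l, v), (l', v'), \<eta>) \<in> X" "fst q = pt l v" "snd q = pt l' v'"
    then have "q \<in> inner_crossing ` X"
      by (intro image_eqI[of _ _ "((l, v), (l', v'), \<eta>)"]) (simp_all add: inner_crossing_def prod_eq_iff)
    then show ?thesis
      using assms(2) by simp
  next
    assume *: "(fst q, snd q) \<in> classical D'" "right_to_left D' (fst q, snd q) = right_to_left D (fst q, snd q)"
      "fst q \<notin> strand_pts 1" "snd q \<notin> strand_pts 1"
    have "snd (inner_crossing x) \<in> strand_pts 1" if x: "x \<in> X'" for x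
    proof -
      obtain l v l' v' \<eta> where xx: "x = ((l, v), (l', v'), \<eta>)" by (rule strand_crossing_cases)
      show ?thesis
        unfolding inner_crossing_def xx using X'[OF x[unfolded xx]] by (simp add: pt_in_strand_pts)
    qed
    then show ?thesis
      using * by auto
  qed
qed

text \<open>Colours at inner points are expressed through the colours in the collars, by
  \<open>strands_generate\<close> for the tautological colouring of the strands.\<close>

lemma generating_good:
  assumes "strands_generate n X"
  shows "generating D (\<lambda>i x. i \<in> {1..ncomp D} \<and> x \<notin> under_params D i \<and> (i, frac x) \<notin> strand_pts (3/4))"
  unfolding generating_def
proof (intro allI impI ballI)
  fix Z i x
  assume Z: "lmod.subspace Z" "rels D \<subseteq> Z"
    and good: "\<forall>i x. i \<in> {1..ncomp D} \<and> x \<notin> under_params D i \<and> (i, frac x) \<notin> strand_pts (3/4) \<longrightarrow> colour D i x \<in> Z"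
    and i: "i \<in> {1..ncomp D}" and x: "x \<notin> under_params D i"
  show "colour D i x \<in> Z"
  proof (cases "(i, frac x) \<in> strand_pts (3/4)")
    case True
    then obtain l v where l: "l < n" "\<bar>v\<bar> \<le> 3/4" "(i, frac x) = pt l v"
      by (auto simp: strand_pts_def)
    then have ci: "i = c l" and v: "\<bar>v\<bar> < 1"
      by (auto simp: pt_def)
    have nX: "\<forall>p \<eta>. (p, (l, v), \<eta>) \<notin> X"
    proof (intro allI notI)
      fix p \<eta> assume "(p, (l, v), \<eta>) \<in> X"
      then have "(pt (fst p) (snd p), pt l v) \<in> classical D"
        using X[of "fst p" "snd p" l v \<eta>] by simp
      then have "\<exists>p. (p, (i, frac x)) \<in> classical D"
        unfolding l(3)[symmetric] by (rule exI)
      then show False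
        using x by (simp add: under_params_def)
    qed
    have "strand_colour l' w \<in> Z" if w: "l' < n" "3/4 < \<bar>w\<bar>" "\<bar>w\<bar> < 1" for l' w
    proof -
      have "pt l' w \<notin> strand_pts (3/4)"
      proof
        assume "pt l' w \<in> strand_pts (3/4)"
        then obtain l v where "l < n" "\<bar>v\<bar> \<le> 3/4" "pt l' w = pt l v"
          by (auto simp: strand_pts_def)
        then show False
          using w pt_inject[of l' l w v] by auto
      qed
      moreover have "m l' + k l' * w \<notin> under_params D (c l')"
      proof
        assume "m l' + k l' * w \<in> under_params D (c l')"
        then obtain p where "(p, pt l' w) \<in> classical D"
          by (auto simp: under_params_def pt_def)
        from classical_cases[OF this] show False
        proof (elim disjE exE conjE)
          fix l1 v1 l2 v2 \<eta> assume *: "((l1, v1), (l2, v2), \<eta>) \<in> X" "pt l' w = pt l2 v2"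
          then show False
            using X[OF *(1)] w pt_inject[of l' l2 w v2] by auto
        next
          assume "pt l' w \<notin> strand_pts 1"
          then show False
            using pt_in_strand_pts[of l' w 1] w by simp
        qed
      qed
      ultimately show ?thesis
        using good c_range[OF w(1)] unfolding strand_colour_def pt_def by blast
    qed
    then have "strand_colour l v \<in> Z"
      using assms[unfolded strands_generate_def, rule_format, OF subspace_rels strand_colouring_colour Z _ l(1) v] nX by blast
    then show ?thesis
      using strand_colour_pt[of l x v] l(3) by (simp add: ci)
  qed (use good i x in blast)
qed

text \<open>Each of the two module maps comes from a colouring of its source by its target, hence
  \<open>strands_extend\<close> in both directions. In the longitudes, the inner crossings
  contribute equally strand by strand, while the outer crossings are common to both diagrams and
  keep signs and colours.\<close>

theorem enhanced_isomorphic_local: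
  assumes ext: "strands_extend n X X'" "strands_extend n X' X"
    and gen: "strands_generate n X" "strands_generate n X'"
  shows "enhanced_isomorphic D D'"
proof -
  interpret sym: local_pair n c m k D' D X' X by (rule local_pair_sym)
  interpret K': congruence "rels D'" by (rule congruence_rels)
  note K = congruence_rels[of D] and K' = congruence_rels[of D']
  obtain \<gamma> where \<gamma>: "K'.strand_colouring n X \<gamma>"
    "\<And>l v. l < n \<Longrightarrow> 3/4 \<le> \<bar>v\<bar> \<Longrightarrow> \<bar>v\<bar> < 1 \<Longrightarrow> K'.cong (\<gamma> l v) (sym.strand_colour l v)"
    "\<And>l. l < n \<Longrightarrow> K'.cong (K'.strand_lonsum X \<gamma> l) (K'.strand_lonsum X' sym.strand_colour l)"
    using ext(1)[unfolded strands_extend_def, rule_format, OF subspace_rels sym.strand_colouring_colour] by blast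
  obtain \<gamma>' where \<gamma>': "congruence.strand_colouring (rels D) n X' \<gamma>'"
    "\<And>l v. l < n \<Longrightarrow> 3/4 \<le> \<bar>v\<bar> \<Longrightarrow> \<bar>v\<bar> < 1 \<Longrightarrow> congruence.cong (rels D) (\<gamma>' l v) (strand_colour l v)"
    using ext(2)[unfolded strands_extend_def, rule_format, OF subspace_rels strand_colouring_colour] by blast
  let ?g = "glue (colour D') \<gamma>" and ?g' = "glue (colour D) \<gamma>'"
  let ?R = "\<lambda>i x x'. x' = x \<and> i \<in> {1..ncomp D} \<and> x \<notin> under_params D i \<and> (i, frac x) \<notin> strand_pts (3/4)"
  have col: "K'.colouring D ?g"
    by (rule sym.colouring_glue[OF \<gamma>(1,2)])
  have col': "congruence.colouring (rels D) D' ?g'"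
    by (rule colouring_glue[OF \<gamma>'])
  interpret C: coloured_diagram D "rels D'" ?g by standard (rule col)
  interpret C': coloured_diagram D' "rels D'" "colour D'" by (rule D'.coloured_diagram_colour)
  show ?thesis
  proof (rule enhanced_isomorphicI[OF valid ncomp_eq col col', where R = ?R])
    fix i x x' assume R: "?R i x x'"
    then have [simp]: "x' = x" and good: "(i, frac x) \<notin> strand_pts (3/4)"
      by blast+
    show "i \<in> {1..ncomp D} \<and> x \<notin> under_params D i \<and> x' \<notin> under_params D' i \<and>
        K'.cong (?g i x) (colour D' i x') \<and> congruence.cong (rels D) (?g' i x') (colour D i x)"
      using R under_params_good[OF good] sym.glue_good[OF \<gamma>(2) K' good] glue_good[OF \<gamma>'(2) K good] by simp
  next
    show "generating D (\<lambda>i x. \<exists>x'. ?R i x x')"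
      using generating_good[OF gen(1)] by simp
  next
    have eq: "(\<lambda>i x'. \<exists>x. ?R i x x') =
        (\<lambda>i x. i \<in> {1..ncomp D'} \<and> x \<notin> under_params D' i \<and> (i, frac x) \<notin> strand_pts (3/4))"
      using under_params_good ncomp_eq by (auto simp: fun_eq_iff)
    show "generating D' (\<lambda>i x'. \<exists>x. ?R i x x')"
      unfolding eq by (rule sym.generating_good[OF gen(2)])
  next
    fix i
    have pt: "(fst (pt l v), frac (snd (pt l v))) = pt l v" "fst (pt l v) = c l" for l v
      by (simp_all add: pt_def)
    have gl: "glue f \<delta> (fst (pt l v)) (snd (pt l v)) = \<delta> l v" if "l < n" "\<bar>v\<bar> < 1"
      for l v and f \<delta> :: "nat \<Rightarrow> real \<Rightarrow> arc \<Rightarrow> laurent"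
      by (rule glue_pt[OF that pt(1)])
    have sd: "K'.sides (glue f \<delta> (c l)) (snd (pt l v)) (if k l > 0 then B else B') (if k l > 0 then B' else B)"
      if "l < n" "\<bar>v\<bar> < 1" "K'.sides (\<delta> l) v B B'" for l v B B' and f \<delta> :: "nat \<Rightarrow> real \<Rightarrow> arc \<Rightarrow> laurent"
      by (rule glue_sides[where \<gamma> = \<delta>, OF K' that]) (use pt in simp)
    let ?S = "\<lambda>X \<gamma>. \<Sum>l\<in>{l. l < n \<and> c l = i}. (if k l > 0 then 1 else - 1) *\<^sub>L K'.strand_lonsum X \<gamma> l"
    let ?T = "\<lambda>D g X. \<Sum>q\<in>{q \<in> classical D. fst (snd q) = i} - inner_crossing ` X. kap (right_to_left D q) *\<^sub>L
       (g (fst (fst q)) (snd (fst q)) - K'.left_colour (g i) (snd (snd q)))"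
    have "K'.cong (K'.lonsum D ?g i) (?S X \<gamma> + ?T D ?g X)"
      by (rule lonsum_split[OF K' \<gamma>(1) gl sd])
    also have "K'.cong \<dots> (?S X' sym.strand_colour + ?T D' (colour D') X')"
    proof (rule K'.cong_add)
      show "K'.cong (?S X \<gamma>) (?S X' sym.strand_colour)"
        by (intro K'.cong_sum K'.cong_scale \<gamma>(3)) simp
      have idx: "{q \<in> classical D. fst (snd q) = i} - inner_crossing ` X =
          {q \<in> classical D'. fst (snd q) = i} - inner_crossing ` X'"
      proof (intro equalityI subsetI)
        fix q assume "q \<in> {q \<in> classical D. fst (snd q) = i} - inner_crossing ` X"
        then show "q \<in> {q \<in> classical D'. fst (snd q) = i} - inner_crossing ` X'"
          using outer_crossing[of q] by simp
      next
        fix q assume "q \<in> {q \<in> classical D'. fst (snd q) = i} - inner_crossing ` X'"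
        then show "q \<in> {q \<in> classical D. fst (snd q) = i} - inner_crossing ` X"
          using sym.outer_crossing[of q] by simp
      qed
      show "K'.cong (?T D ?g X) (?T D' (colour D') X')"
        unfolding idx[symmetric]
      proof (rule K'.cong_sum)
        fix q assume "q \<in> {q \<in> classical D. fst (snd q) = i} - inner_crossing ` X"
        then have q: "q \<in> classical D" "q \<notin> inner_crossing ` X" and i: "fst (snd q) = i"
          by auto
        note o = outer_crossing[OF q]
        have q': "q \<in> classical D'"
          using o by blast
        obtain j x y where qq: "q = ((j, x), (i, y))"
          using i by (cases q, cases "fst q", cases "snd q") auto
        note p = D.classical_params[OF q(1)[unfolded qq]]
        have "(i, frac y) \<notin> strand_pts (3/4)"
          using o p(4) strand_pts_mono[of "3/4" 1] by (auto simp: qq)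
        from sym.glue_near[OF _ K' this C'.crossing_colours(1)[OF q', unfolded qq fst_conv snd_conv], of \<gamma>]
        have lc: "K'.cong (K'.left_colour (?g i) y) (K'.left_colour (colour D' i) y)"
          using \<gamma>(2) K'.left_colour by blast
        have "(j, frac x) \<noteq> pt l v" if "l < n" "\<bar>v\<bar> < 1" for l v
          using o p(3) not_strand_pts_iff[of j x 1 l v] that by (simp add: qq)
        then have over: "?g j x = colour D' j x"
          by (rule glue_outside)
        have rtl: "right_to_left D' ((j, x), (i, y)) = right_to_left D ((j, x), (i, y))"
          using o qq by simp
        show "K'.cong (kap (right_to_left D q) *\<^sub>L (?g (fst (fst q)) (snd (fst q)) - K'.left_colour (?g i) (snd (snd q))))
          (kap (right_to_left D' q) *\<^sub>L (colour D' (fst (fst q)) (snd (fst q)) - K'.left_colour (colour D' i) (snd (snd q))))"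
          unfolding qq fst_conv snd_conv over rtl by (rule K'.cong_scale[OF K'.cong_diff[OF K'.cong_refl lc]])
      qed
    qed
    also have "K'.cong \<dots> (K'.lonsum D' (colour D') i)"
      by (rule K'.cong_sym, rule sym.lonsum_split[OF K' sym.strand_colouring_colour])
        (use gl[of _ _ "colour D'" sym.strand_colour] sd[of _ _ sym.strand_colour _ _ "colour D'"]
          in \<open>simp_all only: sym.glue_strand_colour\<close>)
    finally show "K'.cong (K'.lonsum D ?g i) (K'.lonsum D' (colour D') i)" .
  qed
qed

end

section \<open>The Reidemeister moves on strands\<close>

definition steps :: "real \<Rightarrow> real \<Rightarrow> 'b \<Rightarrow> 'b \<Rightarrow> 'b \<Rightarrow> real \<Rightarrow> 'b" where
  "steps p q x y z v = (if v < p then x else if v < q then y else z)"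

text \<open>Since \<open>lpow \<eta>\<close> - 1 is (t - 1) times \<open>kap \<eta>\<close>, both
  sides are t - 1 times the product of the two \<open>kap\<close> factors.\<close>

lemma kap_lpow: "kap \<eta> * (lpow \<theta> - 1) = kap \<theta> * (lpow \<eta> - 1)"
  by (auto simp: kap_def lpow_def algebra_simps)

text \<open>In the second move the two crossings of the lower strand cancel in the
  longitude.\<close>

lemma kap_under: "kap \<eta> *\<^sub>L (a - x) + kap (\<not> \<eta>) *\<^sub>L (a - under \<eta> a x) = 0"
proof -
  have "kap (\<not> \<eta>) *\<^sub>L (a - under \<eta> a x) = (kap (\<not> \<eta>) * lpow \<eta>) *\<^sub>L (a - x)"
    by (simp add: under_def algebra_simps)
  then show ?thesis
    by (simp add: kap_not)
qed

text \<open>The counterpart of \<open>under_under\<close> for longitudes: the bottom strand of the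
  third move collects the same total in either order of its two crossings.\<close>

lemma kap_under_under:
  "kap \<eta> *\<^sub>L (a - x) + kap \<theta> *\<^sub>L (under \<eta> a b - under \<eta> a x) = kap \<theta> *\<^sub>L (b - x) + kap \<eta> *\<^sub>L (a - under \<theta> b x)"
proof -
  have "(kap \<theta> *\<^sub>L (b - x) + kap \<eta> *\<^sub>L (a - under \<theta> b x)) -
      (kap \<eta> *\<^sub>L (a - x) + kap \<theta> *\<^sub>L (under \<eta> a b - under \<eta> a x)) =
      (kap \<eta> * (lpow \<theta> - 1) - kap \<theta> * (lpow \<eta> - 1)) *\<^sub>L (b - x)"
    by (simp add: under_def algebra_simps)
  then show ?thesis
    by (simp add: kap_lpow[of \<eta> \<theta>])
qed

section \<open>Colours along a strand with at most two undercrossings, and the first move\<close>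

context congruence
begin

lemma sides_eq: "e > 0 \<Longrightarrow> (\<And>d. 0 < d \<Longrightarrow> d < e \<Longrightarrow> f (x - d) = B \<and> f (x + d) = B') \<Longrightarrow> sides f x B B'"
  unfolding sides_def by (intro exI[of _ e]) auto

lemma sides_steps:
  assumes "p < q"
  shows "sides (steps p q x y z) p x y" "sides (steps p q x y z) q y z"
    "v \<noteq> p \<Longrightarrow> v \<noteq> q \<Longrightarrow> loc_const (steps p q x y z) v"
proof -
  show "sides (steps p q x y z) p x y"
    by (rule sides_eq[of "q - p"]) (use assms in \<open>auto simp: steps_def\<close>)
  show "sides (steps p q x y z) q y z"
    by (rule sides_eq[of "q - p"]) (use assms in \<open>auto simp: steps_def\<close>)
  assume "v \<noteq> p" "v \<noteq> q"
  then show "loc_const (steps p q x y z) v"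
    by (intro sides_eq[of "min \<bar>v - p\<bar> \<bar>v - q\<bar>"]) (auto simp: steps_def)
qed

text \<open>Local constancy stops short of \<open>p\<close>, so the colour is carried only to some
  \<open>p - d\<close> within the range of the one-sided colour.\<close>

lemma loc_const_left:
  assumes "sides f p B B'" "v < p" "\<And>z. v \<le> z \<Longrightarrow> z < p \<Longrightarrow> loc_const f z"
  shows "f v \<doteq> B"
proof -
  obtain e where e: "e > 0" "\<And>d. 0 < d \<Longrightarrow> d < e \<Longrightarrow> f (p - d) \<doteq> B \<and> f (p + d) \<doteq> B'"
    using assms(1) unfolding sides_def by blast
  define d where "d = min e (p - v) / 2"
  have d: "0 < d" "d < e" "v \<le> p - d"
    using e(1) assms(2) by (auto simp: d_def min_def field_simps)
  have "f v \<doteq> f (p - d)"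
    by (rule loc_const_connected) (use d assms(3) in \<open>auto simp: closed_segment_eq_real_ivl split: if_splits\<close>)
  then show ?thesis
    using e(2)[OF d(1,2)] cong_trans by blast
qed

lemma loc_const_right:
  assumes "sides f p B B'" "p < v" "\<And>z. p < z \<Longrightarrow> z \<le> v \<Longrightarrow> loc_const f z"
  shows "f v \<doteq> B'"
proof -
  obtain e where e: "e > 0" "\<And>d. 0 < d \<Longrightarrow> d < e \<Longrightarrow> f (p - d) \<doteq> B \<and> f (p + d) \<doteq> B'"
    using assms(1) unfolding sides_def by blast
  define d where "d = min e (v - p) / 2"
  have d: "0 < d" "d < e" "p + d \<le> v"
    using e(1) assms(2) by (auto simp: d_def min_def field_simps)
  have "f v \<doteq> f (p + d)"
    by (rule loc_const_connected) (use d assms(3) in \<open>auto simp: closed_segment_eq_real_ivl split: if_splits\<close>)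
  then show ?thesis
    using e(2)[OF d(1,2)] cong_trans by blast
qed

lemma strand_colouringI:
  assumes "\<And>l v. l < n \<Longrightarrow> \<bar>v\<bar> < 1 \<Longrightarrow> (\<And>p \<eta>. (p, (l, v), \<eta>) \<notin> X) \<Longrightarrow> loc_const (\<gamma> l) v"
    and "\<And>l v l' v' \<eta>. ((l, v), (l', v'), \<eta>) \<in> X \<Longrightarrow> \<exists>B. sides (\<gamma> l') v' B (under \<eta> (\<gamma> l v) B)"
  shows "strand_colouring n X \<gamma>"
  using assms unfolding strand_colouring_def by blast

lemma strand_loc_const:
  "strand_colouring n X \<gamma> \<Longrightarrow> l < n \<Longrightarrow> \<bar>v\<bar> < 1 \<Longrightarrow> (\<And>p \<eta>. (p, (l, v), \<eta>) \<notin> X) \<Longrightarrow> loc_const (\<gamma> l) v"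
  unfolding strand_colouring_def by blast

lemma no_under:
  assumes "strand_colouring n X \<gamma>" "l < n" "\<And>p v \<eta>. (p, (l, v), \<eta>) \<notin> X" "\<bar>v\<bar> < 1" "\<bar>w\<bar> < 1"
  shows "\<gamma> l v \<doteq> \<gamma> l w"
proof (rule loc_const_connected)
  fix z assume "z \<in> closed_segment v w"
  then have "\<bar>z\<bar> < 1"
    using assms(4,5) by (auto simp: closed_segment_eq_real_ivl split: if_splits)
  then show "loc_const (\<gamma> l) z"
    using strand_loc_const assms(1-3) by blast
qed

lemma one_under:
  assumes "strand_colouring n X \<gamma>" "l < n" "((r, u), (l, p), \<eta>) \<in> X" "\<bar>p\<bar> < 1"
    and only: "\<And>a v \<theta>. (a, (l, v), \<theta>) \<in> X \<Longrightarrow> v = p"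
  obtains x where "sides (\<gamma> l) p x (under \<eta> (\<gamma> r u) x)" "left_colour (\<gamma> l) p \<doteq> x"
    "\<And>v. \<bar>v\<bar> < 1 \<Longrightarrow> v < p \<Longrightarrow> \<gamma> l v \<doteq> x" "\<And>v. \<bar>v\<bar> < 1 \<Longrightarrow> p < v \<Longrightarrow> \<gamma> l v \<doteq> under \<eta> (\<gamma> r u) x"
proof -
  obtain x where x: "sides (\<gamma> l) p x (under \<eta> (\<gamma> r u) x)"
    using assms(1,3) unfolding strand_colouring_def by blast
  have lc: "loc_const (\<gamma> l) z" if "\<bar>z\<bar> < 1" "z \<noteq> p" for z
    using strand_loc_const[OF assms(1,2) that(1)] only that(2) by blast
  show thesis
  proof (rule that[OF x left_colour[OF x]])
    show "\<gamma> l v \<doteq> x" if "\<bar>v\<bar> < 1" "v < p" for v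
      by (rule loc_const_left[OF x that(2)]) (use that assms(4) in \<open>auto intro!: lc\<close>)
    show "\<gamma> l v \<doteq> under \<eta> (\<gamma> r u) x" if "\<bar>v\<bar> < 1" "p < v" for v
      by (rule loc_const_right[OF x that(2)]) (use that assms(4) in \<open>auto intro!: lc\<close>)
  qed
qed

lemma two_unders:
  assumes "strand_colouring n X \<gamma>" "l < n" "((r, u), (l, p), \<eta>) \<in> X" "((r', u'), (l, q), \<theta>) \<in> X"
    and pq: "\<bar>p\<bar> < 1" "\<bar>q\<bar> < 1" "p < q" and only: "\<And>a v \<theta>. (a, (l, v), \<theta>) \<in> X \<Longrightarrow> v = p \<or> v = q"
  obtains x y where "y = under \<eta> (\<gamma> r u) x" "left_colour (\<gamma> l) p \<doteq> x" "left_colour (\<gamma> l) q \<doteq> y"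
    "\<And>v. \<bar>v\<bar> < 1 \<Longrightarrow> v \<noteq> p \<Longrightarrow> v \<noteq> q \<Longrightarrow> \<gamma> l v \<doteq> steps p q x y (under \<theta> (\<gamma> r' u') y) v"
proof -
  obtain x where x: "sides (\<gamma> l) p x (under \<eta> (\<gamma> r u) x)"
    using assms(1,3) unfolding strand_colouring_def by blast
  obtain b where b: "sides (\<gamma> l) q b (under \<theta> (\<gamma> r' u') b)"
    using assms(1,4) unfolding strand_colouring_def by blast
  have lc: "loc_const (\<gamma> l) z" if "\<bar>z\<bar> < 1" "z \<noteq> p" "z \<noteq> q" for z
    using strand_loc_const[OF assms(1,2) that(1)] only that(2,3) by blast
  define y where "y = under \<eta> (\<gamma> r u) x"
  have mid: "\<gamma> l v \<doteq> y" "\<gamma> l v \<doteq> b" if "p < v" "v < q" for v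
  proof -
    show "\<gamma> l v \<doteq> y"
      unfolding y_def by (rule loc_const_right[OF x that(1)]) (use that pq in \<open>auto intro!: lc\<close>)
    show "\<gamma> l v \<doteq> b"
      by (rule loc_const_left[OF b that(2)]) (use that pq in \<open>auto intro!: lc\<close>)
  qed
  \<comment> \<open>A point between the two crossings identifies the colour after the first with the
    colour before the second.\<close>
  have "p < (p + q) / 2" "(p + q) / 2 < q"
    using pq by simp_all
  from mid[OF this] have "b \<doteq> y"
    using cong_sym cong_trans by blast
  then have z: "under \<theta> (\<gamma> r' u') b \<doteq> under \<theta> (\<gamma> r' u') y"
    by (rule cong_under[OF cong_refl])
  show thesis
  proof (rule that[OF y_def left_colour[OF x] cong_trans[OF left_colour[OF b] \<open>b \<doteq> y\<close>]])
    fix v assume v: "\<bar>v\<bar> < 1" "v \<noteq> p" "v \<noteq> q"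
    consider "v < p" | "p < v" "v < q" | "q < v"
      using v by linarith
    then show "\<gamma> l v \<doteq> steps p q x y (under \<theta> (\<gamma> r' u') y) v"
    proof cases
      case 1
      have "\<gamma> l v \<doteq> x"
        by (rule loc_const_left[OF x 1]) (use 1 v pq in \<open>auto intro!: lc\<close>)
      then show ?thesis
        using 1 by (simp add: steps_def)
    next
      case 2
      then show ?thesis
        using mid by (simp add: steps_def)
    next
      case 3
      have "\<gamma> l v \<doteq> under \<theta> (\<gamma> r' u') b"
        by (rule loc_const_right[OF b 3]) (use 3 v pq in \<open>auto intro!: lc\<close>)
      then show ?thesis
        using 3 pq cong_trans[OF _ z] by (simp add: steps_def)
    qed
  qed
qed

lemma strand_lonsum_no_under: "(\<And>p v \<eta>. (p, (l, v), \<eta>) \<notin> X) \<Longrightarrow> strand_lonsum X \<gamma> l = 0"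
proof -
  assume "\<And>p v \<eta>. (p, (l, v), \<eta>) \<notin> X"
  then have "{x \<in> X. fst (fst (snd x)) = l} = {}"
    by auto
  then show ?thesis
    by (simp only: strand_lonsum_def sum.empty)
qed

lemma strand_lonsum_one:
  assumes "{x \<in> X. fst (fst (snd x)) = l} = {((r, u), (l, p), \<eta>)}" "left_colour (\<gamma> l) p \<doteq> x"
  shows "strand_lonsum X \<gamma> l \<doteq> kap \<eta> *\<^sub>L (\<gamma> r u - x)"
  unfolding strand_lonsum_def assms(1) using assms(2) by (auto intro!: cong_scale cong_diff)

lemma strand_lonsum_two:
  assumes "{x \<in> X. fst (fst (snd x)) = l} = {((r, u), (l, p), \<eta>), ((r', u'), (l, q), \<theta>)}" "p \<noteq> q"
    "left_colour (\<gamma> l) p \<doteq> x" "left_colour (\<gamma> l) q \<doteq> y"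
  shows "strand_lonsum X \<gamma> l \<doteq> kap \<eta> *\<^sub>L (\<gamma> r u - x) + kap \<theta> *\<^sub>L (\<gamma> r' u' - y)"
  unfolding strand_lonsum_def assms(1) using assms(2-) by (auto intro!: cong_add cong_scale cong_diff)

lemma in_Z:
  assumes "x \<doteq> y" "lmod.subspace Z" "K \<subseteq> Z" "y \<in> Z"
  shows "x \<in> Z"
proof -
  have "x = (x - y) + y"
    by simp
  then show ?thesis
    using assms lmod.subspace_add[OF assms(2)] unfolding cong_def by (metis subsetD)
qed

lemma under_in_Z: "lmod.subspace Z \<Longrightarrow> a \<in> Z \<Longrightarrow> x \<in> Z \<Longrightarrow> under \<eta> a x \<in> Z"
  unfolding under_def by (intro lmod.subspace_add lmod.subspace_scale lmod.subspace_diff)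

text \<open>The overpassing point lies on the strand itself. If it comes before the undercrossing,
  \<open>under_self\<close> shows that the colour does not jump; if it comes after, the relation is
  first solved backwards.\<close>

lemma first_move_const:
  assumes \<gamma>: "strand_colouring 1 {((0, s), (0, - s), \<eta>)} \<gamma>" and s: "s \<noteq> 0" "\<bar>s\<bar> < 3/4"
  obtains x where "\<And>v. \<bar>v\<bar> < 1 \<Longrightarrow> v \<noteq> - s \<Longrightarrow> \<gamma> 0 v \<doteq> x" "left_colour (\<gamma> 0) (- s) \<doteq> x"
proof -
  obtain x where x: "left_colour (\<gamma> 0) (- s) \<doteq> x" "\<And>v. \<bar>v\<bar> < 1 \<Longrightarrow> v < - s \<Longrightarrow> \<gamma> 0 v \<doteq> x"
    "\<And>v. \<bar>v\<bar> < 1 \<Longrightarrow> - s < v \<Longrightarrow> \<gamma> 0 v \<doteq> under \<eta> (\<gamma> 0 s) x"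
    by (rule one_under[OF \<gamma>, of 0 0 s "- s" \<eta>]) (use s in auto)
  have un: "under \<eta> (\<gamma> 0 s) x \<doteq> x"
  proof (cases "s < - s")
    case True
    then have "\<gamma> 0 s \<doteq> x"
      using x(2) s by simp
    then show ?thesis
      using cong_under[of "\<gamma> 0 s" x x x \<eta>] by simp
  next
    case False
    then have "\<gamma> 0 s \<doteq> under \<eta> (\<gamma> 0 s) x"
      using x(3) s by simp
    from under_cong_flip[OF this] have "x \<doteq> \<gamma> 0 s"
      using cong_sym by simp
    then show ?thesis
      using cong_under[of "\<gamma> 0 s" x x x \<eta>] cong_sym by simp
  qed
  have "\<gamma> 0 v \<doteq> x" if "\<bar>v\<bar> < 1" "v \<noteq> - s" for v
    using x(2,3)[OF that(1)] that(2) cong_trans[OF _ un] by (cases v "- s" rule: linorder_cases) auto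
  then show thesis
    using that x(1) by blast
qed

text \<open>All colours of the strand agree, so the kink contributes a multiple of
  \<open>a - x\<close> with \<open>a \<doteq> x\<close>. This is how the correction term of the
  longitude compensates for the writhe of the kink.\<close>

lemma first_move_extend:
  assumes \<gamma>: "strand_colouring 1 {} \<gamma>" and s: "s \<noteq> 0" "\<bar>s\<bar> < 3/4" and X: "X = {((0, s), (0, - s), \<eta>)}"
  shows "strand_colouring 1 X \<gamma>" "strand_lonsum X \<gamma> 0 \<doteq> strand_lonsum {} \<gamma> 0"
proof -
  have lc: "loc_const (\<gamma> 0) v" if "\<bar>v\<bar> < 1" for v
    using strand_loc_const[OF \<gamma>] that by simp
  have c: "\<gamma> 0 v \<doteq> \<gamma> 0 w" if "\<bar>v\<bar> < 1" "\<bar>w\<bar> < 1" for v w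
    by (rule no_under[OF \<gamma>]) (use that in auto)
  have un: "\<gamma> 0 (- s) \<doteq> under \<eta> (\<gamma> 0 s) (\<gamma> 0 (- s))"
    using cong_under[OF c[of "- s" s] cong_refl, of \<eta> "\<gamma> 0 (- s)"] s by simp
  have sd: "sides (\<gamma> 0) (- s) (\<gamma> 0 (- s)) (under \<eta> (\<gamma> 0 s) (\<gamma> 0 (- s)))"
    by (rule sides_cong[OF lc]) (use s un in auto)
  show "strand_colouring 1 X \<gamma>"
    by (rule strand_colouringI) (use lc sd in \<open>auto simp: X\<close>)
  have "strand_lonsum X \<gamma> 0 \<doteq> kap \<eta> *\<^sub>L (\<gamma> 0 s - \<gamma> 0 s)"
    by (rule strand_lonsum_one) (use X cong_trans[OF left_colour[OF sd] c[of "- s" s]] s in auto)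
  then show "strand_lonsum X \<gamma> 0 \<doteq> strand_lonsum {} \<gamma> 0"
    by (simp add: strand_lonsum_no_under)
qed

lemma first_move_collapse:
  assumes \<gamma>: "strand_colouring 1 X \<gamma>" and s: "s \<noteq> 0" "\<bar>s\<bar> < 3/4" and X: "X = {((0, s), (0, - s), \<eta>)}"
  shows "\<exists>\<gamma>'. strand_colouring 1 {} \<gamma>' \<and> (\<forall>l<1. \<forall>v. 3/4 \<le> \<bar>v\<bar> \<longrightarrow> \<bar>v\<bar> < 1 \<longrightarrow> \<gamma>' l v \<doteq> \<gamma> l v) \<and>
    (\<forall>l<1. strand_lonsum {} \<gamma>' l \<doteq> strand_lonsum X \<gamma> l)"
proof -
  obtain x where x: "\<And>v. \<bar>v\<bar> < 1 \<Longrightarrow> v \<noteq> - s \<Longrightarrow> \<gamma> 0 v \<doteq> x" "left_colour (\<gamma> 0) (- s) \<doteq> x"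
    using first_move_const[OF \<gamma>[unfolded X] s] by blast
  have "strand_colouring 1 {} (\<lambda>_ _. x)"
    by (rule strand_colouringI) (auto intro: sides_const[of 1])
  moreover have "strand_lonsum {} (\<lambda>_ _. x) 0 \<doteq> strand_lonsum X \<gamma> 0"
  proof -
    have "\<gamma> 0 s - x \<doteq> x - x"
      by (rule cong_diff[OF x(1) cong_refl]) (use s in auto)
    then have "kap \<eta> *\<^sub>L (\<gamma> 0 s - x) \<doteq> kap \<eta> *\<^sub>L (x - x)"
      by (rule cong_scale)
    moreover have "strand_lonsum X \<gamma> 0 \<doteq> kap \<eta> *\<^sub>L (\<gamma> 0 s - x)"
      by (rule strand_lonsum_one) (use X x(2) in auto)
    ultimately have "strand_lonsum X \<gamma> 0 \<doteq> kap \<eta> *\<^sub>L (x - x)"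
      using cong_trans by blast
    then show ?thesis
      by (simp add: strand_lonsum_no_under cong_sym)
  qed
  moreover have "x \<doteq> \<gamma> 0 v" if "3/4 \<le> \<bar>v\<bar>" "\<bar>v\<bar> < 1" for v
    by (rule cong_sym, rule x(1)) (use that s in auto)
  ultimately show ?thesis
    by (intro exI[of _ "\<lambda>_ _. x"]) simp
qed

text \<open>The parameter 7/8, here and below, stands for any point of the collar between 3/4 and
  1.\<close>

lemma first_move_generate:
  assumes \<gamma>: "strand_colouring 1 {((0, s), (0, - s), \<eta>)} \<gamma>" and s: "s \<noteq> 0" "\<bar>s\<bar> < 3/4"
    and Z: "lmod.subspace Z" "K \<subseteq> Z" and ends: "\<gamma> 0 (7/8) \<in> Z" and v: "\<bar>v\<bar> < 1" "v \<noteq> - s"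
  shows "\<gamma> 0 v \<in> Z"
proof -
  obtain x where x: "\<And>v. \<bar>v\<bar> < 1 \<Longrightarrow> v \<noteq> - s \<Longrightarrow> \<gamma> 0 v \<doteq> x"
    by (rule first_move_const[OF \<gamma> s]) (rule that, assumption)
  have "\<gamma> 0 v \<doteq> \<gamma> 0 (7/8)"
    by (rule cong_trans_sym[OF x x]) (use s v in auto)
  then show ?thesis
    using in_Z[OF _ Z] ends by simp
qed

lemma no_crossings_generate:
  assumes \<gamma>: "strand_colouring n {} \<gamma>" and l: "l < n"
    and Z: "lmod.subspace Z" "K \<subseteq> Z" and ends: "\<gamma> l (7/8) \<in> Z" and v: "\<bar>v\<bar> < 1"
  shows "\<gamma> l v \<in> Z"
proof -
  have "\<gamma> l v \<doteq> \<gamma> l (7/8)"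
    by (rule no_under[OF \<gamma> l]) (use v in auto)
  then show ?thesis
    using in_Z[OF _ Z] ends by simp
qed

end

lemma strands_generate_none: "strands_generate n {}"
  unfolding strands_generate_def
proof (intro allI impI)
  fix K Z :: "(arc \<Rightarrow> laurent) set" and \<gamma> :: "nat \<Rightarrow> real \<Rightarrow> arc \<Rightarrow> laurent" and l and v :: real
  assume *: "lmod.subspace K" "congruence.strand_colouring K n {} \<gamma>" "lmod.subspace Z" "K \<subseteq> Z"
    "\<forall>l<n. \<forall>v. 3/4 < \<bar>v\<bar> \<longrightarrow> \<bar>v\<bar> < 1 \<longrightarrow> \<gamma> l v \<in> Z" "l < n" "\<bar>v\<bar> < 1"
  show "\<gamma> l v \<in> Z"
    by (rule congruence.no_crossings_generate[OF congruence.intro[OF *(1)] *(2,6,3,4) _ *(7)]) (use *(5,6) in simp)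
qed

text \<open>The sign of \<open>s\<close> is left open: it tells which passage of the kink is on
  top.\<close>

lemma strands_first_move:
  fixes X :: "strand_crossing set" and s :: real
  assumes X: "X = {((0, s), (0, - s), \<eta>)}" and s: "s \<noteq> 0" "\<bar>s\<bar> < 3/4"
  shows "strands_extend 1 X {}" "strands_extend 1 {} X" "strands_generate 1 X"
proof -
  show "strands_extend 1 X {}"
    unfolding strands_extend_def
  proof (intro allI impI)
    fix K :: "(arc \<Rightarrow> laurent) set" and \<gamma>
    assume *: "lmod.subspace K" "congruence.strand_colouring K 1 {} \<gamma>"
    interpret congruence K by standard (rule *)
    show "\<exists>\<gamma>'. strand_colouring 1 X \<gamma>' \<and> (\<forall>l<1. \<forall>v. 3/4 \<le> \<bar>v\<bar> \<longrightarrow> \<bar>v\<bar> < 1 \<longrightarrow> cong (\<gamma>' l v) (\<gamma> l v)) \<and>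
        (\<forall>l<1. cong (strand_lonsum X \<gamma>' l) (strand_lonsum {} \<gamma> l))"
      using first_move_extend[OF *(2) s X] by (intro exI[of _ \<gamma>]) simp
  qed
  show "strands_extend 1 {} X"
    unfolding strands_extend_def
  proof (intro allI impI)
    fix K :: "(arc \<Rightarrow> laurent) set" and \<gamma>
    assume *: "lmod.subspace K" "congruence.strand_colouring K 1 X \<gamma>"
    interpret congruence K by standard (rule *)
    show "\<exists>\<gamma>'. strand_colouring 1 {} \<gamma>' \<and> (\<forall>l<1. \<forall>v. 3/4 \<le> \<bar>v\<bar> \<longrightarrow> \<bar>v\<bar> < 1 \<longrightarrow> cong (\<gamma>' l v) (\<gamma> l v)) \<and>
        (\<forall>l<1. cong (strand_lonsum {} \<gamma>' l) (strand_lonsum X \<gamma> l))"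
      by (rule first_move_collapse[OF *(2) s X])
  qed
  show "strands_generate 1 X"
    unfolding strands_generate_def
  proof (intro allI impI)
    fix K Z :: "(arc \<Rightarrow> laurent) set" and \<gamma> :: "nat \<Rightarrow> real \<Rightarrow> arc \<Rightarrow> laurent" and l and v :: real
    assume *: "lmod.subspace K" "congruence.strand_colouring K 1 X \<gamma>" "lmod.subspace Z" "K \<subseteq> Z"
      "\<forall>l<1. \<forall>v. 3/4 < \<bar>v\<bar> \<longrightarrow> \<bar>v\<bar> < 1 \<longrightarrow> \<gamma> l v \<in> Z" "l < 1" "\<bar>v\<bar> < 1" "\<forall>p \<eta>. (p, (l, v), \<eta>) \<notin> X"
    then have "\<gamma> 0 (7/8) \<in> Z" "l = 0"
      by simp_all
    moreover have "v \<noteq> - s"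
      using *(8)[rule_format, of "(0, s)" \<eta>] \<open>l = 0\<close> by (simp add: X)
    ultimately show "\<gamma> l v \<in> Z"
      using congruence.first_move_generate[OF congruence.intro[OF *(1)] *(2)[unfolded X] s *(3,4)] *(7) by simp
  qed
qed

section \<open>Second move\<close>

context congruence
begin

lemma steps_in_Z: "x \<in> Z \<Longrightarrow> y \<in> Z \<Longrightarrow> z \<in> Z \<Longrightarrow> steps p q x y z v \<in> Z"
  by (simp add: steps_def)

text \<open>Only the segment of the lower strand \<open>b\<close> between its two crossings gets a
  new colour. The upper strand has one colour \<open>A\<close>, so the second crossing undoes the
  first and the ends of \<open>b\<close> keep their colour \<open>x\<close>.\<close>

lemma second_move_extend:
  assumes \<gamma>: "strand_colouring 2 {} \<gamma>" and ab: "a < 2" "b < 2" "a \<noteq> b"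
    and X: "X = {((a, - 1/2), (b, - 1/2), \<eta>), ((a, 1/2), (b, 1/2), \<not> \<eta>)}"
  shows "\<exists>\<gamma>'. strand_colouring 2 X \<gamma>' \<and> (\<forall>l<2. \<forall>v. 3/4 \<le> \<bar>v\<bar> \<longrightarrow> \<bar>v\<bar> < 1 \<longrightarrow> \<gamma>' l v \<doteq> \<gamma> l v) \<and>
    (\<forall>l<2. strand_lonsum X \<gamma>' l \<doteq> strand_lonsum {} \<gamma> l)"
proof -
  have c: "\<gamma> l v \<doteq> \<gamma> l 0" if "l < 2" "\<bar>v\<bar> < 1" for l v
    by (rule no_under[OF \<gamma> that(1)]) (use that in auto)
  define A where "A = \<gamma> a 0"
  define x where "x = \<gamma> b 0"
  let ?f = "steps (- 1/2) (1/2) x (under \<eta> A x) x"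
  define \<gamma>' where "\<gamma>' = (\<lambda>l. if l = b then ?f else \<gamma> l)"
  have cA: "\<gamma>' a (- 1/2) \<doteq> A" "\<gamma>' a (1/2) \<doteq> A"
    using c[OF ab(1), of "- 1/2"] c[OF ab(1), of "1/2"] ab(3) by (simp_all add: A_def \<gamma>'_def)
  have s1: "sides (\<gamma>' b) (- 1/2) x (under \<eta> (\<gamma>' a (- 1/2)) x)"
    using sides_cong[OF sides_steps(1)[of "- 1/2" "1/2" x "under \<eta> A x" x] cong_refl
        cong_under[OF cong_sym[OF cA(1)] cong_refl]] by (simp add: \<gamma>'_def)
  have "x \<doteq> under (\<not> \<eta>) (\<gamma>' a (1/2)) (under \<eta> A x)"
    using cong_under[OF cong_sym[OF cA(2)] cong_refl, of "\<not> \<eta>" "under \<eta> A x"] by simp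
  then have s2: "sides (\<gamma>' b) (1/2) (under \<eta> A x) (under (\<not> \<eta>) (\<gamma>' a (1/2)) (under \<eta> A x))"
    using sides_cong[OF sides_steps(2)[of "- 1/2" "1/2" x "under \<eta> A x" x] cong_refl] by (simp add: \<gamma>'_def)
  have "strand_colouring 2 X \<gamma>'"
  proof (rule strand_colouringI)
    fix l v assume l: "l < 2" "\<bar>v\<bar> < 1" and nX: "\<And>p \<eta>. (p, (l, v), \<eta>) \<notin> X"
    show "loc_const (\<gamma>' l) v"
    proof (cases "l = b")
      case True
      then have "v \<noteq> - 1/2" "v \<noteq> 1/2"
        using nX[of "(a, - 1/2)" \<eta>] nX[of "(a, 1/2)" "\<not> \<eta>"] by (auto simp: X)
      then show ?thesis
        using sides_steps(3)[of "- 1/2" "1/2" v] True by (simp add: \<gamma>'_def)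
    next
      case False
      then show ?thesis
        using strand_loc_const[OF \<gamma> l] by (simp add: \<gamma>'_def)
    qed
  next
    fix l v l' v' \<theta> assume "((l, v), (l', v'), \<theta>) \<in> X"
    then show "\<exists>B. sides (\<gamma>' l') v' B (under \<theta> (\<gamma>' l v) B)"
      unfolding X using s1 s2 by blast
  qed
  moreover have "\<gamma>' l v \<doteq> \<gamma> l v" if "l < 2" "3/4 \<le> \<bar>v\<bar>" "\<bar>v\<bar> < 1" for l v
  proof (cases "l = b")
    case True
    then have "\<gamma>' l v = x"
      using that by (auto simp: \<gamma>'_def steps_def)
    then show ?thesis
      using c[OF that(1,3)] cong_sym by (simp add: x_def True)
  qed (simp add: \<gamma>'_def)
  moreover have "strand_lonsum X \<gamma>' l \<doteq> strand_lonsum {} \<gamma> l" if "l < 2" for l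
  proof (cases "l = b")
    case True
    have "strand_lonsum X \<gamma>' b \<doteq>
        kap \<eta> *\<^sub>L (\<gamma>' a (- 1/2) - x) + kap (\<not> \<eta>) *\<^sub>L (\<gamma>' a (1/2) - under \<eta> A x)"
      by (rule strand_lonsum_two) (use left_colour[OF s1] left_colour[OF s2] in \<open>auto simp: X\<close>)
    also have "\<dots> \<doteq> kap \<eta> *\<^sub>L (A - x) + kap (\<not> \<eta>) *\<^sub>L (A - under \<eta> A x)"
      by (intro cong_add cong_scale cong_diff cA cong_refl)
    finally show ?thesis
      by (simp add: kap_under True strand_lonsum_no_under)
  next
    case False
    then show ?thesis
      by (simp add: strand_lonsum_no_under X)
  qed
  ultimately show ?thesis
    by blast
qed

lemma second_move_colours:
  assumes \<gamma>: "strand_colouring 2 X \<gamma>" and ab: "a < 2" "b < 2" "a \<noteq> b"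
    and X: "X = {((a, - 1/2), (b, - 1/2), \<eta>), ((a, 1/2), (b, 1/2), \<not> \<eta>)}"
  obtains x where "left_colour (\<gamma> b) (- 1/2) \<doteq> x" "left_colour (\<gamma> b) (1/2) \<doteq> under \<eta> (\<gamma> a 0) x"
    "\<And>v. \<bar>v\<bar> < 1 \<Longrightarrow> v \<noteq> - 1/2 \<Longrightarrow> v \<noteq> 1/2 \<Longrightarrow> \<gamma> b v \<doteq> steps (- 1/2) (1/2) x (under \<eta> (\<gamma> a 0) x) x v"
proof -
  have c: "\<gamma> a v \<doteq> \<gamma> a 0" if "\<bar>v\<bar> < 1" for v
    by (rule no_under[OF \<gamma> ab(1)]) (use that ab X in auto)
  obtain x y where x: "y = under \<eta> (\<gamma> a (- 1/2)) x" "left_colour (\<gamma> b) (- 1/2) \<doteq> x" "left_colour (\<gamma> b) (1/2) \<doteq> y"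
    "\<And>v. \<bar>v\<bar> < 1 \<Longrightarrow> v \<noteq> - 1/2 \<Longrightarrow> v \<noteq> 1/2 \<Longrightarrow> \<gamma> b v \<doteq> steps (- 1/2) (1/2) x y (under (\<not> \<eta>) (\<gamma> a (1/2)) y) v"
    by (rule two_unders[OF \<gamma> ab(2), of a "- 1/2" "- 1/2" \<eta> a "1/2" "1/2" "\<not> \<eta>"]) (auto simp: X)
  have y: "y \<doteq> under \<eta> (\<gamma> a 0) x"
    unfolding x(1) by (rule cong_under[OF c cong_refl]) simp
  have z: "under (\<not> \<eta>) (\<gamma> a (1/2)) y \<doteq> x"
    using cong_under[OF c[of "1/2"] y, of "\<not> \<eta>"] by simp
  show thesis
  proof (rule that[OF x(2) cong_trans[OF x(3) y]])
    fix v :: real assume "\<bar>v\<bar> < 1" "v \<noteq> - 1/2" "v \<noteq> 1/2"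
    from x(4)[OF this] show "\<gamma> b v \<doteq> steps (- 1/2) (1/2) x (under \<eta> (\<gamma> a 0) x) x v"
      using y z by (auto simp: steps_def intro: cong_trans)
  qed
qed

lemma second_move_collapse:
  assumes \<gamma>: "strand_colouring 2 X \<gamma>" and ab: "a < 2" "b < 2" "a \<noteq> b"
    and X: "X = {((a, - 1/2), (b, - 1/2), \<eta>), ((a, 1/2), (b, 1/2), \<not> \<eta>)}"
  shows "\<exists>\<gamma>'. strand_colouring 2 {} \<gamma>' \<and> (\<forall>l<2. \<forall>v. 3/4 \<le> \<bar>v\<bar> \<longrightarrow> \<bar>v\<bar> < 1 \<longrightarrow> \<gamma>' l v \<doteq> \<gamma> l v) \<and>
    (\<forall>l<2. strand_lonsum {} \<gamma>' l \<doteq> strand_lonsum X \<gamma> l)"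
proof -
  obtain x where x: "left_colour (\<gamma> b) (- 1/2) \<doteq> x" "left_colour (\<gamma> b) (1/2) \<doteq> under \<eta> (\<gamma> a 0) x"
    "\<And>v. \<bar>v\<bar> < 1 \<Longrightarrow> v \<noteq> - 1/2 \<Longrightarrow> v \<noteq> 1/2 \<Longrightarrow> \<gamma> b v \<doteq> steps (- 1/2) (1/2) x (under \<eta> (\<gamma> a 0) x) x v"
    by (rule second_move_colours[OF \<gamma> ab X]) (rule that, assumption+)
  have c: "\<gamma> a v \<doteq> \<gamma> a 0" if "\<bar>v\<bar> < 1" for v
    by (rule no_under[OF \<gamma> ab(1)]) (use that ab X in auto)
  define \<gamma>' where "\<gamma>' = (\<lambda>l (v :: real). if l = b then x else \<gamma> a 0)"
  have "strand_colouring 2 {} \<gamma>'"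
    by (rule strand_colouringI) (auto simp: \<gamma>'_def intro: sides_const[of 1])
  moreover have "\<gamma>' l v \<doteq> \<gamma> l v" if l: "l < 2" and v: "3/4 \<le> \<bar>v\<bar>" "\<bar>v\<bar> < 1" for l v
  proof (cases "l = b")
    case True
    have "steps (- 1/2) (1/2) x (under \<eta> (\<gamma> a 0) x) x v = x"
      using v by (auto simp: steps_def)
    then have "\<gamma> b v \<doteq> x"
      using x(3)[of v] v by force
    then show ?thesis
      by (simp add: \<gamma>'_def True cong_sym)
  next
    case False
    then have "l = a"
      using l ab by linarith
    then show ?thesis
      using c[OF v(2)] False by (simp add: \<gamma>'_def cong_sym)
  qed
  moreover have "strand_lonsum {} \<gamma>' l \<doteq> strand_lonsum X \<gamma> l" if "l < 2" for l
  proof (cases "l = b")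
    case True
    have "strand_lonsum X \<gamma> b \<doteq>
        kap \<eta> *\<^sub>L (\<gamma> a (- 1/2) - x) + kap (\<not> \<eta>) *\<^sub>L (\<gamma> a (1/2) - under \<eta> (\<gamma> a 0) x)"
      by (rule strand_lonsum_two) (use x(1,2) in \<open>auto simp: X\<close>)
    also have "\<dots> \<doteq> kap \<eta> *\<^sub>L (\<gamma> a 0 - x) + kap (\<not> \<eta>) *\<^sub>L (\<gamma> a 0 - under \<eta> (\<gamma> a 0) x)"
      by (intro cong_add cong_scale cong_diff c cong_refl) simp_all
    finally show ?thesis
      by (simp add: kap_under True strand_lonsum_no_under cong_sym)
  next
    case False
    then show ?thesis
      by (simp add: strand_lonsum_no_under X)
  qed
  ultimately show ?thesis
    by blast
qed

text \<open>The colour of the middle segment of the lower strand is no longer visible at the ends,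
  but it is \<open>under \<eta> (\<gamma> a 0) x\<close>, a combination of two end colours.\<close>

lemma second_move_generate:
  assumes \<gamma>: "strand_colouring 2 X \<gamma>" and ab: "a < 2" "b < 2" "a \<noteq> b"
    and X: "X = {((a, - 1/2), (b, - 1/2), \<eta>), ((a, 1/2), (b, 1/2), \<not> \<eta>)}"
    and Z: "lmod.subspace Z" "K \<subseteq> Z" and ends: "\<And>l v. l < 2 \<Longrightarrow> 3/4 < \<bar>v\<bar> \<Longrightarrow> \<bar>v\<bar> < 1 \<Longrightarrow> \<gamma> l v \<in> Z"
    and v: "l < 2" "\<bar>v\<bar> < 1" "\<And>p \<eta>. (p, (l, v), \<eta>) \<notin> X"
  shows "\<gamma> l v \<in> Z"
proof -
  obtain x where x: "\<And>v. \<bar>v\<bar> < 1 \<Longrightarrow> v \<noteq> - 1/2 \<Longrightarrow> v \<noteq> 1/2 \<Longrightarrow> \<gamma> b v \<doteq> steps (- 1/2) (1/2) x (under \<eta> (\<gamma> a 0) x) x v"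
    by (rule second_move_colours[OF \<gamma> ab X]) (rule that, assumption)
  have a: "\<gamma> a v \<in> Z" if "\<bar>v\<bar> < 1" for v
  proof -
    have "\<gamma> a v \<doteq> \<gamma> a (7/8)"
      by (rule no_under[OF \<gamma> ab(1)]) (use that ab X in auto)
    then show ?thesis
      using in_Z[OF _ Z] ends[OF ab(1), of "7/8"] by simp
  qed
  have "\<gamma> b (7/8) \<doteq> x"
    using x[of "7/8"] by (simp add: steps_def)
  then have xZ: "x \<in> Z"
    using in_Z[OF cong_sym Z] ends[OF ab(2), of "7/8"] by simp
  have b: "\<gamma> b v \<in> Z" if "\<bar>v\<bar> < 1" "v \<noteq> - 1/2" "v \<noteq> 1/2" for v
    by (rule in_Z[OF x[OF that] Z]) (intro steps_in_Z under_in_Z Z xZ a, simp)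
  show ?thesis
  proof (cases "l = b")
    case True
    then have "v \<noteq> - 1/2" "v \<noteq> 1/2"
      using v(3)[of "(a, - 1/2)" \<eta>] v(3)[of "(a, 1/2)" "\<not> \<eta>"] by (auto simp: X)
    then show ?thesis
      using b v True by simp
  next
    case False
    then have "l = a"
      using v(1) ab by linarith
    then show ?thesis
      using a v by simp
  qed
qed

end

lemma strands_second_move:
  fixes X :: "strand_crossing set"
  assumes ab: "a < 2" "b < 2" "a \<noteq> b"
    and X: "X = {((a, - 1/2), (b, - 1/2), \<eta>), ((a, 1/2), (b, 1/2), \<not> \<eta>)}"
  shows "strands_extend 2 X {}" "strands_extend 2 {} X" "strands_generate 2 X"
proof -
  show "strands_extend 2 X {}"
    unfolding strands_extend_def
  proof (intro allI impI)
    fix K :: "(arc \<Rightarrow> laurent) set" and \<gamma>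
    assume *: "lmod.subspace K" "congruence.strand_colouring K 2 {} \<gamma>"
    show "\<exists>\<gamma>'. congruence.strand_colouring K 2 X \<gamma>' \<and>
        (\<forall>l<2. \<forall>v. 3/4 \<le> \<bar>v\<bar> \<longrightarrow> \<bar>v\<bar> < 1 \<longrightarrow> congruence.cong K (\<gamma>' l v) (\<gamma> l v)) \<and>
        (\<forall>l<2. congruence.cong K (congruence.strand_lonsum K X \<gamma>' l) (congruence.strand_lonsum K {} \<gamma> l))"
      by (rule congruence.second_move_extend[OF congruence.intro[OF *(1)] *(2) ab X])
  qed
  show "strands_extend 2 {} X"
    unfolding strands_extend_def
  proof (intro allI impI)
    fix K :: "(arc \<Rightarrow> laurent) set" and \<gamma>
    assume *: "lmod.subspace K" "congruence.strand_colouring K 2 X \<gamma>"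
    show "\<exists>\<gamma>'. congruence.strand_colouring K 2 {} \<gamma>' \<and>
        (\<forall>l<2. \<forall>v. 3/4 \<le> \<bar>v\<bar> \<longrightarrow> \<bar>v\<bar> < 1 \<longrightarrow> congruence.cong K (\<gamma>' l v) (\<gamma> l v)) \<and>
        (\<forall>l<2. congruence.cong K (congruence.strand_lonsum K {} \<gamma>' l) (congruence.strand_lonsum K X \<gamma> l))"
      by (rule congruence.second_move_collapse[OF congruence.intro[OF *(1)] *(2) ab X])
  qed
  show "strands_generate 2 X"
    unfolding strands_generate_def
  proof (intro allI impI)
    fix K Z :: "(arc \<Rightarrow> laurent) set" and \<gamma> :: "nat \<Rightarrow> real \<Rightarrow> arc \<Rightarrow> laurent" and l and v :: real
    assume *: "lmod.subspace K" "congruence.strand_colouring K 2 X \<gamma>" "lmod.subspace Z" "K \<subseteq> Z"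
      "\<forall>l<2. \<forall>v. 3/4 < \<bar>v\<bar> \<longrightarrow> \<bar>v\<bar> < 1 \<longrightarrow> \<gamma> l v \<in> Z" "l < 2" "\<bar>v\<bar> < 1" "\<forall>p \<eta>. (p, (l, v), \<eta>) \<notin> X"
    show "\<gamma> l v \<in> Z"
      by (rule congruence.second_move_generate[OF congruence.intro[OF *(1)] *(2) ab X *(3,4) _ *(6,7)]) (use *(5,8) in blast)+
  qed
qed


subsection \<open>Third move\<close>

text \<open>
  The strand \<open>\<tau>\<close> is on top, \<open>\<mu>\<close> in the middle and \<open>\<beta>\<close> at the bottom. Two strands meet at the same
  parameter of both.
\<close>

definition triangle :: "nat \<Rightarrow> nat \<Rightarrow> nat \<Rightarrow> bool \<Rightarrow> bool \<Rightarrow> bool \<Rightarrow> real \<Rightarrow> real \<Rightarrow> real \<Rightarrow> strand_crossing set" where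
  "triangle \<tau> \<mu> \<beta> \<eta>1 \<eta>2 \<eta>3 p1 p2 p3 =
    {((\<tau>, p1), (\<mu>, p1), \<eta>1), ((\<tau>, p2), (\<beta>, p2), \<eta>2), ((\<mu>, p3), (\<beta>, p3), \<eta>3)}"

text \<open>The order of \<open>p1\<close> and \<open>p3\<close> decides which part of the middle
  strand passes over the bottom one; the order of \<open>p2\<close> and \<open>p3\<close> is that of
  the undercrossings of the bottom strand.\<close>

locale triangle_strands =
  fixes \<tau> \<mu> \<beta> :: nat and \<eta>1 \<eta>2 \<eta>3 :: bool and p1 p2 p3 :: real
  assumes strands: "\<tau> < 3" "\<mu> < 3" "\<beta> < 3" "\<tau> \<noteq> \<mu>" "\<tau> \<noteq> \<beta>" "\<mu> \<noteq> \<beta>"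
    and params: "\<bar>p1\<bar> < 3/4" "\<bar>p2\<bar> < 3/4" "\<bar>p3\<bar> < 3/4" "p1 \<noteq> p3" "p2 \<noteq> p3"
begin

abbreviation X :: "strand_crossing set" where
  "X \<equiv> triangle \<tau> \<mu> \<beta> \<eta>1 \<eta>2 \<eta>3 p1 p2 p3"

lemma strand_cases: "l < 3 \<Longrightarrow> l = \<tau> \<or> l = \<mu> \<or> l = \<beta>"
  using strands by linarith

lemma triangle_mem: "((\<tau>, p1), (\<mu>, p1), \<eta>1) \<in> X" "((\<tau>, p2), (\<beta>, p2), \<eta>2) \<in> X" "((\<mu>, p3), (\<beta>, p3), \<eta>3) \<in> X"
  unfolding triangle_def by simp_all

lemma no_crossing_cases:
  assumes "l < 3" "\<And>p \<eta>. (p, (l, v), \<eta>) \<notin> X"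
  obtains "l = \<tau>" | "l = \<mu>" "v \<noteq> p1" | "l = \<beta>" "v \<noteq> p2" "v \<noteq> p3"
proof -
  have "l = \<mu> \<Longrightarrow> v \<noteq> p1" "l = \<beta> \<Longrightarrow> v \<noteq> p2" "l = \<beta> \<Longrightarrow> v \<noteq> p3"
    using assms(2) triangle_mem by metis+
  then show thesis
    using that strand_cases[OF assms(1)] by argo
qed

end

locale coloured_triangle = triangle_strands \<tau> \<mu> \<beta> \<eta>1 \<eta>2 \<eta>3 p1 p2 p3 + congruence K
  for \<tau> \<mu> \<beta> \<eta>1 \<eta>2 \<eta>3 p1 p2 p3 and K :: "('a \<Rightarrow> laurent) set"
begin

text \<open>The second breakpoint 1 lies beyond the open strand, so there is only the jump at
  \<open>p1\<close>.\<close>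

definition mid :: "('a \<Rightarrow> laurent) \<Rightarrow> ('a \<Rightarrow> laurent) \<Rightarrow> real \<Rightarrow> 'a \<Rightarrow> laurent" where
  "mid a y = steps p1 1 y (under \<eta>1 a y) (under \<eta>1 a y)"

text \<open>Here \<open>a\<close> is the colour of the top strand, \<open>b\<close> the colour of
  the middle strand where it passes over the bottom one, and \<open>x\<close> the initial colour of
  the bottom strand.\<close>

definition bot :: "('a \<Rightarrow> laurent) \<Rightarrow> ('a \<Rightarrow> laurent) \<Rightarrow> ('a \<Rightarrow> laurent) \<Rightarrow> real \<Rightarrow> 'a \<Rightarrow> laurent" where
  "bot a b x = (if p2 < p3 then steps p2 p3 x (under \<eta>2 a x) (under \<eta>3 b (under \<eta>2 a x))
    else steps p3 p2 x (under \<eta>3 b x) (under \<eta>2 a (under \<eta>3 b x)))"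

definition bot_lon :: "('a \<Rightarrow> laurent) \<Rightarrow> ('a \<Rightarrow> laurent) \<Rightarrow> ('a \<Rightarrow> laurent) \<Rightarrow> 'a \<Rightarrow> laurent" where
  "bot_lon a b x = (if p2 < p3 then kap \<eta>2 *\<^sub>L (a - x) + kap \<eta>3 *\<^sub>L (b - under \<eta>2 a x)
    else kap \<eta>3 *\<^sub>L (b - x) + kap \<eta>2 *\<^sub>L (a - under \<eta>3 b x))"

lemma bot_cong: "a \<doteq> a' \<Longrightarrow> b \<doteq> b' \<Longrightarrow> bot a b x v \<doteq> bot a' b' x v"
  by (simp add: bot_def steps_def cong_under)

lemma bot_lon_cong: "a \<doteq> a' \<Longrightarrow> b \<doteq> b' \<Longrightarrow> bot_lon a b x \<doteq> bot_lon a' b' x"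
  by (simp add: bot_lon_def cong_under cong_add cong_scale cong_diff)

text \<open>Three initial colours serve as coordinates: \<open>a\<close>, \<open>y\<close> and
  \<open>x\<close> for the top, middle and bottom strand determine the colouring and its longitude
  contributions up to congruence.\<close>

definition described_by :: "(nat \<Rightarrow> real \<Rightarrow> 'a \<Rightarrow> laurent) \<Rightarrow> ('a \<Rightarrow> laurent) \<Rightarrow> ('a \<Rightarrow> laurent) \<Rightarrow> ('a \<Rightarrow> laurent) \<Rightarrow> bool" where
  "described_by \<gamma> a x y \<longleftrightarrow> (\<forall>v. \<bar>v\<bar> < 1 \<longrightarrow> \<gamma> \<tau> v \<doteq> a) \<and>
    (\<forall>v. \<bar>v\<bar> < 1 \<longrightarrow> v \<noteq> p1 \<longrightarrow> \<gamma> \<mu> v \<doteq> mid a y v) \<and>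
    (\<forall>v. \<bar>v\<bar> < 1 \<longrightarrow> v \<noteq> p2 \<longrightarrow> v \<noteq> p3 \<longrightarrow> \<gamma> \<beta> v \<doteq> bot a (mid a y p3) x v) \<and>
    strand_lonsum X \<gamma> \<mu> \<doteq> kap \<eta>1 *\<^sub>L (a - y) \<and>
    strand_lonsum X \<gamma> \<beta> \<doteq> bot_lon a (mid a y p3) x"

lemma described_byD:
  assumes "described_by \<gamma> a x y"
  shows "\<And>v. \<bar>v\<bar> < 1 \<Longrightarrow> \<gamma> \<tau> v \<doteq> a"
    "\<And>v. \<bar>v\<bar> < 1 \<Longrightarrow> v \<noteq> p1 \<Longrightarrow> \<gamma> \<mu> v \<doteq> mid a y v"
    "\<And>v. \<bar>v\<bar> < 1 \<Longrightarrow> v \<noteq> p2 \<Longrightarrow> v \<noteq> p3 \<Longrightarrow> \<gamma> \<beta> v \<doteq> bot a (mid a y p3) x v"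
    "strand_lonsum X \<gamma> \<mu> \<doteq> kap \<eta>1 *\<^sub>L (a - y)"
    "strand_lonsum X \<gamma> \<beta> \<doteq> bot_lon a (mid a y p3) x"
  using assms unfolding described_by_def by simp_all

lemma triangle_colours:
  assumes \<gamma>: "strand_colouring 3 X \<gamma>"
  shows "\<exists>a x y. described_by \<gamma> a x y"
proof -
  define a where "a = \<gamma> \<tau> 0"
  have t: "\<gamma> \<tau> v \<doteq> a" if "\<bar>v\<bar> < 1" for v
    unfolding a_def by (rule no_under[OF \<gamma> strands(1)]) (use that strands in \<open>auto simp: triangle_def\<close>)
  have p: "\<bar>p1\<bar> < 1" "\<bar>p2\<bar> < 1" "\<bar>p3\<bar> < 1"
    using params by auto
  obtain y where y: "left_colour (\<gamma> \<mu>) p1 \<doteq> y" "\<And>v. \<bar>v\<bar> < 1 \<Longrightarrow> v < p1 \<Longrightarrow> \<gamma> \<mu> v \<doteq> y"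
    "\<And>v. \<bar>v\<bar> < 1 \<Longrightarrow> p1 < v \<Longrightarrow> \<gamma> \<mu> v \<doteq> under \<eta>1 (\<gamma> \<tau> p1) y"
    by (rule one_under[OF \<gamma> strands(2), of \<tau> p1 p1 \<eta>1]) (use p strands in \<open>auto simp: triangle_def\<close>)
  have m: "\<gamma> \<mu> v \<doteq> mid a y v" if "\<bar>v\<bar> < 1" "v \<noteq> p1" for v
    using y(2)[OF that(1)] y(3)[OF that(1)] that cong_trans[OF _ cong_under[OF t[OF p(1)] cong_refl]]
    by (cases v p1 rule: linorder_cases) (auto simp: mid_def steps_def)
  define b where "b = mid a y p3"
  have b: "\<gamma> \<mu> p3 \<doteq> b"
    unfolding b_def using m[OF p(3)] params by simp
  have "\<exists>x. (\<forall>v. \<bar>v\<bar> < 1 \<longrightarrow> v \<noteq> p2 \<longrightarrow> v \<noteq> p3 \<longrightarrow> \<gamma> \<beta> v \<doteq> bot (\<gamma> \<tau> p2) (\<gamma> \<mu> p3) x v) \<and>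
      strand_lonsum X \<gamma> \<beta> \<doteq> bot_lon (\<gamma> \<tau> p2) (\<gamma> \<mu> p3) x"
  proof (cases "p2 < p3")
    case True
    obtain x z where x: "z = under \<eta>2 (\<gamma> \<tau> p2) x" "left_colour (\<gamma> \<beta>) p2 \<doteq> x" "left_colour (\<gamma> \<beta>) p3 \<doteq> z"
      "\<And>v. \<bar>v\<bar> < 1 \<Longrightarrow> v \<noteq> p2 \<Longrightarrow> v \<noteq> p3 \<Longrightarrow> \<gamma> \<beta> v \<doteq> steps p2 p3 x z (under \<eta>3 (\<gamma> \<mu> p3) z) v"
      by (rule two_unders[OF \<gamma> strands(3), of \<tau> p2 p2 \<eta>2 \<mu> p3 p3 \<eta>3]) (use p True strands in \<open>auto simp: triangle_def\<close>)
    have "strand_lonsum X \<gamma> \<beta> \<doteq> kap \<eta>2 *\<^sub>L (\<gamma> \<tau> p2 - x) + kap \<eta>3 *\<^sub>L (\<gamma> \<mu> p3 - z)"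
      by (rule strand_lonsum_two) (use strands params(5) x(2,3) in \<open>auto simp: triangle_def\<close>)
    then show ?thesis
      using x(4) True by (intro exI[of _ x]) (simp add: bot_def bot_lon_def x(1))
  next
    case False
    then have lt: "p3 < p2"
      using params by simp
    obtain x z where x: "z = under \<eta>3 (\<gamma> \<mu> p3) x" "left_colour (\<gamma> \<beta>) p3 \<doteq> x" "left_colour (\<gamma> \<beta>) p2 \<doteq> z"
      "\<And>v. \<bar>v\<bar> < 1 \<Longrightarrow> v \<noteq> p3 \<Longrightarrow> v \<noteq> p2 \<Longrightarrow> \<gamma> \<beta> v \<doteq> steps p3 p2 x z (under \<eta>2 (\<gamma> \<tau> p2) z) v"
      by (rule two_unders[OF \<gamma> strands(3), of \<mu> p3 p3 \<eta>3 \<tau> p2 p2 \<eta>2]) (use p lt strands in \<open>auto simp: triangle_def\<close>)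
    have "strand_lonsum X \<gamma> \<beta> \<doteq> kap \<eta>3 *\<^sub>L (\<gamma> \<mu> p3 - x) + kap \<eta>2 *\<^sub>L (\<gamma> \<tau> p2 - z)"
      by (rule strand_lonsum_two) (use strands params(5) x(2,3) in \<open>auto simp: triangle_def\<close>)
    then show ?thesis
      using x(4) False by (intro exI[of _ x]) (simp add: bot_def bot_lon_def x(1))
  qed
  then obtain x where x: "\<And>v. \<bar>v\<bar> < 1 \<Longrightarrow> v \<noteq> p2 \<Longrightarrow> v \<noteq> p3 \<Longrightarrow> \<gamma> \<beta> v \<doteq> bot (\<gamma> \<tau> p2) (\<gamma> \<mu> p3) x v"
    "strand_lonsum X \<gamma> \<beta> \<doteq> bot_lon (\<gamma> \<tau> p2) (\<gamma> \<mu> p3) x"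
    by blast
  have "strand_lonsum X \<gamma> \<mu> \<doteq> kap \<eta>1 *\<^sub>L (\<gamma> \<tau> p1 - y)"
    by (rule strand_lonsum_one) (use strands y(1) in \<open>auto simp: triangle_def\<close>)
  also have "\<dots> \<doteq> kap \<eta>1 *\<^sub>L (a - y)"
    by (intro cong_scale cong_diff t p cong_refl)
  finally have lm: "strand_lonsum X \<gamma> \<mu> \<doteq> kap \<eta>1 *\<^sub>L (a - y)" .
  have bt: "\<gamma> \<beta> v \<doteq> bot a b x v" if "\<bar>v\<bar> < 1" "v \<noteq> p2" "v \<noteq> p3" for v
    by (rule cong_trans[OF x(1)[OF that] bot_cong[OF t[OF p(2)] b]])
  have lb: "strand_lonsum X \<gamma> \<beta> \<doteq> bot_lon a b x"
    by (rule cong_trans[OF x(2) bot_lon_cong[OF t[OF p(2)] b]])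
  have "described_by \<gamma> a x y"
    unfolding described_by_def b_def[symmetric] using t m bt lm lb by blast
  then show ?thesis
    by blast
qed

text \<open>The converse of \<open>triangle_colours\<close>: the coordinates can be prescribed. The
  top strand keeps a given colouring \<open>f\<close> instead of the constant \<open>a\<close>, so
  that nothing changes along it.\<close>

lemma triangle_build:
  fixes x y :: "'a \<Rightarrow> laurent"
  assumes t: "\<And>v. \<bar>v\<bar> < 1 \<Longrightarrow> loc_const f v" "\<And>v. \<bar>v\<bar> < 1 \<Longrightarrow> f v \<doteq> a"
  defines "b \<equiv> mid a y p3"
  defines "\<gamma> \<equiv> \<lambda>l. if l = \<tau> then f else if l = \<mu> then mid a y else bot a b x"
  shows "strand_colouring 3 X \<gamma>" "strand_lonsum X \<gamma> \<tau> = 0" "strand_lonsum X \<gamma> \<mu> \<doteq> kap \<eta>1 *\<^sub>L (a - y)"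
    "strand_lonsum X \<gamma> \<beta> \<doteq> bot_lon a b x"
proof -
  have p: "\<bar>p1\<bar> < 1" "\<bar>p2\<bar> < 1" "\<bar>p3\<bar> < 1"
    using params by auto
  have \<gamma>: "\<gamma> \<tau> = f" "\<gamma> \<mu> = mid a y" "\<gamma> \<beta> = bot a b x"
    using strands by (auto simp: \<gamma>_def)
  have un: "under \<theta> a z \<doteq> under \<theta> (\<gamma> \<tau> v) z" if "\<bar>v\<bar> < 1" for \<theta> z v
    unfolding \<gamma> by (rule cong_under[OF cong_sym[OF t(2)[OF that]] cong_refl])
  have gb: "\<gamma> \<mu> p3 = b"
    by (simp add: \<gamma> b_def)
  have s1: "sides (\<gamma> \<mu>) p1 y (under \<eta>1 (\<gamma> \<tau> p1) y)"
    using sides_cong[OF sides_steps(1)[of p1 1 y "under \<eta>1 a y" "under \<eta>1 a y"] cong_refl un[OF p(1)]] p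
    unfolding \<gamma>(2) mid_def by simp
  have lm: "loc_const (\<gamma> \<mu>) v" if "\<bar>v\<bar> < 1" "v \<noteq> p1" for v
    unfolding \<gamma>(2) mid_def by (rule sides_steps(3)) (use that p in auto)
  have bot1: "bot a b x = steps p2 p3 x (under \<eta>2 a x) (under \<eta>3 b (under \<eta>2 a x))" if "p2 < p3"
    using that by (simp add: bot_def)
  have bot2: "bot a b x = steps p3 p2 x (under \<eta>3 b x) (under \<eta>2 a (under \<eta>3 b x))" "p3 < p2" if "\<not> p2 < p3"
    using that params(5) by (simp_all add: bot_def)
  have lb: "loc_const (\<gamma> \<beta>) v" if "v \<noteq> p2" "v \<noteq> p3" for v
  proof (cases "p2 < p3")
    case True
    show ?thesis
      unfolding \<gamma>(3) bot1[OF True] by (rule sides_steps(3)[OF True that])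
  next
    case False
    show ?thesis
      unfolding \<gamma>(3) bot2(1)[OF False] by (rule sides_steps(3)[OF bot2(2)[OF False] that(2,1)])
  qed
  define x2 where "x2 = (if p2 < p3 then x else under \<eta>3 b x)"
  define x3 where "x3 = (if p2 < p3 then under \<eta>2 a x else x)"
  have s2: "sides (\<gamma> \<beta>) p2 x2 (under \<eta>2 (\<gamma> \<tau> p2) x2)"
  proof (rule sides_cong[OF _ cong_refl un[OF p(2)]])
    show "sides (\<gamma> \<beta>) p2 x2 (under \<eta>2 a x2)"
    proof (cases "p2 < p3")
      case True
      then have "x2 = x"
        by (simp add: x2_def)
      then show ?thesis
        unfolding \<gamma>(3) bot1[OF True] by (simp add: sides_steps(1)[OF True])
    next
      case False
      then have "x2 = under \<eta>3 b x"
        by (simp add: x2_def)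
      then show ?thesis
        unfolding \<gamma>(3) bot2(1)[OF False] by (simp add: sides_steps(2)[OF bot2(2)[OF False]])
    qed
  qed
  have s3: "sides (\<gamma> \<beta>) p3 x3 (under \<eta>3 (\<gamma> \<mu> p3) x3)"
    unfolding gb
  proof (cases "p2 < p3")
    case True
    then have "x3 = under \<eta>2 a x"
      by (simp add: x3_def)
    then show "sides (\<gamma> \<beta>) p3 x3 (under \<eta>3 b x3)"
      unfolding \<gamma>(3) bot1[OF True] by (simp add: sides_steps(2)[OF True])
  next
    case False
    then have "x3 = x"
      by (simp add: x3_def)
    then show "sides (\<gamma> \<beta>) p3 x3 (under \<eta>3 b x3)"
      unfolding \<gamma>(3) bot2(1)[OF False] by (simp add: sides_steps(1)[OF bot2(2)[OF False]])
  qed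
  show "strand_colouring 3 X \<gamma>"
  proof (rule strand_colouringI)
    fix l v assume l: "l < 3" "\<bar>v\<bar> < 1" and nX: "\<And>p \<eta>. (p, (l, v), \<eta>) \<notin> X"
    from l(1) nX show "loc_const (\<gamma> l) v"
    proof (cases rule: no_crossing_cases)
      case 1
      show ?thesis unfolding 1 \<gamma>(1) by (rule t(1)[OF l(2)])
    next
      case 2
      show ?thesis unfolding 2(1) by (rule lm[OF l(2) 2(2)])
    next
      case 3
      show ?thesis unfolding 3(1) by (rule lb[OF 3(2,3)])
    qed
  next
    fix l v l' v' \<theta> assume "((l, v), (l', v'), \<theta>) \<in> X"
    then show "\<exists>B. sides (\<gamma> l') v' B (under \<theta> (\<gamma> l v) B)"
      using s1 s2 s3 unfolding triangle_def by (elim insertE emptyE) (simp_all only: prod.inject, blast+)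
  qed
  show "strand_lonsum X \<gamma> \<tau> = 0"
    by (rule strand_lonsum_no_under) (use strands in \<open>auto simp: triangle_def\<close>)
  have "strand_lonsum X \<gamma> \<mu> \<doteq> kap \<eta>1 *\<^sub>L (\<gamma> \<tau> p1 - y)"
    by (rule strand_lonsum_one) (use strands left_colour[OF s1] in \<open>auto simp: triangle_def\<close>)
  also have "\<dots> \<doteq> kap \<eta>1 *\<^sub>L (a - y)"
    unfolding \<gamma>(1) by (intro cong_scale cong_diff t(2) p cong_refl)
  finally show "strand_lonsum X \<gamma> \<mu> \<doteq> kap \<eta>1 *\<^sub>L (a - y)" .
  have "strand_lonsum X \<gamma> \<beta> \<doteq> kap \<eta>2 *\<^sub>L (\<gamma> \<tau> p2 - x2) + kap \<eta>3 *\<^sub>L (\<gamma> \<mu> p3 - x3)"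
    by (rule strand_lonsum_two) (use strands params(5) left_colour[OF s2] left_colour[OF s3] in \<open>auto simp: triangle_def\<close>)
  also have "\<dots> \<doteq> kap \<eta>2 *\<^sub>L (a - x2) + kap \<eta>3 *\<^sub>L (b - x3)"
    unfolding gb unfolding \<gamma>(1) by (intro cong_add cong_scale cong_diff t(2) p cong_refl)
  also have "\<dots> = bot_lon a b x"
    by (simp add: bot_lon_def x2_def x3_def add.commute)
  finally show "strand_lonsum X \<gamma> \<beta> \<doteq> bot_lon a b x" .
qed

lemma triangle_generate:
  assumes \<gamma>: "strand_colouring 3 X \<gamma>"
    and Z: "lmod.subspace Z" "K \<subseteq> Z" and ends: "\<And>l v. l < 3 \<Longrightarrow> 3/4 < \<bar>v\<bar> \<Longrightarrow> \<bar>v\<bar> < 1 \<Longrightarrow> \<gamma> l v \<in> Z"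
    and v: "l < 3" "\<bar>v\<bar> < 1" "\<And>p \<eta>. (p, (l, v), \<eta>) \<notin> X"
  shows "\<gamma> l v \<in> Z"
proof -
  obtain a x y where "described_by \<gamma> a x y"
    using triangle_colours[OF \<gamma>] by blast
  note c = described_byD[OF this]
  have a: "a \<in> Z"
    by (rule in_Z[OF cong_sym[OF c(1)[of "7/8"]] Z]) (use ends[OF strands(1), of "7/8"] in auto)
  \<comment> \<open>The parameter -7/8 precedes all crossings, so the initial colours can be read
    off there.\<close>
  have e: "\<bar>- 7/8 :: real\<bar> < 1" "3/4 < \<bar>- 7/8 :: real\<bar>" "- 7/8 < p1" "- 7/8 < p2" "- 7/8 < p3"
    using params by auto
  have "\<gamma> \<mu> (- 7/8) \<doteq> y"
    using c(2)[OF e(1)] e by (simp add: mid_def steps_def)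
  then have y: "y \<in> Z"
    using in_Z[OF cong_sym Z] ends[OF strands(2) e(2,1)] by blast
  have m: "mid a y v \<in> Z" for v
    unfolding mid_def by (intro steps_in_Z under_in_Z Z a y)
  have "\<gamma> \<beta> (- 7/8) \<doteq> x"
    using c(3)[OF e(1)] e by (simp add: bot_def steps_def split: if_splits)
  then have x: "x \<in> Z"
    using in_Z[OF cong_sym Z] ends[OF strands(3) e(2,1)] by blast
  have b: "bot a (mid a y p3) x v \<in> Z" for v
    unfolding bot_def by (auto intro!: steps_in_Z under_in_Z Z a x m)
  from v(1,3) show ?thesis
  proof (cases rule: no_crossing_cases)
    case 1
    then show ?thesis using in_Z[OF c(1)[OF v(2)] Z a] by simp
  next
    case 2
    then show ?thesis using in_Z[OF c(2)[OF v(2)] Z m] by simp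
  next
    case 3
    then show ?thesis using in_Z[OF c(3)[OF v(2)] Z b] by simp
  qed
qed

text \<open>
  The bottom strand passes under the top and the middle strand in the other order, and under the
  part of the middle strand on the other side of the top strand.
\<close>

lemma triangle_extend:
  assumes q: "triangle_strands \<tau> \<mu> \<beta> q1 q2 q3"
    and \<gamma>: "strand_colouring 3 (triangle \<tau> \<mu> \<beta> \<eta>1 \<eta>2 \<eta>3 q1 q2 q3) \<gamma>"
    and order: "p2 < p3 \<longleftrightarrow> q3 < q2" "p1 < p3 \<longleftrightarrow> q3 < q1" "\<eta>1 = \<eta>2 \<longleftrightarrow> (p2 < p3 \<longleftrightarrow> p1 < p3)"
  shows "\<exists>\<gamma>'. strand_colouring 3 X \<gamma>' \<and> (\<forall>l<3. \<forall>v. 3/4 \<le> \<bar>v\<bar> \<longrightarrow> \<bar>v\<bar> < 1 \<longrightarrow> \<gamma>' l v \<doteq> \<gamma> l v) \<and>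
    (\<forall>l<3. strand_lonsum X \<gamma>' l \<doteq> strand_lonsum (triangle \<tau> \<mu> \<beta> \<eta>1 \<eta>2 \<eta>3 q1 q2 q3) \<gamma> l)"
proof -
  interpret q: triangle_strands \<tau> \<mu> \<beta> \<eta>1 \<eta>2 \<eta>3 q1 q2 q3 by (rule q)
  interpret q: coloured_triangle \<tau> \<mu> \<beta> \<eta>1 \<eta>2 \<eta>3 q1 q2 q3 K by unfold_locales
  obtain a x y where "q.described_by \<gamma> a x y"
    using q.triangle_colours[OF \<gamma>] by blast
  note c = q.described_byD[OF this]
  define b where "b = mid a y p3"
  define b' where "b' = q.mid a y q3"
  \<comment> \<open>\<open>b\<close> and \<open>b'\<close> are the colours of the middle strand on
    the two sides of the top strand, because its crossing with the bottom strand has changed sides.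
    By \<open>order(3)\<close> the middle and the bottom strand meet on one definite side of the top
    strand, so the passage between \<open>b\<close> and \<open>b'\<close> has the same direction
    \<open>\<eta>2\<close> as that of the bottom strand.\<close>
  have bb': "(if p2 < p3 then b = under \<eta>2 a b' else b' = under \<eta>2 a b)"
  proof -
    have b: "b = (if p3 < p1 then y else under \<eta>1 a y)" and b': "b' = (if q3 < q1 then y else under \<eta>1 a y)"
      by (simp_all add: b_def b'_def mid_def q.mid_def steps_def)
    have lt: "p3 < p1 \<longleftrightarrow> \<not> p1 < p3" "q3 < q1 \<longleftrightarrow> p1 < p3"
      using order(2) params(4) by auto
    show ?thesis
    proof (cases "\<eta>1 = \<eta>2")
      case True
      then have "p2 < p3 \<longleftrightarrow> p1 < p3"
        using order(3) by blast
      then show ?thesis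
        unfolding b b' lt True by simp
    next
      case False
      then have "p2 < p3 \<longleftrightarrow> \<not> p1 < p3"
        using order(3) by blast
      moreover have "\<eta>1 = (\<not> \<eta>2)"
        using False by blast
      then have "under \<eta>2 a (under \<eta>1 a y) = y"
        using under_inverse[of "\<not> \<eta>2" a y] by simp
      ultimately show ?thesis
        unfolding b b' lt by simp
    qed
  qed
  have lc: "loc_const (\<gamma> \<tau>) v" if "\<bar>v\<bar> < 1" for v
    by (rule strand_loc_const[OF \<gamma> strands(1) that]) (use strands in \<open>auto simp: triangle_def\<close>)
  define \<gamma>' where "\<gamma>' = (\<lambda>l. if l = \<tau> then \<gamma> \<tau> else if l = \<mu> then mid a y else bot a b x)"
  have \<gamma>': "\<gamma>' \<tau> = \<gamma> \<tau>" "\<gamma>' \<mu> = mid a y" "\<gamma>' \<beta> = bot a b x"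
    using strands by (auto simp: \<gamma>'_def)
  note build = triangle_build[OF lc c(1), where y = y and x = x, folded b_def, folded \<gamma>'_def]
  have ends: "\<gamma>' l v \<doteq> \<gamma> l v" if l: "l < 3" "3/4 \<le> \<bar>v\<bar>" "\<bar>v\<bar> < 1" for l v
  proof -
    \<comment> \<open>In the collar every comparison with a crossing parameter is decided by the
      sign of \<open>v\<close>, so only initial and final colours occur.\<close>
    have v: "v \<noteq> p1" "v \<noteq> p2" "v \<noteq> p3" "v \<noteq> q1" "v \<noteq> q2" "v \<noteq> q3" "v < p1 \<longleftrightarrow> v < 0" "v < p2 \<longleftrightarrow> v < 0" "v < p3 \<longleftrightarrow> v < 0"
      "v < q1 \<longleftrightarrow> v < 0" "v < q2 \<longleftrightarrow> v < 0" "v < q3 \<longleftrightarrow> v < 0"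
    proof -
      have "v \<le> - 3/4 \<or> 3/4 \<le> v"
        using l(2) by linarith
      moreover have "- 3/4 < r \<and> r < 3/4" if "r \<in> {p1, p2, p3, q1, q2, q3}" for r
        using that params q.params by (auto simp: abs_less_iff)
      then have "- 3/4 < p1 \<and> p1 < 3/4" "- 3/4 < p2 \<and> p2 < 3/4" "- 3/4 < p3 \<and> p3 < 3/4"
        "- 3/4 < q1 \<and> q1 < 3/4" "- 3/4 < q2 \<and> q2 < 3/4" "- 3/4 < q3 \<and> q3 < 3/4"
        by blast+
      ultimately show "v \<noteq> p1" "v \<noteq> p2" "v \<noteq> p3" "v \<noteq> q1" "v \<noteq> q2" "v \<noteq> q3"
        "v < p1 \<longleftrightarrow> v < 0" "v < p2 \<longleftrightarrow> v < 0" "v < p3 \<longleftrightarrow> v < 0"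
        "v < q1 \<longleftrightarrow> v < 0" "v < q2 \<longleftrightarrow> v < 0" "v < q3 \<longleftrightarrow> v < 0"
        by (elim disjE; linarith)+
    qed
    have m: "mid a y v = q.mid a y v"
      using v l by (simp add: mid_def q.mid_def steps_def)
    \<comment> \<open>The initial colours agree trivially; for the final ones
      \<open>under_under\<close> exchanges the two passages, with \<open>b\<close> and
      \<open>b'\<close> related by \<open>bb'\<close>.\<close>
    have bt: "bot a b x v = q.bot a b' x v"
    proof (cases "p2 < p3")
      case True
      then have "\<not> q2 < q3" "b = under \<eta>2 a b'"
        using order(1) q.params(5) bb' True by simp_all
      then show ?thesis
        using v True under_under[of \<eta>2 a \<eta>3 b' x] by (simp add: bot_def q.bot_def steps_def)
    next
      case False
      then have "q2 < q3" "b' = under \<eta>2 a b"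
        using order(1) q.params(5) bb' False by simp_all
      then show ?thesis
        using v False under_under[of \<eta>2 a \<eta>3 b x] by (simp add: bot_def q.bot_def steps_def)
    qed
    consider "l = \<tau>" | "l = \<mu>" | "l = \<beta>"
      using strand_cases[OF l(1)] by blast
    then show ?thesis
    proof cases
      case 1
      then show ?thesis by (simp add: \<gamma>')
    next
      case 2
      then show ?thesis using c(2)[OF l(3)] v cong_sym by (simp add: \<gamma>' m)
    next
      case 3
      then show ?thesis using c(3)[OF l(3)] v cong_sym by (simp add: \<gamma>' bt b'_def)
    qed
  qed
  have lon: "bot_lon a b x = q.bot_lon a b' x"
  proof (cases "p2 < p3")
    case True
    then have "\<not> q2 < q3" "b = under \<eta>2 a b'"
      using order(1) q.params(5) bb' True by simp_all
    then show ?thesis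
      using True kap_under_under[of \<eta>2 a x \<eta>3 b'] by (simp add: bot_lon_def q.bot_lon_def)
  next
    case False
    then have "q2 < q3" "b' = under \<eta>2 a b"
      using order(1) q.params(5) bb' False by simp_all
    then show ?thesis
      using False kap_under_under[of \<eta>2 a x \<eta>3 b] by (simp add: bot_lon_def q.bot_lon_def)
  qed
  have "strand_lonsum X \<gamma>' l \<doteq> strand_lonsum q.X \<gamma> l" if "l < 3" for l
  proof -
    have "strand_lonsum q.X \<gamma> \<tau> = 0"
      by (rule strand_lonsum_no_under) (use strands in \<open>auto simp: triangle_def\<close>)
    moreover have "strand_lonsum X \<gamma>' \<mu> \<doteq> strand_lonsum q.X \<gamma> \<mu>"
      by (rule cong_trans_sym[OF build(3) c(4)])
    moreover have "strand_lonsum X \<gamma>' \<beta> \<doteq> strand_lonsum q.X \<gamma> \<beta>"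
    proof (rule cong_trans_sym[OF build(4)])
      show "strand_lonsum q.X \<gamma> \<beta> \<doteq> bot_lon a b x"
        unfolding lon b'_def by (rule c(5))
    qed
    ultimately show ?thesis
      using strand_cases[OF that] build(2) by auto
  qed
  then show ?thesis
    using build(1) ends by blast
qed

end

lemma strands_third_move:
  assumes p: "triangle_strands \<tau> \<mu> \<beta> p1 p2 p3" and q: "triangle_strands \<tau> \<mu> \<beta> q1 q2 q3"
    and order: "p2 < p3 \<longleftrightarrow> q3 < q2" "p1 < p3 \<longleftrightarrow> q3 < q1" "\<eta>1 = \<eta>2 \<longleftrightarrow> (p2 < p3 \<longleftrightarrow> p1 < p3)"
  shows "strands_extend 3 (triangle \<tau> \<mu> \<beta> \<eta>1 \<eta>2 \<eta>3 p1 p2 p3) (triangle \<tau> \<mu> \<beta> \<eta>1 \<eta>2 \<eta>3 q1 q2 q3)"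
    "strands_generate 3 (triangle \<tau> \<mu> \<beta> \<eta>1 \<eta>2 \<eta>3 p1 p2 p3)"
proof -
  interpret p: triangle_strands \<tau> \<mu> \<beta> \<eta>1 \<eta>2 \<eta>3 p1 p2 p3 by (rule p)
  show "strands_extend 3 p.X (triangle \<tau> \<mu> \<beta> \<eta>1 \<eta>2 \<eta>3 q1 q2 q3)"
    unfolding strands_extend_def
  proof (intro allI impI)
    fix K :: "(arc \<Rightarrow> laurent) set" and \<gamma>
    assume *: "lmod.subspace K" "congruence.strand_colouring K 3 (triangle \<tau> \<mu> \<beta> \<eta>1 \<eta>2 \<eta>3 q1 q2 q3) \<gamma>"
    interpret coloured_triangle \<tau> \<mu> \<beta> \<eta>1 \<eta>2 \<eta>3 p1 p2 p3 K by unfold_locales (rule *)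
    show "\<exists>\<gamma>'. congruence.strand_colouring K 3 p.X \<gamma>' \<and>
        (\<forall>l<3. \<forall>v. 3/4 \<le> \<bar>v\<bar> \<longrightarrow> \<bar>v\<bar> < 1 \<longrightarrow> congruence.cong K (\<gamma>' l v) (\<gamma> l v)) \<and>
        (\<forall>l<3. congruence.cong K (congruence.strand_lonsum K p.X \<gamma>' l)
          (congruence.strand_lonsum K (triangle \<tau> \<mu> \<beta> \<eta>1 \<eta>2 \<eta>3 q1 q2 q3) \<gamma> l))"
      by (rule triangle_extend[OF q *(2) order])
  qed
  show "strands_generate 3 p.X"
    unfolding strands_generate_def
  proof (intro allI impI)
    fix K Z :: "(arc \<Rightarrow> laurent) set" and \<gamma> :: "nat \<Rightarrow> real \<Rightarrow> arc \<Rightarrow> laurent" and l and v :: real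
    assume *: "lmod.subspace K" "congruence.strand_colouring K 3 p.X \<gamma>" "lmod.subspace Z" "K \<subseteq> Z"
      "\<forall>l<3. \<forall>v. 3/4 < \<bar>v\<bar> \<longrightarrow> \<bar>v\<bar> < 1 \<longrightarrow> \<gamma> l v \<in> Z" "l < 3" "\<bar>v\<bar> < 1" "\<forall>p \<eta>. (p, (l, v), \<eta>) \<notin> p.X"
    interpret coloured_triangle \<tau> \<mu> \<beta> \<eta>1 \<eta>2 \<eta>3 p1 p2 p3 K by unfold_locales (rule *)
    show "\<gamma> l v \<in> Z"
      by (rule triangle_generate[OF *(2,3,4) _ *(6,7)]) (use *(5,8) in blast)+
  qed
qed

section \<open>The geometry of the Reidemeister moves\<close>

text \<open>One side of a local move. It is instantiated for the diagrams before and after the move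
  with the same parameter intervals and heights but different strand curves
  \<open>T\<close>.\<close>

locale diagram_strands = disjoint_strands n c m k for n c m k +
  fixes E :: diagram and T :: "nat \<Rightarrow> real \<Rightarrow> complex" and h :: "nat \<Rightarrow> nat"
  assumes valid: "link_diagram E"
    and c_range: "\<And>l. l < n \<Longrightarrow> c l \<in> {1..ncomp E}"
    and curve_strand: "\<And>l v. l < n \<Longrightarrow> \<bar>v\<bar> \<le> 1 \<Longrightarrow> curve E (c l) (m l + k l * v) = T l v"
    and strand_square: "\<And>l v. l < n \<Longrightarrow> \<bar>v\<bar> \<le> 1 \<Longrightarrow> T l v \<in> square"
    and outside_square: "\<And>p. p \<in> points E \<Longrightarrow> p \<notin> strand_pts 1 \<Longrightarrow> position E p \<notin> square"
    and double_classical: "\<And>l v q. l < n \<Longrightarrow> \<bar>v\<bar> \<le> 1 \<Longrightarrow> (pt l v, q) \<in> double_points E \<Longrightarrow>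
      (pt l v, q) \<in> classical E \<or> (q, pt l v) \<in> classical E"
    and height: "\<And>l v l' v'. l < n \<Longrightarrow> l' < n \<Longrightarrow> \<bar>v\<bar> \<le> 1 \<Longrightarrow> \<bar>v'\<bar> \<le> 1 \<Longrightarrow> l \<noteq> l' \<Longrightarrow>
      (pt l v, pt l' v') \<in> classical E \<Longrightarrow> h l' < h l"
begin

sublocale E: valid_diagram E by standard (rule valid)

lemma position_pt: "l < n \<Longrightarrow> \<bar>v\<bar> \<le> 1 \<Longrightarrow> position E (pt l v) = T l v"
  using E.curve_shift[OF c_range, of l "frac (m l + k l * v)" "\<lfloor>m l + k l * v\<rfloor>"] curve_strand[of l v]
  by (simp add: position_def pt_def) (simp add: frac_def)

lemma pt_in_points: "l < n \<Longrightarrow> pt l v \<in> points E"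
  using c_range by (simp add: points_def pt_def frac_lt_1)

text \<open>The strands lie in the square and all other points outside it, so a crossing is either
  entirely inside the disc or entirely outside.\<close>

lemma classical_strand:
  assumes pq: "(p, q) \<in> classical E" and "p \<in> strand_pts 1 \<or> q \<in> strand_pts 1"
  obtains l v l' v' where "l < n" "\<bar>v\<bar> \<le> 1" "l' < n" "\<bar>v'\<bar> \<le> 1" "p = pt l v" "q = pt l' v'"
proof -
  have pos: "position E p = position E q"
    using pq E.classical_double by (auto simp: double_points_def)
  have sq: "position E r \<in> square" if "r \<in> strand_pts 1" for r
    using that strand_square position_pt by (auto simp: strand_pts_def)
  have "p \<in> strand_pts 1" "q \<in> strand_pts 1"
    using assms(2) sq[of p] sq[of q] pos outside_square[of p] outside_square[of q] E.classical_points[OF pq] by auto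
  then show thesis
    using that by (auto simp: strand_pts_def)
qed

lemma classical_pt_eq:
  assumes "l < n" "\<bar>v\<bar> \<le> 1" "l' < n" "\<bar>v'\<bar> \<le> 1" "(pt l v, pt l' v') \<in> classical E"
  shows "T l v = T l' v' \<and> (l, v) \<noteq> (l', v')"
  using assms E.classical_double position_pt[of l v] position_pt[of l' v'] by (auto simp: double_points_def)

lemma classical_pt:
  assumes "l < n" "\<bar>v\<bar> \<le> 1" "l' < n" "\<bar>v'\<bar> \<le> 1" "T l v = T l' v'" "(l, v) \<noteq> (l', v')"
  shows "(pt l v, pt l' v') \<in> classical E \<or> (pt l' v', pt l v) \<in> classical E"
proof (rule double_classical[OF assms(1,2)])
  show "(pt l v, pt l' v') \<in> double_points E"
    using assms pt_in_points position_pt pt_inject[of l l' v v'] by (auto simp: double_points_def)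
qed

lemma velocity_pt:
  assumes l: "l < n" "\<bar>v\<bar> < 1" and d: "(T l has_vector_derivative d) (at v)"
  shows "velocity E (pt l v) = (1 / k l) *\<^sub>R d"
proof -
  define y where "y = m l + k l * v"
  have k: "k l \<noteq> 0"
    using k_bound[OF l(1)] by auto
  have per: "curve E (c l) (x + 1) = curve E (c l) x" for x
    by (rule E.curve_period[OF c_range[OF l(1)]])
  have "((\<lambda>x. (x - m l) / k l) has_vector_derivative (1 / k l)) (at y)"
    unfolding has_real_derivative_iff_has_vector_derivative[symmetric]
    using k by (auto intro!: derivative_eq_intros)
  moreover have yv: "(y - m l) / k l = v"
    using k by (simp add: y_def)
  ultimately have "((T l \<circ> (\<lambda>x. (x - m l) / k l)) has_vector_derivative (1 / k l) *\<^sub>R d) (at y)"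
    using vector_diff_chain_at d by metis
  then have "(curve E (c l) has_vector_derivative (1 / k l) *\<^sub>R d) (at y)"
  proof (rule has_vector_derivative_transform_within_open)
    show "open {x. \<bar>(x - m l) / k l\<bar> < 1}"
      using k by (intro open_Collect_less continuous_intros) auto
    show "y \<in> {x. \<bar>(x - m l) / k l\<bar> < 1}"
      using l(2) by (simp only: yv mem_Collect_eq)
    fix x assume "x \<in> {x. \<bar>(x - m l) / k l\<bar> < 1}"
    then show "(T l \<circ> (\<lambda>x. (x - m l) / k l)) x = curve E (c l) x"
      using curve_strand[OF l(1), of "(x - m l) / k l"] k by simp
  qed
  then have "(curve E (c l) has_vector_derivative (1 / k l) *\<^sub>R d) (at (frac y + of_int \<lfloor>y\<rfloor>))"
    by (simp add: frac_def)
  then have "(curve E (c l) has_vector_derivative (1 / k l) *\<^sub>R d) (at (frac y))"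
    by (rule has_vector_derivative_shift_period[where f = "curve E (c l)", OF per])
  then show ?thesis
    by (simp add: velocity_def pt_def y_def vector_derivative_at)
qed

text \<open>The determinant of the velocities is \<open>det2 d d'\<close> divided by
  \<open>k l * k l'\<close>.\<close>

lemma right_to_left_pt:
  assumes "l < n" "\<bar>v\<bar> < 1" "l' < n" "\<bar>v'\<bar> < 1"
    and "(T l has_vector_derivative d) (at v)" "(T l' has_vector_derivative d') (at v')" "det2 d d' \<noteq> 0"
  shows "right_to_left E (pt l v, pt l' v') \<longleftrightarrow> ((k l > 0 \<longleftrightarrow> det2 d d' > 0) \<longleftrightarrow> k l' > 0)"
proof -
  have "k l \<noteq> 0" "k l' \<noteq> 0"
    using k_bound assms by auto
  then show ?thesis
    using assms(7) velocity_pt[OF assms(1,2,5)] velocity_pt[OF assms(3,4,6)]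
    by (auto simp: right_to_left_def det2_scale zero_less_mult_iff zero_less_divide_iff mult_less_0_iff divide_less_0_iff)
qed

definition crossings_of :: "strand_crossing set \<Rightarrow> bool" where
  "crossings_of X \<longleftrightarrow>
    (\<forall>l v l' v' \<eta>. ((l, v), (l', v'), \<eta>) \<in> X \<longrightarrow> l < n \<and> l' < n \<and> \<bar>v\<bar> < 3/4 \<and> \<bar>v'\<bar> < 3/4 \<and>
      (pt l v, pt l' v') \<in> classical E \<and> (right_to_left E (pt l v, pt l' v') \<longleftrightarrow> (\<eta> \<longleftrightarrow> k l' > 0))) \<and>
    (\<forall>l v l' v'. l < n \<longrightarrow> l' < n \<longrightarrow> \<bar>v\<bar> \<le> 1 \<longrightarrow> \<bar>v'\<bar> \<le> 1 \<longrightarrow> (pt l v, pt l' v') \<in> classical E \<longrightarrow>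
      (\<exists>\<eta>. ((l, v), (l', v'), \<eta>) \<in> X))"

text \<open>In the second and third move the strands are graphs over the parameter, so a strand does
  not meet itself and two strands meet at a common \<open>v\<close>. The tangents are (1, slope),
  whose determinant is the difference of the slopes; the heights \<open>h\<close> decide which
  strand is on top.\<close>

lemma crossings_of_graphs:
  assumes T: "\<And>l v. l < n \<Longrightarrow> T l v = Complex v (f l v)"
    and s: "\<And>a b v. a < n \<Longrightarrow> b < n \<Longrightarrow> a \<noteq> b \<Longrightarrow> \<bar>v\<bar> \<le> 1 \<Longrightarrow> f a v = f b v \<Longrightarrow>
      \<bar>v\<bar> < 3/4 \<and> (f a has_real_derivative s a v) (at v) \<and> s a v \<noteq> s b v"
    and inj: "inj_on h {..<n}"
  shows "crossings_of {((a, v), (b, v), k a > 0 \<longleftrightarrow> s a v < s b v) |a b v.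
    a < n \<and> b < n \<and> h b < h a \<and> \<bar>v\<bar> \<le> 1 \<and> f a v = f b v}"
  unfolding crossings_of_def
proof (intro conjI allI impI)
  fix l v l' v' \<eta>
  assume "((l, v), (l', v'), \<eta>) \<in> {((a, v), (b, v), k a > 0 \<longleftrightarrow> s a v < s b v) |a b v.
    a < n \<and> b < n \<and> h b < h a \<and> \<bar>v\<bar> \<le> 1 \<and> f a v = f b v}"
  then have x: "v' = v" "\<eta> \<longleftrightarrow> (k l > 0 \<longleftrightarrow> s l v < s l' v)" "l < n" "l' < n" "h l' < h l" "\<bar>v\<bar> \<le> 1" "f l v = f l' v"
    by auto
  then have ne: "l \<noteq> l'"
    by auto
  note sl = s[OF x(3,4) ne x(6,7)] and sl' = s[OF x(4,3) ne[symmetric] x(6) x(7)[symmetric]]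
  have v: "\<bar>v\<bar> < 3/4" "\<bar>v\<bar> < 1"
    using sl by auto
  show "l < n" "l' < n" "\<bar>v\<bar> < 3/4" "\<bar>v'\<bar> < 3/4"
    using x v by auto
  have "(pt l v, pt l' v) \<in> classical E \<or> (pt l' v, pt l v) \<in> classical E"
    by (rule classical_pt) (use x ne T in auto)
  then show cl: "(pt l v, pt l' v') \<in> classical E"
    using height[of l' l v v] x ne by auto
  have der: "(T a has_vector_derivative Complex 1 (s a v)) (at v)"
    if "a < n" "(f a has_real_derivative s a v) (at v)" for a
  proof -
    have "((\<lambda>v. of_real v + \<i> * of_real (f a v)) has_vector_derivative (1 + \<i> * of_real (s a v))) (at v)"
      using that(2) by (auto intro!: derivative_eq_intros simp: has_real_derivative_iff_has_vector_derivative)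
    moreover have "T a = (\<lambda>v. of_real v + \<i> * of_real (f a v))" "Complex 1 (s a v) = 1 + \<i> * of_real (s a v)"
      using T[OF that(1)] by (auto simp: complex_eq_iff)
    ultimately show ?thesis
      by simp
  qed
  have "det2 (Complex 1 (s l v)) (Complex 1 (s l' v)) = s l' v - s l v"
    by (simp add: det2_def)
  then show "right_to_left E (pt l v, pt l' v') \<longleftrightarrow> (\<eta> \<longleftrightarrow> k l' > 0)"
    using right_to_left_pt[OF x(3) v(2) x(4) v(2) der der] x(1-4) sl sl' by auto
next
  fix l v l' v'
  assume l: "l < n" "l' < n" "\<bar>v\<bar> \<le> 1" "\<bar>v'\<bar> \<le> 1" "(pt l v, pt l' v') \<in> classical E"
  have "T l v = T l' v' \<and> (l, v) \<noteq> (l', v')"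
    by (rule classical_pt_eq) (use l in auto)
  then have "v' = v" "f l v = f l' v" "l \<noteq> l'"
    using T l by auto
  moreover have "h l' < h l"
    using height[OF l(1-4) \<open>l \<noteq> l'\<close> l(5)] .
  ultimately show "\<exists>\<eta>. ((l, v), (l', v'), \<eta>) \<in> {((a, v), (b, v), k a > 0 \<longleftrightarrow> s a v < s b v) |a b v.
    a < n \<and> b < n \<and> h b < h a \<and> \<bar>v\<bar> \<le> 1 \<and> f a v = f b v}"
    using l by blast
qed

end

text \<open>The geometry common to the three moves. What remains for each move is to list the
  crossings of its two local pictures as \<open>X\<close> and \<open>X'\<close>.\<close>

lemma local_move_obtain:
  assumes D: "link_diagram D" and D': "link_diagram D'" and move: "local_move n T T' D D'"
    and sq: "\<And>l v. l < n \<Longrightarrow> \<bar>v\<bar> \<le> 1 \<Longrightarrow> T l v \<in> square" "\<And>l v. l < n \<Longrightarrow> \<bar>v\<bar> \<le> 1 \<Longrightarrow> T' l v \<in> square"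
  obtains c m k h where "diagram_strands n c m k D T h" "diagram_strands n c m k D' T' h" "inj_on h {..<n}"
    "\<And>X X'. diagram_strands.crossings_of n c m k D X \<Longrightarrow> diagram_strands.crossings_of n c m k D' X' \<Longrightarrow>
      local_pair n c m k D D' X X'"
proof -
  note mv = move[unfolded local_move_def]
  have nc: "ncomp D' = ncomp D"
    using mv by (rule conjunct1)
  obtain c :: "nat \<Rightarrow> nat" and m k :: "nat \<Rightarrow> real" and h :: "nat \<Rightarrow> nat" and S where
    strands: "\<forall>l < n. c l \<in> {1..ncomp D} \<and> 0 < \<bar>k l\<bar> \<and> \<bar>k l\<bar> < 1/2 \<and>
        S l = {(c l, frac (m l + k l * v)) | v. v \<in> {-1..1}} \<and>
        (\<forall>v \<in> {-1..1}. curve D (c l) (m l + k l * v) = T l v \<and> curve D' (c l) (m l + k l * v) = T' l v)"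
    and disj: "disjoint_family_on S {..<n}"
    and out: "\<forall>p \<in> points D - (\<Union>l<n. S l). position D p \<notin> square \<and> position D' p = position D p"
    and inj: "inj_on h {..<n}"
    and E: "\<forall>E \<in> {D, D'}.
        (\<forall>l < n. \<forall>p \<in> S l. \<forall>q. (p, q) \<in> double_points E \<longrightarrow> (p, q) \<in> classical E \<or> (q, p) \<in> classical E) \<and>
        (\<forall>l < n. \<forall>l' < n. \<forall>p \<in> S l. \<forall>q \<in> S l'. l \<noteq> l' \<and> (p, q) \<in> classical E \<longrightarrow> h l' < h l)"
    and same: "\<forall>p \<in> points D - (\<Union>l<n. S l). \<forall>q \<in> points D - (\<Union>l<n. S l).
        (p, q) \<in> classical D' \<longleftrightarrow> (p, q) \<in> classical D"
    using mv[THEN conjunct2] by (elim exE conjE) (rule that, assumption+)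
  interpret D: valid_diagram D by standard (rule D)
  interpret D': valid_diagram D' by standard (rule D')
  have k: "0 < \<bar>k l\<bar> \<and> \<bar>k l\<bar> < 1/2" and cr: "c l \<in> {1..ncomp D}" if "l < n" for l
    using strands that by blast+
  interpret strand_family n c m k by standard (rule k)
  have abs1: "v \<in> {-1..1} \<longleftrightarrow> \<bar>v\<bar> \<le> 1" for v :: real
    by (auto simp: abs_le_iff)
  have S: "S l = {pt l v |v. \<bar>v\<bar> \<le> 1}" if "l < n" for l
  proof -
    have "S l = {(c l, frac (m l + k l * v)) |v. v \<in> {-1..1}}"
      using strands that by blast
    then show ?thesis
      unfolding pt_def abs1 .
  qed
  have cu: "curve D (c l) (m l + k l * v) = T l v" "curve D' (c l) (m l + k l * v) = T' l v" if "l < n" "\<bar>v\<bar> \<le> 1" for l v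
    using strands that abs1[of v] by blast+
  have mem: "pt l v \<in> S l" if "l < n" "\<bar>v\<bar> \<le> 1" for l v
    unfolding S[OF that(1)] using that by blast
  have "disjoint_strands n c m k"
  proof
    fix l l' v v' assume *: "l < n" "l' < n" "\<bar>v\<bar> \<le> 1" "\<bar>v'\<bar> \<le> 1" "pt l v = pt l' v'"
    show "l = l'"
    proof (rule ccontr)
      assume "l \<noteq> l'"
      then have "S l \<inter> S l' = {}"
        using disj *(1,2) by (auto simp: disjoint_family_on_def)
      moreover have "pt l v \<in> S l \<inter> S l'"
        using mem[OF *(1,3)] mem[OF *(2,4)] *(5) by simp
      ultimately show False
        by blast
    qed
  qed
  then interpret disjoint_strands n c m k .
  have US: "(\<Union>l<n. S l) = strand_pts 1"
    using S by (auto simp: strand_pts_def)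
  have outD: "position D p \<notin> square" "position D' p = position D p" if "p \<in> points D" "p \<notin> strand_pts 1" for p
    using out that unfolding US by blast+
  have pts: "points D' = points D"
    by (simp add: points_def nc)
  have ED: "(p, q) \<in> double_points F \<Longrightarrow> (p, q) \<in> classical F \<or> (q, p) \<in> classical F"
    if "F = D \<or> F = D'" "l < n" "p \<in> S l" for F l p q
    using E that by blast
  have EH: "h l' < h l" if "F = D \<or> F = D'" "l < n" "l' < n" "p \<in> S l" "q \<in> S l'" "l \<noteq> l'" "(p, q) \<in> classical F" for F l l' p q
    using E that by blast
  have EH': "h l' < h l" if "F = D \<or> F = D'" "l < n" "l' < n" "\<bar>v\<bar> \<le> 1" "\<bar>v'\<bar> \<le> 1" "l \<noteq> l'"
    "(pt l v, pt l' v') \<in> classical F" for F l l' v v'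
    by (rule EH[OF that(1-3) mem[OF that(2,4)] mem[OF that(3,5)] that(6,7)])
  have sD: "diagram_strands n c m k D T h"
    by unfold_locales (use D cr cu sq outD ED[of D] mem in \<open>simp; fail\<close> | rule EH'[of D]; simp)+
  have sD': "diagram_strands n c m k D' T' h"
    by unfold_locales (use D' cr cu sq outD ED[of D'] mem nc pts in \<open>simp; fail\<close> | rule EH'[of D']; simp)+
  interpret sD: diagram_strands n c m k D T h by (rule sD)
  interpret sD': diagram_strands n c m k D' T' h by (rule sD')
  \<comment> \<open>A point off the closed strands has a neighbourhood off them, where the two
    curves agree; this gives equal velocities and hence equal signs outside the disc.\<close>
  have vel: "velocity D' p = velocity D p" if out_p: "p \<in> points D" "p \<notin> strand_pts 1" for p
  proof -
    obtain i x where p: "p = (i, x)" by (cases p)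
    have i: "i \<in> {1..ncomp D}" and x: "frac x = x"
      using out_p(1) by (auto simp: p points_def)
    obtain e where e: "e > 0" "\<And>y. \<bar>y - x\<bar> < e \<Longrightarrow> (i, frac y) \<notin> strand_pts 1"
      by (rule strand_pts_avoid[of i x 1]) (use out_p(2) x in \<open>auto simp: p\<close>)
    show ?thesis
      unfolding p
    proof (rule velocity_eqI[OF e(1)])
      fix y assume "\<bar>y - x\<bar> < e"
      then have "position D' (i, frac y) = position D (i, frac y)"
        using e(2) i by (intro outD) (auto simp: points_def frac_lt_1)
      then show "curve D' i y = curve D i y"
        using D.curve_shift[OF i, of "frac y" "\<lfloor>y\<rfloor>"] D'.curve_shift[of i "frac y" "\<lfloor>y\<rfloor>"] i nc
        by (simp add: position_def) (simp add: frac_def)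
    qed
  qed
  show thesis
  proof (rule that[OF sD sD' inj])
    fix X X' assume X: "sD.crossings_of X" and X': "sD'.crossings_of X'"
    show "local_pair n c m k D D' X X'"
    proof
      fix p q assume pq: "(p, q) \<in> classical D"
      show "(\<exists>l v l' v' \<eta>. ((l, v), (l', v'), \<eta>) \<in> X \<and> p = pt l v \<and> q = pt l' v') \<or>
        (p, q) \<in> classical D' \<and> right_to_left D' (p, q) = right_to_left D (p, q) \<and>
        p \<notin> strand_pts 1 \<and> q \<notin> strand_pts 1"
      proof (cases "p \<in> strand_pts 1 \<or> q \<in> strand_pts 1")
        case True
        obtain l v l' v' where l: "l < n" "\<bar>v\<bar> \<le> 1" "l' < n" "\<bar>v'\<bar> \<le> 1" "p = pt l v" "q = pt l' v'"
          by (rule sD.classical_strand[OF pq True])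
        then have "\<exists>\<eta>. ((l, v), (l', v'), \<eta>) \<in> X"
          using X pq unfolding sD.crossings_of_def by blast
        then show ?thesis
          using l(5,6) by blast
      next
        case False
        then have "(p, q) \<in> classical D'"
          using same pq D.classical_points[OF pq] unfolding US by blast
        moreover have "right_to_left D' (p, q) = right_to_left D (p, q)"
          by (rule right_to_left_cong) (use vel False D.classical_points[OF pq] in simp_all)
        ultimately show ?thesis
          using False by blast
      qed
    next
      fix p q assume pq: "(p, q) \<in> classical D'"
      show "(\<exists>l v l' v' \<eta>. ((l, v), (l', v'), \<eta>) \<in> X' \<and> p = pt l v \<and> q = pt l' v') \<or>
        (p, q) \<in> classical D \<and> right_to_left D (p, q) = right_to_left D' (p, q) \<and>
        p \<notin> strand_pts 1 \<and> q \<notin> strand_pts 1"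
      proof (cases "p \<in> strand_pts 1 \<or> q \<in> strand_pts 1")
        case True
        obtain l v l' v' where l: "l < n" "\<bar>v\<bar> \<le> 1" "l' < n" "\<bar>v'\<bar> \<le> 1" "p = pt l v" "q = pt l' v'"
          by (rule sD'.classical_strand[OF pq True])
        then have "\<exists>\<eta>. ((l, v), (l', v'), \<eta>) \<in> X'"
          using X' pq unfolding sD'.crossings_of_def by blast
        then show ?thesis
          using l(5,6) by blast
      next
        case False
        then have "(p, q) \<in> classical D"
          using same pq D'.classical_points[OF pq] unfolding US pts by blast
        moreover have "right_to_left D (p, q) = right_to_left D' (p, q)"
          by (rule right_to_left_cong) (use vel False D'.classical_points[OF pq] pts in simp_all)
        ultimately show ?thesis
          using False by blast
      qed
    next
      fix l v l' v' \<eta> assume "((l, v), (l', v'), \<eta>) \<in> X"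
      then show "l < n \<and> l' < n \<and> \<bar>v\<bar> < 3/4 \<and> \<bar>v'\<bar> < 3/4 \<and>
        (pt l v, pt l' v') \<in> classical D \<and> (right_to_left D (pt l v, pt l' v') \<longleftrightarrow> (\<eta> \<longleftrightarrow> k l' > 0))"
        using X[unfolded sD.crossings_of_def, THEN conjunct1] by blast
    next
      fix l v l' v' \<eta> assume "((l, v), (l', v'), \<eta>) \<in> X'"
      then show "l < n \<and> l' < n \<and> \<bar>v\<bar> < 3/4 \<and> \<bar>v'\<bar> < 3/4 \<and>
        (pt l v, pt l' v') \<in> classical D' \<and> (right_to_left D' (pt l v, pt l' v') \<longleftrightarrow> (\<eta> \<longleftrightarrow> k l' > 0))"
        using X'[unfolded sD'.crossings_of_def, THEN conjunct1] by blast
    qed (use D D' nc cr in simp_all)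
  qed
qed

section \<open>Crossings of the three local pictures\<close>

lemma reidemeister1_invariance:
  assumes D: "link_diagram D" and D': "link_diagram D'" and move: "reidemeister1 D D'"
  shows "enhanced_isomorphic D D'"
proof -
  let ?T = "\<lambda>(_::nat) v. Complex (2 * v ^ 3 - v) ((1 - v\<^sup>2) / 2)"
  have sq: "?T l v \<in> square" if "\<bar>v\<bar> \<le> 1" for l v
  proof -
    have v2: "0 \<le> v\<^sup>2" "v\<^sup>2 \<le> 1"
      using that by (auto simp: abs_square_le_1)
    then have "- 1 \<le> v\<^sup>2"
      by linarith
    have "\<bar>v\<bar> * \<bar>2 * v\<^sup>2 - 1\<bar> \<le> 1 * 1"
      by (intro mult_mono) (use that v2 in \<open>auto simp: abs_le_iff\<close>)
    moreover have "2 * v ^ 3 - v = v * (2 * v\<^sup>2 - 1)"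
      by (simp add: power3_eq_cube power2_eq_square algebra_simps)
    ultimately show ?thesis
      using v2 \<open>- 1 \<le> v\<^sup>2\<close> by (simp add: square_def abs_mult)
  qed
  obtain c m k h where ds: "diagram_strands 1 c m k D ?T h"
      "diagram_strands 1 c m k D' (\<lambda>_ v. Complex v 0) h" and inj: "inj_on h {..<1::nat}"
    and pair: "\<And>X X'. diagram_strands.crossings_of 1 c m k D X \<Longrightarrow>
      diagram_strands.crossings_of 1 c m k D' X' \<Longrightarrow> local_pair 1 c m k D D' X X'"
    by (rule local_move_obtain[OF D D' move[unfolded reidemeister1_def] sq]) (auto simp: square_def)
  interpret sD: diagram_strands 1 c m k D ?T h by (rule ds)
  interpret sD': diagram_strands 1 c m k D' "\<lambda>_ v. Complex v 0" h by (rule ds)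
  have root: "v = w \<or> v = - w" if "v\<^sup>2 = w\<^sup>2" for v w :: real
    using that power2_eq_iff by blast
  have T0: "?T 0 v = ?T 0 (- v)" if "v\<^sup>2 = 1/2" for v :: real
    using that by (simp add: power3_eq_cube power2_eq_square)
  have bound: "\<bar>v\<bar> < 3/4" if "v\<^sup>2 = 1/2" for v :: real
    by (rule power2_less_imp_less) (use that in \<open>auto simp: power2_eq_square\<close>)
  \<comment> \<open>Equal imaginary parts leave only \<open>v' = - v\<close>. The real part is odd,
    so it must vanish at \<open>v\<close>, that is, \<open>v * (2 * v\<^sup>2 - 1) = 0\<close> with
    \<open>v \<noteq> 0\<close>.\<close>
  have double: "v' = - v \<and> v\<^sup>2 = 1/2" if "?T 0 v = ?T 0 v'" "v \<noteq> v'" for v v' :: real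
  proof -
    have "v\<^sup>2 = v'\<^sup>2" and e: "2 * v ^ 3 - v = 2 * v' ^ 3 - v'"
      using that by auto
    then have v': "v' = - v"
      using root[of v v'] that by auto
    then have "v * (2 * v\<^sup>2 - 1) = 0" "v \<noteq> 0"
      using e that(2) by (auto simp: power3_eq_cube power2_eq_square algebra_simps)
    then show ?thesis
      using v' by auto
  qed
  have "\<exists>s. s\<^sup>2 = 1/2 \<and> (sD.pt 0 s, sD.pt 0 (- s)) \<in> classical D"
  proof -
    define r :: real where "r = sqrt (1/2)"
    have r: "r\<^sup>2 = 1/2" "r \<noteq> 0"
      by (auto simp: r_def)
    have "(sD.pt 0 r, sD.pt 0 (- r)) \<in> classical D \<or> (sD.pt 0 (- r), sD.pt 0 r) \<in> classical D"
      by (rule sD.classical_pt) (use r T0[of r] bound[of r] in auto)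
    then show ?thesis
      using r by (metis minus_minus power2_minus)
  qed
  then obtain s where s: "s\<^sup>2 = 1/2" "(sD.pt 0 s, sD.pt 0 (- s)) \<in> classical D"
    by blast
  have s0: "s \<noteq> 0" "\<bar>s\<bar> < 3/4" "\<bar>s\<bar> < 1"
    using s(1) bound[of s] by auto
  \<comment> \<open>The tangents at \<open>s\<close> and \<open>- s\<close> are (2, -s) and (2, s),
    with determinant 4 s, so the flag depends on the sign of \<open>s\<close>.\<close>
  define X :: "strand_crossing set" where "X = {((0, s), (0, - s), k 0 > 0 \<longleftrightarrow> s > 0)}"
  have der: "(?T 0 has_vector_derivative Complex 2 (- v)) (at v)" if "v\<^sup>2 = 1/2" for v :: real
  proof -
    have "((\<lambda>v. of_real (2 * v ^ 3 - v) + \<i> * of_real ((1 - v\<^sup>2) / 2)) has_vector_derivative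
        (of_real (6 * v\<^sup>2 - 1) + \<i> * of_real (- v))) (at v)"
    proof -
      have "((\<lambda>v. 2 * v ^ 3 - v) has_real_derivative (6 * v\<^sup>2 - 1)) (at v)"
        "((\<lambda>v. (1 - v\<^sup>2) / 2) has_real_derivative - v) (at v)"
        by (auto intro!: derivative_eq_intros)
      then show ?thesis
        by (intro has_vector_derivative_add has_vector_derivative_mult_right has_vector_derivative_of_real)
    qed
    moreover have "?T 0 = (\<lambda>v. of_real (2 * v ^ 3 - v) + \<i> * of_real ((1 - v\<^sup>2) / 2))"
      by (auto simp: complex_eq_iff)
    moreover have "Complex 2 (- v) = of_real (6 * v\<^sup>2 - 1) + \<i> * of_real (- v)"
      using that by (simp add: complex_eq_iff)
    ultimately show ?thesis
      by metis
  qed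
  have "det2 (Complex 2 (- s)) (Complex 2 s) = 4 * s"
    by (simp add: det2_def)
  then have rtl: "right_to_left D (sD.pt 0 s, sD.pt 0 (- s)) \<longleftrightarrow> ((k 0 > 0 \<longleftrightarrow> s > 0) \<longleftrightarrow> k 0 > 0)"
    using sD.right_to_left_pt[of 0 s 0 "- s" "Complex 2 (- s)" "Complex 2 s"] der[of s] der[of "- s"] s s0
    by simp
  have X: "sD.crossings_of X"
    unfolding sD.crossings_of_def
  proof (rule conjI; intro allI impI)
    fix l v l' v' \<eta> assume "((l, v), (l', v'), \<eta>) \<in> X"
    then show "l < 1 \<and> l' < 1 \<and> \<bar>v\<bar> < 3/4 \<and> \<bar>v'\<bar> < 3/4 \<and> (sD.pt l v, sD.pt l' v') \<in> classical D \<and>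
        (right_to_left D (sD.pt l v, sD.pt l' v') \<longleftrightarrow> (\<eta> \<longleftrightarrow> k l' > 0))"
      using s s0 rtl by (simp add: X_def)
  next
    fix l l' :: nat and v v'
    assume *: "l < 1" "l' < 1" "\<bar>v\<bar> \<le> 1" "\<bar>v'\<bar> \<le> 1" "(sD.pt l v, sD.pt l' v') \<in> classical D"
    have l: "l = 0" "l' = 0"
      using * by auto
    have "?T l v = ?T l' v' \<and> (l, v) \<noteq> (l', v')"
      by (rule sD.classical_pt_eq[OF *(1,3,2,4,5)])
    then have "v' = - v" "v\<^sup>2 = 1/2"
      using double[of v v'] l by auto
    moreover have "v = s"
    proof (rule ccontr)
      assume "v \<noteq> s"
      then have "v = - s"
        using root[of v s] \<open>v\<^sup>2 = 1/2\<close> s(1) by simp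
      then show False
        using sD.E.classical_asym[OF s(2)] *(5) l \<open>v' = - v\<close> by simp
    qed
    ultimately show "\<exists>\<eta>. ((l, v), (l', v'), \<eta>) \<in> X"
      using l by (simp add: X_def)
  qed
  have X': "sD'.crossings_of {}"
    using sD'.crossings_of_graphs[of "\<lambda>_ _. 0" "\<lambda>_ _. 0"] inj by simp
  show ?thesis
    by (rule local_pair.enhanced_isomorphic_local[OF pair[OF X X']])
      (use strands_first_move[OF X_def s0(1,2)] strands_generate_none in auto)
qed

lemma abs_has_real_derivative:
  fixes v :: real
  assumes "v \<noteq> 0"
  shows "((\<lambda>v. \<bar>v\<bar>) has_real_derivative sgn v) (at v)"
proof -
  have "((\<lambda>x. sgn v * x) has_real_derivative sgn v) (at v)"
    by (auto intro!: derivative_eq_intros)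
  then show ?thesis
    by (rule has_field_derivative_transform_within_open[where S = "{x. 0 < sgn v * x}"])
      (use assms in \<open>auto simp: sgn_if intro!: open_Collect_less continuous_intros split: if_splits\<close>)
qed

lemma reidemeister2_invariance:
  assumes D: "link_diagram D" and D': "link_diagram D'" and move: "reidemeister2 D D'"
  shows "enhanced_isomorphic D D'"
proof -
  let ?T = "\<lambda>(l::nat) v. if l = 0 then Complex v 0 else Complex v (\<bar>v\<bar> - 1/2)"
  let ?T' = "\<lambda>(l::nat) v. if l = 0 then Complex v 0 else Complex v (1/2)"
  obtain c m k h where ds: "diagram_strands 2 c m k D ?T h" "diagram_strands 2 c m k D' ?T' h"
      and inj: "inj_on h {..<2::nat}"
    and pair: "\<And>X X'. diagram_strands.crossings_of 2 c m k D X \<Longrightarrow>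
      diagram_strands.crossings_of 2 c m k D' X' \<Longrightarrow> local_pair 2 c m k D D' X X'"
    by (rule local_move_obtain[OF D D' move[unfolded reidemeister2_def]]) (auto simp: square_def)
  interpret sD: diagram_strands 2 c m k D ?T h by (rule ds)
  interpret sD': diagram_strands 2 c m k D' ?T' h by (rule ds)
  define f s :: "nat \<Rightarrow> real \<Rightarrow> real"
    where "f l v = (if l = 0 then 0 else \<bar>v\<bar> - 1/2)" and "s l v = (if l = 0 then 0 else sgn v)" for l v
  have "h 0 \<noteq> h 1"
    using inj_on_eq_iff[OF inj, of 0 1] by simp
  then obtain a b :: nat where ab: "a < 2" "b < 2" "a \<noteq> b" "h b < h a"
    using that[of 0 1] that[of 1 0] by (cases "h 1 < h 0") auto
  define X :: "strand_crossing set" where "X = {((a, - 1/2), (b, - 1/2), k a > 0 \<longleftrightarrow> s a (- 1/2) < s b (- 1/2)),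
    ((a, 1/2), (b, 1/2), \<not> (k a > 0 \<longleftrightarrow> s a (- 1/2) < s b (- 1/2)))}"
  have two: "i = 0 \<or> i = 1" if "i < 2" for i :: nat
    using that by auto
  have meet: "f i v = f j v \<longleftrightarrow> v = 1/2 \<or> v = - 1/2" if "i < 2" "j < 2" "i \<noteq> j" for i j v
    using two[OF that(1)] two[OF that(2)] that(3) by (auto simp: f_def)
  have pairs: "h j < h i \<longleftrightarrow> i = a \<and> j = b" if "i < 2" "j < 2" for i j
    using two[OF that(1)] two[OF that(2)] two[OF ab(1)] two[OF ab(2)] ab(3,4) by auto
  have two_values: "{F v |v. v = x \<or> v = y} = {F x, F y}" for F :: "real \<Rightarrow> strand_crossing" and x y
    by blast
  \<comment> \<open>The slope of the bent strand is \<open>sgn v\<close>, that of the straight one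
    is 0, so the comparison of slopes is reversed between the two crossings. This is the opposite
    flag required by \<open>strands_second_move\<close>.\<close>
  have flip: "(s a (1/2) < s b (1/2)) = (\<not> s a (- 1/2) < s b (- 1/2))"
    using two[OF ab(1)] two[OF ab(2)] ab(3) by (auto simp: s_def)
  have "{((i, v), (j, v), k i > 0 \<longleftrightarrow> s i v < s j v) |i j v.
      i < 2 \<and> j < 2 \<and> h j < h i \<and> \<bar>v\<bar> \<le> 1 \<and> f i v = f j v} =
    {((a, v), (b, v), k a > 0 \<longleftrightarrow> s a v < s b v) |v. v = 1/2 \<or> v = - 1/2}"
  proof -
    have "(i < 2 \<and> j < 2 \<and> h j < h i \<and> \<bar>v\<bar> \<le> 1 \<and> f i v = f j v) \<longleftrightarrow>
        i = a \<and> j = b \<and> (v = 1/2 \<or> v = - 1/2)" for i j :: nat and v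
      using pairs[of i j] meet[of a b v] ab by auto
    then show ?thesis
      by simp
  qed
  also have "\<dots> = {((a, 1/2), (b, 1/2), k a > 0 \<longleftrightarrow> s a (1/2) < s b (1/2)),
      ((a, - 1/2), (b, - 1/2), k a > 0 \<longleftrightarrow> s a (- 1/2) < s b (- 1/2))}"
    by (rule two_values)
  also have "\<dots> = X"
    unfolding X_def using flip by auto
  finally have X_eq: "{((i, v), (j, v), k i > 0 \<longleftrightarrow> s i v < s j v) |i j v.
      i < 2 \<and> j < 2 \<and> h j < h i \<and> \<bar>v\<bar> \<le> 1 \<and> f i v = f j v} = X" .
  have der: "(f i has_real_derivative s i v) (at v)" if "v \<noteq> 0" for i v
  proof (cases "i = 0")
    case False
    then have "f i = (\<lambda>v. \<bar>v\<bar> - 1/2)" "s i v = sgn v"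
      by (auto simp: f_def s_def)
    then show ?thesis
      using abs_has_real_derivative[OF that] by (auto intro!: derivative_eq_intros)
  next
    case True
    then have "f i = (\<lambda>v. 0)" "s i v = 0"
      by (auto simp: f_def s_def)
    then show ?thesis
      by simp
  qed
  have slopes: "s i v \<noteq> s j v" if "i < 2" "j < 2" "i \<noteq> j" "v \<noteq> 0" for i j v
    using two[OF that(1)] two[OF that(2)] that(3,4) by (auto simp: s_def sgn_if)
  have X: "sD.crossings_of X"
    unfolding X_eq[symmetric]
  proof (intro sD.crossings_of_graphs inj)
    fix i j :: nat and v assume *: "i < 2" "j < 2" "i \<noteq> j" "f i v = f j v"
    then have "v \<noteq> 0" "\<bar>v\<bar> < 3/4"
      using meet by auto
    then show "\<bar>v\<bar> < 3/4 \<and> (f i has_real_derivative s i v) (at v) \<and> s i v \<noteq> s j v"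
      using der slopes[OF *(1-3)] by blast
  qed (simp add: f_def)
  define f' :: "nat \<Rightarrow> real \<Rightarrow> real" where "f' l v = (if l = 0 then 0 else 1/2)" for l v
  have ne: "f' i v \<noteq> f' j v" if "i < 2" "j < 2" "i \<noteq> j" for i j v
    using two[OF that(1)] two[OF that(2)] that(3) by (auto simp: f'_def)
  have "sD'.crossings_of {((a, v), (b, v), k a > 0 \<longleftrightarrow> (0::real) < 0) |a b v.
    a < 2 \<and> b < 2 \<and> h b < h a \<and> \<bar>v\<bar> \<le> 1 \<and> f' a v = f' b v}"
    by (intro sD'.crossings_of_graphs inj) (auto simp: f'_def dest: ne)
  moreover have "{((a, v), (b, v), k a > 0 \<longleftrightarrow> (0::real) < 0) |a b v.
    a < 2 \<and> b < 2 \<and> h b < h a \<and> \<bar>v\<bar> \<le> 1 \<and> f' a v = f' b v} = {}"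
    using ne by fastforce
  ultimately have X': "sD'.crossings_of {}"
    by (simp only:)
  show ?thesis
    by (rule local_pair.enhanced_isomorphic_local[OF pair[OF X X']])
      (use strands_second_move[OF ab(1-3) X_def] strands_generate_none in auto)
qed

text \<open>
  In the third move the strands \<open>a\<close> and \<open>b\<close> cross at \<open>v = meet a b\<close> before the move and at
  \<open>v = - meet a b\<close> after the move; \<open>steeper b a\<close> compares their slopes there.
\<close>

definition meet :: "nat \<Rightarrow> nat \<Rightarrow> real" where
  "meet a b = (if a + b = 1 then 0 else if a + b = 2 then 1/3 else - 1/3)"

definition steeper :: "nat \<Rightarrow> nat \<Rightarrow> bool" where
  "steeper b a \<longleftrightarrow> (a, b) \<in> {(1, 0), (2, 0), (1, 2)}"

text \<open>Both positions of the roof at once, \<open>e = 1\<close> above and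
  \<open>e = - 1\<close> below. The roof meets the rising diagonal at e/3 with slope -1/2 and the
  falling one at -e/3 with slope 1/2. These slopes do not depend on \<open>e\<close>, so the move
  keeps the flags and only negates the parameters.\<close>

lemma (in diagram_strands) crossings_of_roof:
  assumes n: "n = 3" and e: "e = 1 \<or> e = -1"
    and T: "\<And>l v. l < n \<Longrightarrow> T l v = Complex v (if l = 0 then v else if l = 1 then - v else e * ((1 - \<bar>v\<bar>) / 2))"
    and inj: "inj_on h {..<n}"
    and lt: "\<tau> < 3" "\<mu> < 3" "\<beta> < 3" and h: "h \<beta> < h \<mu>" "h \<mu> < h \<tau>"
  shows "crossings_of (triangle \<tau> \<mu> \<beta> (k \<tau> > 0 \<longleftrightarrow> steeper \<mu> \<tau>) (k \<tau> > 0 \<longleftrightarrow> steeper \<beta> \<tau>)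
    (k \<mu> > 0 \<longleftrightarrow> steeper \<beta> \<mu>) (e * meet \<tau> \<mu>) (e * meet \<tau> \<beta>) (e * meet \<mu> \<beta>))"
proof -
  define f s :: "nat \<Rightarrow> real \<Rightarrow> real"
    where "f l v = (if l = 0 then v else if l = 1 then - v else e * ((1 - \<bar>v\<bar>) / 2))"
      and "s l v = (if l = 0 then 1 else if l = 1 then - 1 else e * (- sgn v / 2))" for l v
  have three: "i = 0 \<or> i = 1 \<or> i = 2" if "i < 3" for i :: nat
    using that by auto
  have meet: "f i v = f j v \<longleftrightarrow> v = e * meet i j" if "i < 3" "j < 3" "i \<noteq> j" for i j v
    using e three[OF that(1)] three[OF that(2)] that(3) by (auto simp: f_def meet_def abs_if)
  have slope: "s i (e * meet i j) < s j (e * meet i j) \<longleftrightarrow> steeper j i"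
    "s i (e * meet i j) \<noteq> s j (e * meet i j)" if "i < 3" "j < 3" "i \<noteq> j" for i j
    using e three[OF that(1)] three[OF that(2)] that(3) by (auto simp: s_def meet_def steeper_def)
  have small: "\<bar>e * meet i j\<bar> < 3/4" for i j
    using e by (auto simp: meet_def)
  have der: "(f i has_real_derivative s i v) (at v)" if "i = 2 \<longrightarrow> v \<noteq> 0" "i < 3" for i v
  proof -
    from three[OF that(2)] consider "i = 0" | "i = 1" | "i = 2"
      by blast
    then show ?thesis
    proof cases
      case 3
      then have "f i = (\<lambda>v. e * ((1 - \<bar>v\<bar>) / 2))" "s i v = e * (- sgn v / 2)"
        by (auto simp: f_def s_def)
      then show ?thesis
        using abs_has_real_derivative[of v] that(1) 3 by (auto intro!: derivative_eq_intros)
    next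
      case 1
      then have "f i = (\<lambda>v. v)" "s i v = 1"
        by (auto simp: f_def s_def)
      then show ?thesis
        by simp
    next
      case 2
      then have "f i = (\<lambda>v. - v)" "s i v = - 1"
        by (auto simp: f_def s_def)
      then show ?thesis
        by (auto intro!: derivative_eq_intros)
    qed
  qed
  have nz: "e * meet i j \<noteq> 0" if "i < 3" "j < 3" "i \<noteq> j" "i = 2 \<or> j = 2" for i j
    using e that by (auto simp: meet_def)
  have ne: "\<tau> \<noteq> \<mu>" "\<tau> \<noteq> \<beta>" "\<mu> \<noteq> \<beta>"
    using h by auto
  have all: "i = \<tau> \<or> i = \<mu> \<or> i = \<beta>" if "i < 3" for i
    using that lt ne by auto
  have iff: "(i < 3 \<and> j < 3 \<and> h j < h i \<and> \<bar>v\<bar> \<le> 1 \<and> f i v = f j v) \<longleftrightarrow>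
      (i, j) \<in> {(\<tau>, \<mu>), (\<tau>, \<beta>), (\<mu>, \<beta>)} \<and> v = e * meet i j" for i j v
  proof -
    have "i < 3 \<and> j < 3 \<and> h j < h i \<longleftrightarrow> (i, j) \<in> {(\<tau>, \<mu>), (\<tau>, \<beta>), (\<mu>, \<beta>)}"
      using all[of i] all[of j] h lt by auto
    moreover have "(\<bar>v\<bar> \<le> 1 \<and> f i v = f j v) \<longleftrightarrow> v = e * meet i j" if "i < 3" "j < 3" "h j < h i"
      using meet[OF that(1,2), of v] that(3) small[of i j] by auto
    ultimately show ?thesis
      by blast
  qed
  have image: "{F i j v |i j v. (i, j) \<in> S \<and> v = g i j} = (\<lambda>(i, j). F i j (g i j)) ` S"
    for F :: "nat \<Rightarrow> nat \<Rightarrow> real \<Rightarrow> strand_crossing" and g S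
    by force
  have set_eq: "{((i, v), (j, v), k i > 0 \<longleftrightarrow> s i v < s j v) |i j v.
      i < 3 \<and> j < 3 \<and> h j < h i \<and> \<bar>v\<bar> \<le> 1 \<and> f i v = f j v} =
    triangle \<tau> \<mu> \<beta> (k \<tau> > 0 \<longleftrightarrow> steeper \<mu> \<tau>) (k \<tau> > 0 \<longleftrightarrow> steeper \<beta> \<tau>)
      (k \<mu> > 0 \<longleftrightarrow> steeper \<beta> \<mu>) (e * meet \<tau> \<mu>) (e * meet \<tau> \<beta>) (e * meet \<mu> \<beta>)"
  proof -
    have "{((i, v), (j, v), k i > 0 \<longleftrightarrow> s i v < s j v) |i j v.
        (i, j) \<in> {(\<tau>, \<mu>), (\<tau>, \<beta>), (\<mu>, \<beta>)} \<and> v = e * meet i j} =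
      (\<lambda>(i, j). ((i, e * meet i j), (j, e * meet i j), k i > 0 \<longleftrightarrow> s i (e * meet i j) < s j (e * meet i j))) `
        {(\<tau>, \<mu>), (\<tau>, \<beta>), (\<mu>, \<beta>)}"
      by (rule image)
    then show ?thesis
      unfolding iff triangle_def by (simp add: slope(1) lt ne)
  qed
  have graph: "\<bar>v\<bar> < 3/4 \<and> (f i has_real_derivative s i v) (at v) \<and> s i v \<noteq> s j v"
    if "i < 3" "j < 3" "i \<noteq> j" "f i v = f j v" for i j v
  proof -
    have v: "v = e * meet i j"
      using meet[OF that(1-3)] that(4) by blast
    have "i = 2 \<longrightarrow> v \<noteq> 0"
      using nz[OF that(1-3)] unfolding v by blast
    from der[OF this that(1)] show ?thesis
      using slope(2)[OF that(1-3)] small[of i j] unfolding v by blast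
  qed
  have "crossings_of {((i, v), (j, v), k i > 0 \<longleftrightarrow> s i v < s j v) |i j v.
      i < n \<and> j < n \<and> h j < h i \<and> \<bar>v\<bar> \<le> 1 \<and> f i v = f j v}"
  proof (intro crossings_of_graphs inj)
    fix l v assume "l < n"
    then show "T l v = Complex v (f l v)"
      unfolding f_def by (rule T)
  next
    fix i j v assume "i < n" "j < n" "i \<noteq> j" "f i v = f j v"
    then show "\<bar>v\<bar> < 3/4 \<and> (f i has_real_derivative s i v) (at v) \<and> s i v \<noteq> s j v"
      unfolding n by (rule graph)
  qed
  then show ?thesis
    by (simp only: n set_eq)
qed

lemma reidemeister3_invariance:
  assumes D: "link_diagram D" and D': "link_diagram D'" and move: "reidemeister3 D D'"
  shows "enhanced_isomorphic D D'"
proof -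
  let ?T = "\<lambda>(l::nat) v. if l = 0 then Complex v v else if l = 1 then Complex v (- v)
       else Complex v ((1 - \<bar>v\<bar>) / 2)"
  let ?T' = "\<lambda>(l::nat) v. if l = 0 then Complex v v else if l = 1 then Complex v (- v)
       else Complex v (- (1 - \<bar>v\<bar>) / 2)"
  obtain c m k h where ds: "diagram_strands 3 c m k D ?T h" "diagram_strands 3 c m k D' ?T' h"
      and inj: "inj_on h {..<3::nat}"
    and pair: "\<And>X X'. diagram_strands.crossings_of 3 c m k D X \<Longrightarrow>
      diagram_strands.crossings_of 3 c m k D' X' \<Longrightarrow> local_pair 3 c m k D D' X X'"
    by (rule local_move_obtain[OF D D' move[unfolded reidemeister3_def]]) (auto simp: square_def)
  interpret sD: diagram_strands 3 c m k D ?T h by (rule ds)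
  interpret sD': diagram_strands 3 c m k D' ?T' h by (rule ds)
  have "h 0 \<noteq> h 1" "h 0 \<noteq> h 2" "h 1 \<noteq> h 2"
    using inj_on_eq_iff[OF inj, of 0 1] inj_on_eq_iff[OF inj, of 0 2] inj_on_eq_iff[OF inj, of 1 2] by simp_all
  then have "\<exists>\<tau> \<mu> \<beta>. \<tau> < 3 \<and> \<mu> < 3 \<and> \<beta> < 3 \<and> h \<beta> < h \<mu> \<and> h \<mu> < h \<tau>"
  proof -
    assume h: "h 0 \<noteq> h 1" "h 0 \<noteq> h 2" "h 1 \<noteq> h 2"
    have w: ?thesis if "i < 3" "j < 3" "l < 3" "h l < h j" "h j < h i" for i j l
      using that by blast
    show ?thesis
      by (cases "h 0 < h 1"; cases "h 0 < h 2"; cases "h 1 < h 2")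
        (use h w[of 0 1 2] w[of 0 2 1] w[of 1 0 2] w[of 1 2 0] w[of 2 0 1] w[of 2 1 0] in \<open>simp; linarith\<close>)+
  qed
  then obtain \<tau> \<mu> \<beta> where lt: "\<tau> < 3" "\<mu> < 3" "\<beta> < 3" and h: "h \<beta> < h \<mu>" "h \<mu> < h \<tau>"
    by blast
  have ne: "\<tau> \<noteq> \<mu>" "\<tau> \<noteq> \<beta>" "\<mu> \<noteq> \<beta>"
    using h by auto
  define X where "X e = triangle \<tau> \<mu> \<beta> (k \<tau> > 0 \<longleftrightarrow> steeper \<mu> \<tau>) (k \<tau> > 0 \<longleftrightarrow> steeper \<beta> \<tau>)
    (k \<mu> > 0 \<longleftrightarrow> steeper \<beta> \<mu>) (e * meet \<tau> \<mu>) (e * meet \<tau> \<beta>) (e * meet \<mu> \<beta>)" for e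
  have X: "sD.crossings_of (X 1)" "sD'.crossings_of (X (- 1))"
    unfolding X_def
    by (rule sD.crossings_of_roof sD'.crossings_of_roof; use inj lt h in simp)+
  have cases3: "\<tau> = 0 \<and> \<mu> = 1 \<and> \<beta> = 2 \<or> \<tau> = 0 \<and> \<mu> = 2 \<and> \<beta> = 1 \<or> \<tau> = 1 \<and> \<mu> = 0 \<and> \<beta> = 2 \<or>
      \<tau> = 1 \<and> \<mu> = 2 \<and> \<beta> = 0 \<or> \<tau> = 2 \<and> \<mu> = 0 \<and> \<beta> = 1 \<or> \<tau> = 2 \<and> \<mu> = 1 \<and> \<beta> = 0"
  proof -
    have three: "i = 0 \<or> i = 1 \<or> i = 2" if "i < 3" for i :: nat
      using that by auto
    show ?thesis
      using three[OF lt(1)] three[OF lt(2)] three[OF lt(3)] ne by (elim disjE) simp_all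
  qed
  have tri: "triangle_strands \<tau> \<mu> \<beta> (e * meet \<tau> \<mu>) (e * meet \<tau> \<beta>) (e * meet \<mu> \<beta>)" if "e = 1 \<or> e = - 1" for e
    using that cases3 unfolding triangle_strands_def by (elim disjE; simp add: meet_def)
  \<comment> \<open>Negating the parameters reverses their order, as the first two conditions
    demand. The third, that the two lower strands meet on one side of the top strand, is checked for
    each of the six possible height orders.\<close>
  have order: "e * meet \<tau> \<beta> < e * meet \<mu> \<beta> \<longleftrightarrow> - e * meet \<mu> \<beta> < - e * meet \<tau> \<beta>"
      "e * meet \<tau> \<mu> < e * meet \<mu> \<beta> \<longleftrightarrow> - e * meet \<mu> \<beta> < - e * meet \<tau> \<mu>"
      "(k \<tau> > 0 \<longleftrightarrow> steeper \<mu> \<tau>) = (k \<tau> > 0 \<longleftrightarrow> steeper \<beta> \<tau>) \<longleftrightarrow>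
        (e * meet \<tau> \<beta> < e * meet \<mu> \<beta> \<longleftrightarrow> e * meet \<tau> \<mu> < e * meet \<mu> \<beta>)" if "e = 1 \<or> e = - 1" for e
    using that cases3 by (elim disjE; simp add: meet_def steeper_def)+
  have third: "strands_extend 3 (X e) (X (- e))" "strands_generate 3 (X e)" if e: "e = 1 \<or> e = - 1" for e
    unfolding X_def
    by (rule strands_third_move[OF tri[OF e] tri order[OF e]]; use e in argo)+
  show ?thesis
    using local_pair.enhanced_isomorphic_local[OF pair[OF X]] third[of 1] third[of "- 1"] by simp
qed

section \<open>Equivalent diagrams\<close>

lemma diagram_move_invariance:
  assumes "diagram_move D D'"
  shows "enhanced_isomorphic D D'"
  using assms by cases (blast intro: reparametrization_invariance planar_isotopy_invariance
    detour_move_invariance reidemeister1_invariance reidemeister2_invariance reidemeister3_invariance)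

theorem theorem5:
  fixes D D' :: diagram and \<mu> :: nat
  assumes "link_diagram D" and "ncomp D = \<mu>"
    and "link_diagram D'" and "ncomp D' = \<mu>"
    and "diagram_equivalent D D'"
  shows "\<exists>f. f \<in> enhanced_iso \<mu> (M_enr D) (M_enr D')"
proof -
  have "equivclp diagram_move D D'"
    using assms(5) by (simp add: diagram_equivalent_def)
  then have "enhanced_isomorphic D D'"
  proof (induction rule: equivclp_induct)
    case base
    show ?case
      by (rule enhanced_isomorphic_refl)
  next
    case (step E F)
    have "enhanced_isomorphic E F"
      using step(2)
    proof
      assume move: "diagram_move F E"
      then have "link_diagram F"
        by cases
      then show ?thesis
        using enhanced_isomorphic_sym diagram_move_invariance[OF move] by blast
    qed (rule diagram_move_invariance)
    then show ?case
      using step.IH enhanced_isomorphic_trans by blast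
  qed
  then show ?thesis
    unfolding enhanced_isomorphic_def assms(2) by blast
qed

end
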